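(* Let $N\geq 2$ and let $\Omega\subset\mathbb{R}^N$ be a smooth bounded domain containing the origin. For any $0\leq\gamma<\gamma_1$, $0\leq\beta<N$ and $p>1$, $$\Lambda:=\sup_{u\in W_0^{1,N}(\Omega),\ \|u\|_{\gamma,p,F}\leq 1}\int_\Omega \frac{e^{\lambda_N(1-\frac{\beta}{N})|u|^{\frac{N}{N-1}}}}{F^o(x)^\beta}\,\mathrm{d}x<+\infty .$$
   Context: $F:\mathbb{R}^N\to[0,+\infty)$ is a convex function of class $C^2(\mathbb{R}^N\setminus\{0\})$, even and positively homogeneous of degree 1 (so $F(tx)=|t|F(x)$ for all $t\in\mathbb{R}$, $x\in\mathbb{R}^N$), with $F(x)>0$ for $x\neq0$ and $\mathrm{Hess}(F^2)$ positive definite on $\mathbb{R}^N\setminus\{0\}$. $F^o(x):=\sup_{\xi\in K}\langle x,\xi\rangle$ where $K=\{\xi: F(\xi)\leq 1\}$. $\kappa_N$ is the Lebesgue measure of the Wulff ball $W_1=\{x:F^o(x)\leq1\}$, and $\lambda_N=N^{\frac{N}{N-1}}\kappa_N^{\frac{1}{N-1}}$. $\gamma_1:=\inf_{u\in W_0^{1,N}(\Omega)\setminus\{0\}}\frac{\int_\Omega F(\nabla u)^N\,\mathrm{d}x}{\|u\|_p^N}$, and $\|u\|_{\gamma,p,F}:=\left(\int_\Omega F(\nabla u)^N\,\mathrm{d}x-\gamma\|u\|_p^N\right)^{1/N}$, where $\|\cdot\|_p$ is the $L^p(\Omega)$ norm. *)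

theory Defs
  imports "HOL-Analysis.Analysis"
begin

coinductive smooth_on :: "(real^'n) set \<Rightarrow> (real^'n \<Rightarrow> real) \<Rightarrow> bool" where
  "continuous_on S f \<Longrightarrow>
   (\<forall>i. \<exists>g. (\<forall>x\<in>S. ((\<lambda>t. f (x + t *\<^sub>R axis i 1)) has_real_derivative g x) (at 0))
             \<and> smooth_on S g) \<Longrightarrow>
   smooth_on S f"

text \<open>Bounded domain (open, connected) whose boundary is a smooth hypersurface, given by a
  global smooth defining function with nonvanishing gradient on its zero set.\<close>

definition smooth_bounded_domain :: "(real^'n) set \<Rightarrow> bool" where
  "smooth_bounded_domain \<Omega> \<longleftrightarrow> open \<Omega> \<and> connected \<Omega> \<and> bounded \<Omega> \<and> \<Omega> \<noteq> {} \<and>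
     (\<exists>\<rho>. smooth_on UNIV \<rho> \<and> \<Omega> = {x. \<rho> x < 0} \<and>
          (\<forall>x. \<rho> x = 0 \<longrightarrow> \<not> (\<rho> has_derivative (\<lambda>h. 0)) (at x)))"

definition anisotropic_F :: "(real^'n \<Rightarrow> real) \<Rightarrow> bool" where
  "anisotropic_F F \<longleftrightarrow>
     (\<forall>x. F x \<ge> 0) \<and> convex_on UNIV F \<and>
     (\<forall>t x. F (t *\<^sub>R x) = \<bar>t\<bar> * F x) \<and>
     (\<forall>x. x \<noteq> 0 \<longrightarrow> F x > 0) \<and>
     \<comment> \<open>F is of class C^2 on R^N minus the origin\<close>
     (\<exists>grad H. \<forall>x. x \<noteq> 0 \<longrightarrow>
        (F has_derivative (\<lambda>h. grad x \<bullet> h)) (at x) \<and>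
        (grad has_derivative (\<lambda>h. H x *v h)) (at x) \<and>
        continuous (at x) H) \<and>
     \<comment> \<open>Hess(F^2) is positive definite on R^N minus the origin\<close>
     (\<exists>grad2 H2. \<forall>x. x \<noteq> 0 \<longrightarrow>
        ((\<lambda>y. (F y)\<^sup>2) has_derivative (\<lambda>h. grad2 x \<bullet> h)) (at x) \<and>
        (grad2 has_derivative (\<lambda>h. H2 x *v h)) (at x) \<and>
        (\<forall>v. v \<noteq> 0 \<longrightarrow> v \<bullet> (H2 x *v v) > 0))"

definition polar_F :: "(real^'n \<Rightarrow> real) \<Rightarrow> real^'n \<Rightarrow> real" where
  "polar_F F x = Sup {x \<bullet> \<xi> | \<xi>. F \<xi> \<le> 1}"

definition kappa_N :: "(real^'n \<Rightarrow> real) \<Rightarrow> real" where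
  "kappa_N F = measure lebesgue {x. polar_F F x \<le> 1}"

definition lambda_N :: "(real^'n \<Rightarrow> real) \<Rightarrow> real" where
  "lambda_N F = (let N = real CARD('n) in N powr (N / (N - 1)) * kappa_N F powr (1 / (N - 1)))"

text \<open>\<open>W0 \<Omega> q u g\<close>: u belongs to W_0^{1,q}(Omega) with weak gradient g, i.e. (u,g) is the
  W^{1,q} limit of gradients of C_c^infinity(Omega) functions. Functions are defined on all of
  R^N (extended by zero outside Omega).\<close>

definition W0 :: "(real^'n) set \<Rightarrow> real \<Rightarrow> (real^'n \<Rightarrow> real) \<Rightarrow> (real^'n \<Rightarrow> real^'n) \<Rightarrow> bool" where
  "W0 \<Omega> q u g \<longleftrightarrow> u \<in> borel_measurable lebesgue \<and> g \<in> borel_measurable lebesgue \<and>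
     (\<exists>\<phi> G. (\<forall>k. smooth_on UNIV (\<phi> k) \<and> compact (closure {x. \<phi> k x \<noteq> 0}) \<and>
                  closure {x. \<phi> k x \<noteq> 0} \<subseteq> \<Omega> \<and>
                  (\<forall>x. (\<phi> k has_derivative (\<lambda>h. G k x \<bullet> h)) (at x))) \<and>
        (\<lambda>k. \<integral>\<^sup>+ x. ennreal (\<bar>\<phi> k x - u x\<bar> powr q) \<partial>lebesgue) \<longlonglongrightarrow> 0 \<and>
        (\<lambda>k. \<integral>\<^sup>+ x. ennreal (norm (G k x - g x) powr q) \<partial>lebesgue) \<longlonglongrightarrow> 0)"

definition Lp_norm :: "(real^'n) set \<Rightarrow> real \<Rightarrow> (real^'n \<Rightarrow> real) \<Rightarrow> real" where
  "Lp_norm \<Omega> p u = enn2real (\<integral>\<^sup>+ x\<in>\<Omega>. ennreal (\<bar>u x\<bar> powr p) \<partial>lebesgue) powr (1 / p)"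

definition F_energy :: "(real^'n \<Rightarrow> real) \<Rightarrow> (real^'n) set \<Rightarrow> (real^'n \<Rightarrow> real^'n) \<Rightarrow> real" where
  "F_energy F \<Omega> g = enn2real (\<integral>\<^sup>+ x\<in>\<Omega>. ennreal (F (g x) ^ CARD('n)) \<partial>lebesgue)"

definition gamma_1 :: "(real^'n \<Rightarrow> real) \<Rightarrow> (real^'n) set \<Rightarrow> real \<Rightarrow> real" where
  "gamma_1 F \<Omega> p = Inf {F_energy F \<Omega> g / Lp_norm \<Omega> p u ^ CARD('n) | u g.
       W0 \<Omega> (real CARD('n)) u g \<and> \<not> (AE x in lebesgue. u x = 0)}"

definition gamma_norm :: "(real^'n \<Rightarrow> real) \<Rightarrow> (real^'n) set \<Rightarrow> real \<Rightarrow> real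
    \<Rightarrow> (real^'n \<Rightarrow> real) \<Rightarrow> (real^'n \<Rightarrow> real^'n) \<Rightarrow> real" where
  "gamma_norm F \<Omega> \<gamma> p u g =
     (F_energy F \<Omega> g - \<gamma> * Lp_norm \<Omega> p u ^ CARD('n)) powr (1 / real CARD('n))"

end

theory Submission
  imports Defs
begin

text \<open>The argument uses neither rearrangement nor blow-up. Integrating \<open>\<phi>\<close> along rays from \<open>x\<close> and averaging over
  the Wulff ball gives \<open>\<bar>\<phi> x\<bar> \<le> (N \<kappa>)\<^sup>-\<^sup>1 \<integral> F (\<nabla>\<phi> y) F\<^sup>o (x - y) powr (1 - N) dy\<close>, and the same bound
  for truncations of \<open>\<bar>\<phi>\<bar>\<close> between two levels \<open>a < b\<close> with the integral restricted to \<open>a < \<bar>\<phi>\<bar> < b\<close>. Averaging this over the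
  superlevel set at \<open>b\<close> and using Hoelder's inequality yields, with \<open>e(a, b)\<close> the energy between the levels,
  \<open>\<lambda>\<^sub>N (b - a)^(N/(N-1)) \<le> e(a, b)^(1/(N-1)) (ln (\<bar>{\<bar>\<phi>\<bar> > a}\<bar> / \<bar>{\<bar>\<phi>\<bar> \<ge> b}\<bar>) + C)\<close>
  with the sharp constant \<open>\<lambda>\<^sub>N\<close>. A counting argument of Adams--Garsia type turns this family of weak estimates into the
  strong exponential bound for energy at most one. For the problem with \<open>\<gamma>\<close>, one finds a level \<open>M\<close> below which
  the energy is at least \<open>\<gamma> \<parallel>\<phi>\<parallel>\<^sub>p^N + c M^N\<close>; then \<open>max 0 (\<bar>\<phi>\<bar> - M)\<close> has energy at most \<open>1 - c M^N\<close>, and this slack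
  absorbs the shift by \<open>M\<close> in the exponent.\<close>

section \<open>Elementary inequalities and the Adams--Garsia lemma\<close>

text \<open>The difficulty is criticality. If m_n is the measure of the level set on which the
  normalised exponent is at least n, a one-level estimate only gives m_n \<le> V e^(C - n): every
  term (e^n m_n / V)^\<alpha> is bounded, but nothing makes their sum converge. In such estimates an
  error may stand beside the logarithm as an additive constant, but never in front of it as a
  factor. This dictates the handling of the kernel: its critical power is a multiple of \<rho>^(-N),
  which is not integrable at the pole, and exactly the annulus between the Wulff balls with the two
  measures yields the logarithm with the right coefficient. The parts nearer and farther are bounded
  crudely and go into C. For \<gamma> > 0 the gain and the loss have matching homogeneity: reserving
  energy s of order M^N costs s^(1-q) M^q in the exponent, with q = N/(N-1), and this is independent
  of M. A gain at some uncontrolled level M therefore suffices.\<close>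

lemma powr_add_le_convex:
  fixes a b \<tau> p :: real
  assumes "0 \<le> a" "0 \<le> b" "0 < \<tau>" "\<tau> < 1" "1 \<le> p"
  shows "(a + b) powr p \<le> (1 - \<tau>) powr (1 - p) * a powr p + \<tau> powr (1 - p) * b powr p"
proof (cases "a = 0 \<or> b = 0")
  case True
  have "1 \<le> (1 - \<tau>) powr (1 - p)" "1 \<le> \<tau> powr (1 - p)"
    using assms powr_mono'[of "1 - p" 0 \<tau>] powr_mono'[of "1 - p" 0 "1 - \<tau>"] by auto
  then have "a powr p \<le> (1 - \<tau>) powr (1 - p) * a powr p" "b powr p \<le> \<tau> powr (1 - p) * b powr p"
    using mult_right_mono[of 1 _ "a powr p"] mult_right_mono[of 1 _ "b powr p"] by auto
  then show ?thesis using True by auto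
next
  case False
  have cv: "convex_on {0<..} (\<lambda>x::real. x powr p)"
    using powr_convex[OF assms(5)] .
  have "((1 - \<tau>) *\<^sub>R (a / (1 - \<tau>)) + \<tau> *\<^sub>R (b / \<tau>)) powr p
      \<le> (1 - \<tau>) * (a / (1 - \<tau>)) powr p + \<tau> * (b / \<tau>) powr p"
    using convex_onD[OF cv, of \<tau> "a / (1 - \<tau>)" "b / \<tau>"] assms False by simp
  also have "(1 - \<tau>) *\<^sub>R (a / (1 - \<tau>)) + \<tau> *\<^sub>R (b / \<tau>) = a + b"
    using assms by simp
  also have "(1 - \<tau>) * (a / (1 - \<tau>)) powr p = (1 - \<tau>) powr (1 - p) * a powr p"
    using assms by (simp add: powr_divide powr_diff)
  also have "\<tau> * (b / \<tau>) powr p = \<tau> powr (1 - p) * b powr p"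
    using assms by (simp add: powr_divide powr_diff)
  finally show ?thesis .
qed

text \<open>The graph of x^q lies above its tangent at H. In this form convexity can be averaged
  over k with H fixed. In \<open>level_estimate\<close> the fixed value is the mean of k, so this
  becomes Jensen's inequality with room to modify k^q near its singularity.\<close>

lemma powr_tangent_le:
  fixes H k q :: real
  assumes "0 \<le> H" "0 \<le> k" "1 < q"
  shows "q * H powr (q - 1) * k - (q - 1) * H powr q \<le> k powr q"
proof -
  define s where "s = q / (q - 1)"
  have s: "s > 1" "1 / q + 1 / s = 1"
    using assms unfolding s_def by (simp_all add: field_simps)
  have "k * H powr (q - 1) \<le> k powr q / q + (H powr (q - 1)) powr s / s"
    by (rule Youngs_inequality) (use assms s in auto)
  also have "(H powr (q - 1)) powr s = H powr q"
    using assms unfolding s_def by (simp add: powr_powr)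
  also have "H powr q / s = H powr q * (q - 1) / q"
    unfolding s_def by simp
  finally have "q * (k * H powr (q - 1)) \<le> q * (k powr q / q + H powr q * (q - 1) / q)"
    using assms by (intro mult_left_mono) auto
  also have "\<dots> = k powr q + (q - 1) * H powr q"
    using assms by (simp add: field_simps)
  finally show ?thesis by (simp add: algebra_simps)
qed

lemma one_minus_powr_le:
  fixes b r :: real
  assumes "0 \<le> b" "b \<le> 1" "0 < r" "r \<le> 1"
  shows "(1 - b) powr r \<le> 1 - r * b"
proof (cases "b = 1")
  case False
  then show ?thesis
    using Youngs_inequality_0[of r "1 - r" "1 - b" 1] assms by (simp add: algebra_simps)
qed (use assms in auto)

lemma powr_diff_ge_tangent:
  fixes x y s :: real
  assumes "0 < x" "x \<le> y" "0 < s" "s \<le> 1"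
  shows "s * y powr (s - 1) * (y - x) \<le> y powr s - x powr s"
proof -
  have "(x / y) powr s \<le> s * (x / y) + (1 - s)"
    using Youngs_inequality_0[of s "1 - s" "x / y" 1] assms by simp
  then have "y powr s * (x / y) powr s \<le> y powr s * (s * (x / y) + (1 - s))"
    by (intro mult_left_mono) auto
  moreover have "y powr s * (x / y) powr s = x powr s"
    using assms by (simp add: powr_divide)
  moreover have "y powr s * (s * (x / y) + (1 - s)) = y powr s - s * y powr (s - 1) * (y - x)"
    using assms by (simp add: powr_diff field_simps)
  ultimately show ?thesis by linarith
qed

text \<open>Suppose both defects are at most L and yet \<Delta> = k - n \<ge> K L. The outer
  condition permits b only of order L/n. Bounding the concave power in the inner condition from
  below by its slope at k then gives \<Delta>^q \<le> const (k L / n)^r \<Delta> with q = 1 + r. As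
  n and \<Delta> are both at least K L, k L / n \<le> 2 \<Delta> / K, and \<open>Ksmall\<close> is
  exactly what makes the right side smaller than \<Delta>^q.\<close>

lemma level_gap_bound:
  fixes N K L C b tn tk n k :: real
  assumes N: "2 \<le> N" and K: "2 \<le> K"
    and Ksmall: "2 * (N / (N - 1)) powr (N / (N - 1)) * (2 * N / K) powr (1 / (N - 1)) < 1"
    and L: "1 \<le> L" "C \<le> L" and C: "0 \<le> C" and b: "0 \<le> b" "b \<le> 1"
    and nk: "n < k" "K * L \<le> n"
    and y: "tn - n + C \<le> L" "tk - k + C \<le> L" and n0: "n \<le> tn + C"
    and outer: "n \<le> (1 - b) powr (1 / (N - 1)) * (tn + C)"
    and inner: "(k powr ((N - 1) / N) - n powr ((N - 1) / N)) powr (N / (N - 1))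
                 \<le> b powr (1 / (N - 1)) * (tk - tn + C)"
  shows "k - n < K * L"
proof (rule ccontr)
  assume "\<not> k - n < K * L"
  then have D: "K * L \<le> k - n" by simp
  define r where "r = 1 / (N - 1)"
  define q where "q = N / (N - 1)"
  define \<Delta> where "\<Delta> = k - n"
  have N1: "N - 1 \<ge> 1" using N by auto
  have r: "0 < r" "r \<le> 1" "q = 1 + r" "r * (N - 1) = 1" "q > 1"
    unfolding r_def q_def using N1 by (auto simp: field_simps)
  have KL: "K * L \<ge> 2 * L" "K * L \<ge> 2" using K L mult_right_mono[of 2 K L] by linarith+
  have n_pos: "n > 0" and k_pos: "k > 0" using nk KL by auto
  have "\<Delta> > 0" "\<Delta> \<ge> 2 * L" using D KL unfolding \<Delta>_def by auto
  \<comment> \<open>The level n can afford the loss factor (1 - b)^r only if b is small: Bernoulli's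
    inequality gives r b n \<le> L, and 1/r = N - 1 is rounded up to N.\<close>
  have bn: "b \<le> N * L / n"
  proof -
    have "n \<le> (1 - r * b) * (tn + C)"
      using outer one_minus_powr_le[OF b r(1,2)] n0 n_pos unfolding r_def[symmetric]
      by (smt (verit) mult_right_mono)
    then have "r * b * (tn + C) \<le> L" using y(1) by (simp add: algebra_simps)
    moreover have "r * b * n \<le> r * b * (tn + C)"
      using n0 r b by (intro mult_left_mono) auto
    ultimately have "r * b * n \<le> L" by linarith
    then have "(N - 1) * (r * b * n) \<le> (N - 1) * L"
      using N1 by (intro mult_left_mono) auto
    moreover have "(N - 1) * (r * b * n) = b * n"
      using r(4) by (metis (no_types, opaque_lifting) mult.assoc mult.commute mult.right_neutral)
    ultimately have "b * n \<le> N * L" using L by (simp add: algebra_simps)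
    then show ?thesis using n_pos by (simp add: field_simps)
  qed
  have inv_q: "(N - 1) / N = 1 / q" unfolding q_def using N1 by simp
  have iq: "0 < 1 / q" "1 / q \<le> 1" "(1 / q - 1) * q = - r"
    using r(3,5) by (auto simp: divide_simps left_diff_distrib)
  have "(1 / q * k powr (1 / q - 1) * \<Delta>) powr q \<le> (k powr (1 / q) - n powr (1 / q)) powr q"
    unfolding \<Delta>_def
    by (rule powr_mono2) (use powr_diff_ge_tangent[of n k "1 / q"] iq r n_pos nk in auto)
  also have "\<dots> \<le> b powr r * (tk - tn + C)"
    using inner unfolding inv_q r_def[symmetric] q_def[symmetric] .
  \<comment> \<open>The defect bounds give \<open>tk - tn + C\<close> \<le> \<Delta> + L + C, and L
    + C \<le> 2 L \<le> \<Delta>; the last step uses K \<ge> 2.\<close>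
  also have "\<dots> \<le> b powr r * (2 * \<Delta>)"
  proof (rule mult_left_mono)
    show "tk - tn + C \<le> 2 * \<Delta>" using y n0 L \<open>\<Delta> \<ge> 2 * L\<close> unfolding \<Delta>_def by argo
  qed auto
  also have "b powr r \<le> (N * L / n) powr r" using bn b r by (intro powr_mono2) auto
  finally have "(1 / q * k powr (1 / q - 1) * \<Delta>) powr q \<le> (N * L / n) powr r * (2 * \<Delta>)"
    using \<open>\<Delta> > 0\<close> by (simp add: mult_right_mono)
  moreover have "(1 / q * k powr (1 / q - 1) * \<Delta>) powr q = k powr (- r) * \<Delta> powr q / q powr q"
    using r k_pos \<open>\<Delta> > 0\<close> iq by (simp add: powr_mult powr_divide powr_powr)
  ultimately have "k powr (- r) * \<Delta> powr q / q powr q \<le> (N * L / n) powr r * (2 * \<Delta>)" by simp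
  then have "k powr r * q powr q * (k powr (- r) * \<Delta> powr q / q powr q)
      \<le> k powr r * q powr q * ((N * L / n) powr r * (2 * \<Delta>))"
    by (intro mult_left_mono) auto
  moreover have "k powr r * q powr q * (k powr (- r) * \<Delta> powr q / q powr q) = \<Delta> powr q"
    using k_pos r by (simp add: powr_minus field_simps)
  moreover have "k powr r * q powr q * ((N * L / n) powr r * (2 * \<Delta>))
      = q powr q * (k * (N * L / n)) powr r * (2 * \<Delta>)"
    using k_pos n_pos L by (simp add: powr_mult powr_divide)
  ultimately have "\<Delta> powr q \<le> q powr q * (k * (N * L / n)) powr r * (2 * \<Delta>)" by simp
  also have "\<dots> \<le> q powr q * (2 * N / K * \<Delta>) powr r * (2 * \<Delta>)"
  proof -
    have "K * (k * L) = K * L * n + K * L * \<Delta>" unfolding \<Delta>_def by (simp add: algebra_simps)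
    also have "\<dots> \<le> \<Delta> * n + n * \<Delta>"
      using D nk n_pos \<open>\<Delta> > 0\<close> unfolding \<Delta>_def[symmetric]
      by (intro add_mono mult_right_mono) auto
    finally have "k * L / n \<le> 2 * \<Delta> / K" using n_pos K by (simp add: field_simps)
    then have "N * (k * L / n) \<le> N * (2 * \<Delta> / K)" using N by (intro mult_left_mono) auto
    then have "k * (N * L / n) \<le> 2 * N / K * \<Delta>" by (simp add: mult_ac)
    then show ?thesis
      using r k_pos n_pos L N \<open>\<Delta> > 0\<close> by (intro mult_right_mono mult_left_mono powr_mono2) auto
  qed
  also have "\<dots> = (2 * q powr q * (2 * N / K) powr r) * \<Delta> powr q"
    using \<open>\<Delta> > 0\<close> K r by (simp add: powr_mult powr_add powr_divide)
  also have "\<dots> < 1 * \<Delta> powr q"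
  proof (rule mult_strict_right_mono)
    show "2 * q powr q * (2 * N / K) powr r < 1" using Ksmall N1 by (simp add: q_def r_def)
  qed (use \<open>\<Delta> > 0\<close> in auto)
  finally show False by simp
qed


section \<open>Counting levels and summing exponentials\<close>

lemma card_nat_below:
  fixes x :: real and I :: "nat set"
  assumes "finite I" "0 \<le> x" "\<And>n k. n \<in> I \<Longrightarrow> k \<in> I \<Longrightarrow> n < k \<Longrightarrow> real k - real n < x"
  shows "real (card I) \<le> x + 1"
proof (cases "I = {}")
  case False
  define m where "m = Min I"
  have m: "m \<in> I" "\<And>k. k \<in> I \<Longrightarrow> m \<le> k"
    unfolding m_def using assms(1) False by auto
  have "I \<subseteq> {m..m + nat \<lfloor>x\<rfloor>}"
  proof
    fix k assume k: "k \<in> I"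
    then have "real k - real m \<le> x" using assms(2) assms(3)[OF m(1) k] m(2)[OF k] by fastforce
    then have "real (k - m) \<le> x" using m(2)[OF k] by (simp add: of_nat_diff)
    then have "k - m \<le> nat \<lfloor>x\<rfloor>" by (simp add: le_nat_floor)
    then show "k \<in> {m..m + nat \<lfloor>x\<rfloor>}" using m(2)[OF k] by auto
  qed
  then have "card I \<le> nat \<lfloor>x\<rfloor> + 1"
    using card_mono[of "{m..m + nat \<lfloor>x\<rfloor>}" I] by simp
  then show ?thesis using assms(2) of_nat_floor[OF assms(2)] by linarith
qed (use assms in auto)

text \<open>Grouped by the integer part of y, the j-th group has linearly many members of weight at
  most exp(-\<alpha> j). Half of the exponent absorbs the linear growth and the other half sums
  geometrically. The bound S is fixed before I and y, which is where the uniformity over all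
  functions comes from in the end.\<close>

lemma sum_exp_le_of_card_le:
  fixes \<alpha> A B :: real
  assumes "0 < \<alpha>" "0 \<le> A" "0 \<le> B"
  shows "\<exists>S. \<forall>(I::nat set) (y::nat \<Rightarrow> real). finite I \<longrightarrow> (\<forall>n\<in>I. 0 \<le> y n) \<longrightarrow>
     (\<forall>j::nat. real (card {n \<in> I. y n \<le> real j + 1}) \<le> A * j + B) \<longrightarrow>
     (\<Sum>n\<in>I. exp (- \<alpha> * y n)) \<le> S"
proof -
  \<comment> \<open>From A j = (2 A / \<alpha>) (\<alpha> j / 2) and x \<le> e^x at x = \<alpha> j /
    2.\<close>
  define D where "D = 2 * A / \<alpha> + B"
  define z where "z = exp (- \<alpha> / 2)"
  have z: "0 < z" "z < 1" "summable (\<lambda>j. z ^ j)"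
    unfolding z_def using assms by (auto intro!: summable_geometric)
  have term_le: "(A * j + B) * exp (- \<alpha> * j) \<le> D * z ^ j" for j :: nat
  proof -
    have e: "1 \<le> exp (\<alpha> * j / 2)" "\<alpha> * j / 2 \<le> exp (\<alpha> * j / 2)"
      using assms exp_ge_add_one_self[of "\<alpha> * j / 2"] by - (simp, linarith)
    have "A * j = (2 * A / \<alpha>) * (\<alpha> * j / 2)" using assms by simp
    also have "\<dots> \<le> (2 * A / \<alpha>) * exp (\<alpha> * j / 2)" using e assms by (intro mult_left_mono) auto
    finally have "A * j + B \<le> D * exp (\<alpha> * j / 2)"
      using mult_left_mono[OF e(1) assms(3)] unfolding D_def by (simp add: algebra_simps)
    then have "(A * j + B) * exp (- \<alpha> * j) \<le> D * exp (\<alpha> * j / 2) * exp (- \<alpha> * j)"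
      by (intro mult_right_mono) auto
    also have "\<dots> = D * z ^ j"
      unfolding z_def by (simp add: exp_of_nat_mult[symmetric] mult_exp_exp field_simps)
    finally show ?thesis .
  qed
  show ?thesis
  proof (intro exI allI impI)
    fix I :: "nat set" and y :: "nat \<Rightarrow> real"
    assume I: "finite I" and y: "\<forall>n\<in>I. 0 \<le> y n"
      and c: "\<forall>j::nat. real (card {n \<in> I. y n \<le> real j + 1}) \<le> A * j + B"
    define h where "h n = nat \<lfloor>y n\<rfloor>" for n
    have h: "real (h n) \<le> y n" "y n \<le> real (h n) + 1" if "n \<in> I" for n
      using bspec[OF y that] unfolding h_def by linarith+
    have "(\<Sum>n\<in>I. exp (- \<alpha> * y n)) \<le> (\<Sum>n\<in>I. exp (- \<alpha> * h n))"
      using h(1) assms by (intro sum_mono) auto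
    also have "\<dots> = (\<Sum>j\<in>h ` I. \<Sum>n\<in>{n\<in>I. h n = j}. exp (- \<alpha> * h n))"
      by (rule sum.image_gen[OF I])
    also have "\<dots> \<le> (\<Sum>j\<in>h ` I. D * z ^ j)"
    proof (rule sum_mono)
      fix j
      have "(\<Sum>n\<in>{n\<in>I. h n = j}. exp (- \<alpha> * h n)) = card {n\<in>I. h n = j} * exp (- \<alpha> * j)"
        by simp
      also have "\<dots> \<le> card {n \<in> I. y n \<le> real j + 1} * exp (- \<alpha> * j)"
        using h(2) I by (intro mult_right_mono) (auto intro!: card_mono)
      also have "\<dots> \<le> (A * j + B) * exp (- \<alpha> * j)"
        using c by (intro mult_right_mono) auto
      finally show "(\<Sum>n\<in>{n\<in>I. h n = j}. exp (- \<alpha> * h n)) \<le> D * z ^ j"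
        using term_le[of j] by linarith
    qed
    also have "\<dots> \<le> (\<Sum>j. D * z ^ j)"
      using z I assms by (intro sum_le_suminf summable_mult) (auto simp: D_def)
    finally show "(\<Sum>n\<in>I. exp (- \<alpha> * y n)) \<le> (\<Sum>j. D * z ^ j)" .
  qed
qed

text \<open>A discrete form of the Adams--Garsia lemma: two nearly extremal levels \<open>n < k\<close> cannot be far
  apart, because near-extremality of level \<open>n\<close> leaves little energy \<open>b\<close> for the passage from \<open>n\<close> to \<open>k\<close>.\<close>

definition adams_garsia_levels :: "real \<Rightarrow> real \<Rightarrow> nat set \<Rightarrow> (nat \<Rightarrow> real) \<Rightarrow> bool" where
  "adams_garsia_levels N C I t \<longleftrightarrow> finite I \<and> (\<forall>n\<in>I. real n \<le> t n + C) \<and>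
    (\<forall>n\<in>I. \<forall>k\<in>I. n < k \<longrightarrow> (\<exists>b. 0 \<le> b \<and> b \<le> 1 \<and>
       real n \<le> (1 - b) powr (1 / (N - 1)) * (t n + C) \<and>
       (real k powr ((N - 1) / N) - real n powr ((N - 1) / N)) powr (N / (N - 1))
          \<le> b powr (1 / (N - 1)) * (t k - t n + C)))"

text \<open>For t n = -ln of the relative measure of the n-th level set, the summand is the
  \<alpha>-th power of e^n times that relative measure. The indices whose defect t n - n + C is at
  most L are either below K L or pairwise closer than K L by \<open>level_gap_bound\<close>. So
  their number is linear in L, while a summand decays exponentially in its defect.\<close>

lemma adams_garsia_sum:
  fixes N \<alpha> C :: real
  assumes N: "2 \<le> N" and \<alpha>: "0 < \<alpha>" and C: "0 \<le> C"
  shows "\<exists>S. \<forall>I (t::nat \<Rightarrow> real). adams_garsia_levels N C I t \<longrightarrow> (\<Sum>n\<in>I. exp (\<alpha> * (n - t n))) \<le> S"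
proof -
  define r where "r = 1 / (N - 1)"
  have r: "0 < r" unfolding r_def using N by auto
  obtain K where K: "2 \<le> K"
    "2 * (N / (N - 1)) powr (N / (N - 1)) * (2 * N / K) powr (1 / (N - 1)) < 1"
  proof -
    have "((\<lambda>K. 2 * (N / (N - 1)) powr (N / (N - 1)) * (2 * N * inverse K) powr r) \<longlongrightarrow>
        2 * (N / (N - 1)) powr (N / (N - 1)) * (2 * N * 0) powr r) at_top"
      using r N by (intro tendsto_intros tendsto_inverse_0_at_top filterlim_ident tendsto_powr')
        (auto simp: eventually_at_top_linorder intro!: exI[of _ 1])
    then have "\<forall>\<^sub>F K in at_top. 2 * (N / (N - 1)) powr (N / (N - 1)) * (2 * N * inverse K) powr r < 1"
      by (rule order_tendstoD) (use r in auto)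
    then have "\<forall>\<^sub>F K in at_top. 2 * (N / (N - 1)) powr (N / (N - 1)) * (2 * N * inverse K) powr r < 1
        \<and> 2 \<le> K"
      by (intro eventually_conj eventually_ge_at_top)
    then obtain K where "2 * (N / (N - 1)) powr (N / (N - 1)) * (2 * N * inverse K) powr r < 1 \<and> 2 \<le> K"
      using eventually_happens'[OF trivial_limit_at_top_linorder] by blast
    then show ?thesis
      using that[of K] unfolding r_def by (simp only: divide_inverse)
  qed
  define A where "A = 2 * K"
  define B where "B = 2 * K * (2 + C) + 2"
  obtain S where S: "\<And>(I::nat set) y. finite I \<Longrightarrow> (\<forall>n\<in>I. 0 \<le> y n) \<Longrightarrow>
     (\<forall>j::nat. real (card {n \<in> I. y n \<le> real j + 1}) \<le> A * j + B) \<Longrightarrow>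
     (\<Sum>n\<in>I. exp (- \<alpha> * y n)) \<le> S"
  proof -
    have "0 \<le> A" "0 \<le> B" using K C unfolding A_def B_def by auto
    then show ?thesis using sum_exp_le_of_card_le[of \<alpha> A B] \<alpha> that by blast
  qed
  show ?thesis
  proof (intro exI allI impI)
    fix I :: "nat set" and t :: "nat \<Rightarrow> real"
    assume lev: "adams_garsia_levels N C I t"
    then have I: "finite I" and t: "\<forall>n\<in>I. real n \<le> t n + C"
      unfolding adams_garsia_levels_def by blast+
    define y where "y n = t n - n + C" for n
    have card_le: "real (card {n \<in> I. y n \<le> real j + 1}) \<le> A * j + B" for j :: nat
    proof -
      \<comment> \<open>The shift guarantees both L \<ge> 1 and L \<ge> C, as
        \<open>level_gap_bound\<close> requires, also for j = 0.\<close>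
      define L where "L = real j + 2 + C"
      define I1 where "I1 = {n \<in> I. y n \<le> L \<and> real n < K * L}"
      define I2 where "I2 = {n \<in> I. y n \<le> L \<and> K * L \<le> real n}"
      have L: "1 \<le> L" "C \<le> L" "0 \<le> K * L" unfolding L_def using C K by auto
      have "real (card I1) \<le> K * L + 1"
        using I L unfolding I1_def by (intro card_nat_below) auto
      moreover have "real (card I2) \<le> K * L + 1"
      proof (rule card_nat_below)
        fix n k assume nk: "n \<in> I2" "k \<in> I2" "n < k"
        then obtain b where b: "0 \<le> b" "b \<le> 1"
          "real n \<le> (1 - b) powr (1 / (N - 1)) * (t n + C)"
          "(real k powr ((N - 1) / N) - real n powr ((N - 1) / N)) powr (N / (N - 1))
          \<le> b powr (1 / (N - 1)) * (t k - t n + C)"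
          using lev unfolding adams_garsia_levels_def I2_def by blast
        show "real k - real n < K * L"
          by (rule level_gap_bound[OF N K L(1,2) C b(1,2) _ _ _ _ _ b(3,4)])
            (use nk t in \<open>auto simp: I2_def y_def\<close>)
      qed (use I L in \<open>auto simp: I2_def\<close>)
      moreover have "card {n \<in> I. y n \<le> real j + 1} \<le> card (I1 \<union> I2)"
        using I C unfolding I1_def I2_def L_def by (intro card_mono) auto
      moreover have "card (I1 \<union> I2) \<le> card I1 + card I2" by (rule card_Un_le)
      ultimately have "real (card {n \<in> I. y n \<le> real j + 1}) \<le> 2 * (K * L + 1)"
        by (smt (verit) of_nat_add of_nat_mono)
      then show ?thesis unfolding A_def B_def L_def by (simp add: algebra_simps)
    qed
    have "(\<Sum>n\<in>I. exp (\<alpha> * (n - t n))) = (\<Sum>n\<in>I. exp (\<alpha> * C) * exp (- \<alpha> * y n))"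
      unfolding y_def by (simp add: mult_exp_exp algebra_simps)
    also have "\<dots> = exp (\<alpha> * C) * (\<Sum>n\<in>I. exp (- \<alpha> * y n))"
      by (simp add: sum_distrib_left)
    also have "\<dots> \<le> exp (\<alpha> * C) * S"
      using t card_le by (intro mult_left_mono S I) (auto simp: y_def)
    finally show "(\<Sum>n\<in>I. exp (\<alpha> * (n - t n))) \<le> exp (\<alpha> * C) * S" .
  qed
qed

section \<open>Finsler norms and their Wulff balls\<close>

lemma nn_integral_lborel_scaleR:
  fixes f :: "'a::euclidean_space \<Rightarrow> ennreal"
  assumes [measurable]: "f \<in> borel_measurable borel" and c: "c \<noteq> 0"
  shows "(\<integral>\<^sup>+x. f x \<partial>lborel) = ennreal (\<bar>c\<bar> ^ DIM('a)) * (\<integral>\<^sup>+x. f (c *\<^sub>R x) \<partial>lborel)"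
  by (subst lborel_affine[OF c, of 0])
     (simp add: nn_integral_density nn_integral_distr nn_integral_cmult)

lemma nn_integral_lborel_translate:
  fixes f :: "'a::euclidean_space \<Rightarrow> ennreal"
  assumes [measurable]: "f \<in> borel_measurable borel"
  shows "(\<integral>\<^sup>+x. f (t + x) \<partial>lborel) = (\<integral>\<^sup>+x. f x \<partial>lborel)"
  by (subst (2) lborel_affine[of 1 t])
     (simp_all add: nn_integral_density nn_integral_distr nn_integral_cmult)

lemma nn_integral_lborel_minus:
  fixes f :: "'a::euclidean_space \<Rightarrow> ennreal"
  assumes [measurable]: "f \<in> borel_measurable borel"
  shows "(\<integral>\<^sup>+x. f (t - x) \<partial>lborel) = (\<integral>\<^sup>+x. f x \<partial>lborel)"
  by (subst (2) lborel_affine[of "-1" t])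
     (simp_all add: nn_integral_density nn_integral_distr nn_integral_cmult)

locale finsler_norm =
  fixes F :: "real^'n \<Rightarrow> real"
  assumes F_nonneg: "0 \<le> F x"
    and F_convex: "convex_on UNIV F"
    and F_scale: "F (t *\<^sub>R x) = \<bar>t\<bar> * F x"
    and F_pos: "x \<noteq> 0 \<Longrightarrow> 0 < F x"
begin

abbreviation \<rho> :: "real^'n \<Rightarrow> real" where "\<rho> \<equiv> polar_F F"

lemma F_zero [simp]: "F 0 = 0"
  using F_scale[of 0 0] by simp

lemma F_triangle: "F (x + y) \<le> F x + F y"
proof -
  have "F ((1 - 1/2) *\<^sub>R (2 *\<^sub>R x) + (1/2) *\<^sub>R (2 *\<^sub>R y)) \<le> (1 - 1/2) * F (2 *\<^sub>R x) + 1/2 * F (2 *\<^sub>R y)"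
    by (rule convex_onD[OF F_convex]) auto
  then show ?thesis by (simp add: F_scale)
qed

lemma F_continuous: "continuous_on S F"
  using convex_on_continuous[OF open_UNIV F_convex] continuous_on_subset by blast

lemma F_measurable [measurable]: "F \<in> borel_measurable borel"
  by (rule borel_measurable_continuous_onI[OF F_continuous])

lemma F_bounds:
  obtains c C where "0 < c" "0 < C" "\<And>x. c * norm x \<le> F x" "\<And>x. F x \<le> C * norm x"
proof -
  have "sphere (0::real^'n) 1 \<noteq> {}" by simp
  then obtain a b where a: "a \<in> sphere 0 1" "\<And>y. y \<in> sphere 0 1 \<Longrightarrow> F a \<le> F y"
    and b: "b \<in> sphere 0 1" "\<And>y. y \<in> sphere 0 1 \<Longrightarrow> F y \<le> F b"
    using continuous_attains_inf[OF compact_sphere _ F_continuous]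
      continuous_attains_sup[OF compact_sphere _ F_continuous] by metis
  have *: "F x = norm x * F (x /\<^sub>R norm x)" "x \<noteq> 0 \<Longrightarrow> x /\<^sub>R norm x \<in> sphere 0 1" for x
    by (auto simp: F_scale field_simps)
  show ?thesis
  proof (rule that[of "F a" "F b"])
    show "0 < F a" "0 < F b" by (use a(1) b(1) in \<open>auto intro!: F_pos\<close>)
    show "F a * norm x \<le> F x" for x
    proof (cases "x = 0")
      case False
      then have "norm x * F a \<le> norm x * F (x /\<^sub>R norm x)" using *(2) a by (intro mult_left_mono) auto
      then show ?thesis using *(1)[of x] by (simp add: mult.commute)
    qed simp
    show "F x \<le> F b * norm x" for x
    proof (cases "x = 0")
      case False
      then have "norm x * F (x /\<^sub>R norm x) \<le> norm x * F b" using *(2) b by (intro mult_left_mono) auto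
      then show ?thesis using *(1)[of x] by (simp add: mult.commute)
    qed simp
  qed
qed

lemma polar_bdd_above: "bdd_above {x \<bullet> \<xi> | \<xi>. F \<xi> \<le> 1}"
proof -
  obtain c where c: "0 < c" "\<And>x. c * norm x \<le> F x" using F_bounds by metis
  show ?thesis
  proof (rule bdd_aboveI, clarify)
    fix \<xi> assume "F \<xi> \<le> 1"
    then have "norm \<xi> \<le> 1 / c" using c(1) c(2)[of \<xi>] by (simp add: field_simps)
    then have "norm x * norm \<xi> \<le> norm x * (1 / c)" by (intro mult_left_mono) auto
    then show "x \<bullet> \<xi> \<le> norm x * (1 / c)" using norm_cauchy_schwarz[of x \<xi>] by linarith
  qed
qed

lemma polar_upper: "F \<xi> \<le> 1 \<Longrightarrow> x \<bullet> \<xi> \<le> \<rho> x"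
  unfolding polar_F_def by (rule cSup_upper[OF _ polar_bdd_above]) auto

lemma polar_least: "(\<And>\<xi>. F \<xi> \<le> 1 \<Longrightarrow> x \<bullet> \<xi> \<le> M) \<Longrightarrow> \<rho> x \<le> M"
  unfolding polar_F_def by (rule cSup_least) (auto intro!: exI[of _ 0])

text \<open>Homogeneity extends the definition of the polar from the unit ball of F to all vectors.
  This is the Cauchy-Schwarz inequality of the anisotropic setting; its constant 1 is essential for
  the sharp exponent.\<close>

lemma inner_le_polar: "x \<bullet> \<xi> \<le> \<rho> x * F \<xi>"
proof (cases "\<xi> = 0")
  case False
  then have "x \<bullet> (\<xi> /\<^sub>R F \<xi>) \<le> \<rho> x" using F_pos[OF False] by (intro polar_upper) (simp add: F_scale)
  then show ?thesis using F_pos[OF False] by (simp add: field_simps)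
qed simp

lemma F_minus [simp]: "F (- x) = F x"
  using F_scale[of "-1" x] by simp

lemma abs_inner_le_polar: "\<bar>x \<bullet> \<xi>\<bar> \<le> \<rho> x * F \<xi>"
  using inner_le_polar[of x \<xi>] inner_le_polar[of x "- \<xi>"] by auto

lemma polar_nonneg [simp]: "0 \<le> \<rho> x"
  using polar_upper[of 0 x] by simp

lemma polar_triangle: "\<rho> (x + y) \<le> \<rho> x + \<rho> y"
  using polar_upper by (intro polar_least) (simp add: inner_add_left add_mono)

lemma polar_minus [simp]: "\<rho> (- x) = \<rho> x"
proof -
  have "\<rho> (- x) \<le> \<rho> x" for x
  proof (rule polar_least)
    fix \<xi> assume "F \<xi> \<le> 1"
    then show "- x \<bullet> \<xi> \<le> \<rho> x" using polar_upper[of "- \<xi>" x] by simp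
  qed
  from this[of x] this[of "- x"] show ?thesis by simp
qed

lemma polar_minus_commute: "\<rho> (x - y) = \<rho> (y - x)"
  using polar_minus[of "x - y"] by simp

lemma polar_scale: "\<rho> (t *\<^sub>R x) = \<bar>t\<bar> * \<rho> x"
proof -
  have le: "\<rho> (t *\<^sub>R x) \<le> t * \<rho> x" if "0 \<le> t" for t x
    using that polar_upper[of _ x] by (intro polar_least) (simp add: mult_left_mono)
  have eq: "\<rho> (t *\<^sub>R x) = t * \<rho> x" if "0 < t" for t x
  proof (rule antisym[OF le])
    have "\<rho> ((1 / t) *\<^sub>R (t *\<^sub>R x)) \<le> 1 / t * \<rho> (t *\<^sub>R x)" using that by (intro le) auto
    then show "t * \<rho> x \<le> \<rho> (t *\<^sub>R x)" using that by (simp add: field_simps)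
  qed (use that in auto)
  have z: "\<rho> 0 = 0" using le[of 0 0] polar_nonneg[of 0] by simp
  consider "t = 0" | "0 < t" | "t < 0" by linarith
  then show ?thesis
  proof cases
    case 3
    then show ?thesis using eq[of "- t" "x"] polar_minus[of "t *\<^sub>R x"] by simp
  qed (use z eq in auto)
qed

lemma polar_zero [simp]: "\<rho> 0 = 0"
  using polar_scale[of 0 0] by simp

lemma polar_bounds:
  obtains c C where "0 < c" "0 < C" "\<And>x. c * norm x \<le> \<rho> x" "\<And>x. \<rho> x \<le> C * norm x"
proof -
  obtain c C where c: "0 < c" "0 < C" "\<And>x. c * norm x \<le> F x" "\<And>x. F x \<le> C * norm x"
    using F_bounds by metis
  show ?thesis
  proof (rule that[of "1 / C" "1 / c"])
    show "1 / C * norm x \<le> \<rho> x" for x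
    proof (cases "x = 0")
      case False
      have "norm x * norm x = x \<bullet> x" by (simp add: norm_eq_sqrt_inner)
      also have "\<dots> \<le> \<rho> x * F x" by (rule inner_le_polar)
      also have "\<dots> \<le> \<rho> x * (C * norm x)" using c by (intro mult_left_mono) auto
      finally show ?thesis using False c by (simp add: field_simps)
    qed simp
    show "\<rho> x \<le> 1 / c * norm x" for x
    proof (rule polar_least)
      fix \<xi> assume "F \<xi> \<le> 1"
      then have "norm \<xi> \<le> 1 / c" using c(1) c(3)[of \<xi>] by (simp add: field_simps)
      then have "norm x * norm \<xi> \<le> norm x * (1 / c)" by (intro mult_left_mono) auto
      then show "x \<bullet> \<xi> \<le> 1 / c * norm x" using norm_cauchy_schwarz[of x \<xi>] by (simp add: mult.commute)
    qed
  qed (use c in auto)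
qed

lemma polar_pos [simp]: "0 < \<rho> x \<longleftrightarrow> x \<noteq> 0"
proof -
  obtain c where "0 < c" "\<And>x. c * norm x \<le> \<rho> x" using polar_bounds by metis
  then show ?thesis by (metis less_le_trans mult_pos_pos polar_zero zero_less_norm_iff less_irrefl)
qed

lemma polar_eq_0_iff [simp]: "\<rho> x = 0 \<longleftrightarrow> x = 0"
  using polar_pos[of x] polar_nonneg[of x] by linarith

lemma polar_continuous: "continuous_on S \<rho>"
proof -
  obtain C where C: "0 < C" "\<And>x. \<rho> x \<le> C * norm x" using polar_bounds by metis
  have "C-lipschitz_on S \<rho>"
  proof (rule lipschitz_onI)
    fix x y
    have "\<rho> x \<le> \<rho> y + \<rho> (x - y)" "\<rho> y \<le> \<rho> x + \<rho> (x - y)"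
      using polar_triangle[of y "x - y"] polar_triangle[of x "y - x"] polar_minus_commute[of x y]
      by simp_all
    then show "dist (\<rho> x) (\<rho> y) \<le> C * dist x y"
      using C(2)[of "x - y"] by (auto simp: dist_norm)
  qed (use C in auto)
  then show ?thesis by (rule lipschitz_on_continuous_on)
qed

lemma polar_measurable [measurable]: "\<rho> \<in> borel_measurable borel"
  by (rule borel_measurable_continuous_onI[OF polar_continuous])

section \<open>Measures of Wulff balls and integrals of functions of \<rho>\<close>

definition \<kappa> :: real where "\<kappa> = kappa_N F"

lemma emeasure_wulff_finite: "emeasure lborel {x. \<rho> x \<le> r} < \<infinity>"
proof -
  obtain c where c: "0 < c" "\<And>x. c * norm x \<le> \<rho> x" using polar_bounds by metis
  have "{x. \<rho> x \<le> r} \<subseteq> cball 0 (r / c)"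
    using c by (auto simp: field_simps intro: order_trans[OF c(2)])
  then have "bounded {x. \<rho> x \<le> r}" using bounded_cball bounded_subset by blast
  then show ?thesis by (rule emeasure_bounded_finite)
qed

lemma emeasure_wulff_1: "emeasure lborel {x. \<rho> x \<le> 1} = ennreal \<kappa>"
proof -
  have "{x. \<rho> x \<le> 1} \<in> sets lborel" by measurable
  then have "measure lebesgue {x. \<rho> x \<le> 1} = measure lborel {x. \<rho> x \<le> 1}"
    by (rule measure_completion)
  then have "\<kappa> = measure lborel {x. \<rho> x \<le> 1}" unfolding \<kappa>_def kappa_N_def by simp
  then show ?thesis using emeasure_wulff_finite[of 1] by (simp add: emeasure_eq_ennreal_measure)
qed

lemma kappa_pos: "0 < \<kappa>"
proof -
  obtain C where C: "0 < C" "\<And>x. \<rho> x \<le> C * norm x" using polar_bounds by metis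
  have "ball 0 (1 / C) \<subseteq> {x. \<rho> x \<le> 1}"
    using C by (auto simp: field_simps intro!: order_trans[OF C(2)])
  then have "emeasure lborel (ball (0::real^'n) (1 / C)) \<le> ennreal \<kappa>"
    unfolding emeasure_wulff_1[symmetric] by (intro emeasure_mono) auto
  moreover have "emeasure lborel (ball (0::real^'n) (1 / C)) \<noteq> 0"
    using C emeasure_ball[of "1 / C" "0::real^'n"] by (simp add: unit_ball_vol_pos[THEN less_imp_neq, symmetric])
  ultimately show ?thesis
    by (metis ennreal_neg le_zero_eq not_le)
qed

lemma emeasure_wulff:
  assumes "0 \<le> r"
  shows "emeasure lborel {x. \<rho> x \<le> r} = ennreal (\<kappa> * r ^ CARD('n))"
proof (cases "r = 0")
  case True
  then have "{x. \<rho> x \<le> r} = {0}" using antisym[OF _ polar_nonneg] by (auto simp flip: polar_eq_0_iff)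
  then show ?thesis using True by (simp add: power_0_left)
next
  case False
  have "emeasure lborel {x. \<rho> x \<le> r} = (\<integral>\<^sup>+x. indicator {x. \<rho> x \<le> r} x \<partial>lborel)"
    by simp
  also have "\<dots> = ennreal (\<bar>r\<bar> ^ DIM(real^'n)) * (\<integral>\<^sup>+x. indicator {x. \<rho> x \<le> r} (r *\<^sub>R x) \<partial>lborel)"
    by (rule nn_integral_lborel_scaleR) (use False in auto)
  also have "(\<lambda>x. indicator {x. \<rho> x \<le> r} (r *\<^sub>R x) :: ennreal) = indicator {x. \<rho> x \<le> 1}"
    using False assms by (auto simp: indicator_def polar_scale fun_eq_iff)
  finally show ?thesis using assms
    by (simp add: emeasure_wulff_1 ennreal_mult[symmetric] kappa_pos less_imp_le mult.commute)
qed

text \<open>Half-lines determine both measures: on the left they give the volume \<kappa> r^N of a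
  Wulff ball, on the right the integral of its derivative. Radial integration is thus available
  without any surface measure.\<close>

lemma distr_polar:
  "distr lborel borel \<rho> =
     density lborel (\<lambda>r. ennreal (real CARD('n) * \<kappa> * r ^ (CARD('n) - 1)) * indicator {0..} r)"
  (is "?M = ?D")
proof (rule measure_eqI_generator_eq[where E = "range atMost" and \<Omega> = UNIV and A = "\<lambda>i. {..real i}"])
  show "Int_stable (range (atMost :: real \<Rightarrow> _))" by (auto simp: Int_stable_def)
  show "sets ?M = sigma_sets UNIV (range atMost)" "sets ?D = sigma_sets UNIV (range atMost)"
    by (simp_all add: borel_eq_atMost)
  show "range (\<lambda>i. {..real i}) \<subseteq> range atMost" by auto
  show "(\<Union>i. {..real i}) = UNIV" using real_arch_simple by auto
  have eqM: "emeasure ?M {..r} = emeasure lborel {x. \<rho> x \<le> r}" for r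
    by (subst emeasure_distr) (auto simp: vimage_def)
  show "emeasure ?M {..real i} \<noteq> \<infinity>" for i
    unfolding eqM using emeasure_wulff_finite[of "real i"] by simp
  fix X assume "X \<in> range (atMost :: real \<Rightarrow> _)"
  then obtain r where X: "X = {..r}" by auto
  have D: "emeasure ?D {..r} =
      (\<integral>\<^sup>+x. ennreal (real CARD('n) * \<kappa> * x ^ (CARD('n) - 1)) * indicator {0..r} x \<partial>lborel)"
    by (subst emeasure_density) (auto intro!: nn_integral_cong simp: indicator_def)
  show "emeasure ?M X = emeasure ?D X"
  proof (cases "0 \<le> r")
    case True
    have "emeasure ?D {..r} = ennreal (\<kappa> * r ^ CARD('n) - \<kappa> * 0 ^ CARD('n))"
      unfolding D using True kappa_pos
      by (intro nn_integral_FTC_Icc) (auto intro!: derivative_eq_intros)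
    then show ?thesis unfolding X eqM emeasure_wulff[OF True] by (simp add: power_0_left)
  next
    case False
    then have "{x. \<rho> x \<le> r} = {}" using polar_nonneg order_trans by blast
    then show ?thesis unfolding X eqM D using False by simp
  qed
qed simp

lemma nn_integral_polar:
  assumes [measurable]: "h \<in> borel_measurable borel"
  shows "(\<integral>\<^sup>+x. h (\<rho> x) \<partial>lborel) =
     (\<integral>\<^sup>+r. ennreal (real CARD('n) * \<kappa> * r ^ (CARD('n) - 1)) * indicator {0..} r * h r \<partial>lborel)"
proof -
  have "(\<integral>\<^sup>+x. h (\<rho> x) \<partial>lborel) = (\<integral>\<^sup>+r. h r \<partial>distr lborel borel \<rho>)"
    by (subst nn_integral_distr) auto
  also have "\<dots> = (\<integral>\<^sup>+r. ennreal (real CARD('n) * \<kappa> * r ^ (CARD('n) - 1)) * indicator {0..} r * h r \<partial>lborel)"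
    unfolding distr_polar by (subst nn_integral_density) auto
  finally show ?thesis .
qed

lemma nn_integral_polar_powr_ball:
  assumes s: "s < real CARD('n)" and R: "0 \<le> R"
  shows "(\<integral>\<^sup>+x. ennreal (\<rho> x powr (- s)) * indicator {x. \<rho> x \<le> R} x \<partial>lborel)
    = ennreal (real CARD('n) * \<kappa> / (real CARD('n) - s) * R powr (real CARD('n) - s))"
proof -
  let ?N = "real CARD('n)"
  have "(\<integral>\<^sup>+x. ennreal (\<rho> x powr (- s)) * indicator {x. \<rho> x \<le> R} x \<partial>lborel)
      = (\<integral>\<^sup>+x. ennreal (\<rho> x powr (- s)) * indicator {..R} (\<rho> x) \<partial>lborel)"
    by (intro nn_integral_cong) (auto simp: indicator_def)
  also have "\<dots> = (\<integral>\<^sup>+r. ennreal (?N * \<kappa> * r ^ (CARD('n) - 1)) * indicator {0..} r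
      * (ennreal (r powr (- s)) * indicator {..R} r) \<partial>lborel)"
    by (rule nn_integral_polar) measurable
  also have "\<dots> = (\<integral>\<^sup>+r. ennreal (?N * \<kappa> * r powr (?N - 1 - s)) * indicator {0..R} r \<partial>lborel)"
  proof (rule nn_integral_cong_AE)
    have "AE r in lborel. r \<noteq> (0::real)" by (rule AE_lborel_singleton)
    then show "AE r in lborel. ennreal (?N * \<kappa> * r ^ (CARD('n) - 1)) * indicator {0..} r
      * (ennreal (r powr (- s)) * indicator {..R} r) =
      ennreal (?N * \<kappa> * r powr (?N - 1 - s)) * indicator {0..R} r"
    proof eventually_elim
      case (elim r)
      show ?case
      proof (cases "0 < r")
        case True
        have "r ^ (CARD('n) - 1) * r powr (- s) = r powr (?N - 1 - s)"
          using True by (simp add: powr_realpow[symmetric] powr_add[symmetric] of_nat_diff Suc_leI)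
        then have "?N * \<kappa> * r ^ (CARD('n) - 1) * r powr (- s) = ?N * \<kappa> * r powr (?N - 1 - s)"
          by (simp add: mult.assoc)
        then show ?thesis using True kappa_pos
          by (auto simp: indicator_def ennreal_mult[symmetric])
      qed (use elim in \<open>auto simp: indicator_def\<close>)
    qed
  qed
  also have "\<dots> = ennreal (?N * \<kappa> * (R powr (?N - 1 - s + 1) / (?N - 1 - s + 1)))"
  proof -
    have "((\<lambda>r. ?N * \<kappa> * r powr (?N - 1 - s)) has_integral
        ?N * \<kappa> * (R powr (?N - 1 - s + 1) / (?N - 1 - s + 1))) {0..R}"
      using s R by (intro has_integral_mult_right has_integral_powr_from_0) auto
    from nn_integral_has_integral_lebesgue'[OF _ this] kappa_pos show ?thesis
      by (simp add: mult.commute)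
  qed
  finally show ?thesis by simp
qed

text \<open>At the exponent -N the radial integrand becomes dr/r. This is the only source of the
  logarithm in the level estimate, and its coefficient N \<kappa> is responsible for the sharp
  constant.\<close>

lemma nn_integral_polar_annulus:
  assumes "0 < R" "R \<le> R0"
  shows "(\<integral>\<^sup>+x. ennreal (\<rho> x powr (- real CARD('n))) * indicator {x. R \<le> \<rho> x \<and> \<rho> x \<le> R0} x \<partial>lborel)
    = ennreal (real CARD('n) * \<kappa> * ln (R0 / R))"
proof -
  let ?N = "real CARD('n)"
  have "(\<integral>\<^sup>+x. ennreal (\<rho> x powr (- ?N)) * indicator {x. R \<le> \<rho> x \<and> \<rho> x \<le> R0} x \<partial>lborel)
      = (\<integral>\<^sup>+x. ennreal (\<rho> x powr (- ?N)) * indicator {R..R0} (\<rho> x) \<partial>lborel)"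
    by (intro nn_integral_cong) (auto simp: indicator_def)
  also have "\<dots> = (\<integral>\<^sup>+r. ennreal (?N * \<kappa> * r ^ (CARD('n) - 1)) * indicator {0..} r
      * (ennreal (r powr (- ?N)) * indicator {R..R0} r) \<partial>lborel)"
    by (rule nn_integral_polar) measurable
  also have "\<dots> = (\<integral>\<^sup>+r. ennreal (?N * \<kappa> * (1 / r)) * indicator {R..R0} r \<partial>lborel)"
  proof (rule nn_integral_cong)
    fix r :: real
    show "ennreal (?N * \<kappa> * r ^ (CARD('n) - 1)) * indicator {0..} r
      * (ennreal (r powr (- ?N)) * indicator {R..R0} r) = ennreal (?N * \<kappa> * (1 / r)) * indicator {R..R0} r"
    proof (cases "R \<le> r")
      case True
      then have "0 < r" using assms by simp
      have "r ^ (CARD('n) - 1) * r powr (- ?N) = r powr (?N - 1 - ?N)"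
        using \<open>0 < r\<close> by (simp add: powr_realpow[symmetric] powr_add[symmetric] of_nat_diff Suc_leI)
      also have "?N - 1 - ?N = -1" by simp
      finally have "r ^ (CARD('n) - 1) * r powr (- ?N) = 1 / r"
        using \<open>0 < r\<close> by (simp add: powr_minus_divide)
      then have "?N * \<kappa> * r ^ (CARD('n) - 1) * r powr (- ?N) = ?N * \<kappa> * (1 / r)"
        by (simp only: mult.assoc)
      then show ?thesis using \<open>0 < r\<close> kappa_pos
        by (auto simp: indicator_def ennreal_mult[symmetric])
    qed (simp add: indicator_def)
  qed
  also have "\<dots> = ennreal (?N * \<kappa> * ln R0 - ?N * \<kappa> * ln R)"
    using assms kappa_pos by (intro nn_integral_FTC_Icc) (auto intro!: derivative_eq_intros)
  finally show ?thesis using assms by (simp add: ln_div algebra_simps)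
qed

text \<open>Integrating the hypothesis over the Wulff ball and substituting \<open>z = r y\<close> replaces polar coordinates.\<close>

lemma ray_average:
  assumes [measurable]: "G \<in> borel_measurable borel"
    and ray: "\<And>y. y \<noteq> 0 \<Longrightarrow> ennreal c \<le> (\<integral>\<^sup>+r. G (r *\<^sub>R y) * ennreal (\<rho> y) * indicator {0<..} r \<partial>lborel)"
  shows "ennreal (real CARD('n) * \<kappa>) * ennreal c \<le> (\<integral>\<^sup>+z. G z * ennreal (\<rho> z powr (1 - real CARD('n))) \<partial>lborel)"
proof -
  let ?N = "real CARD('n)"
  have N: "0 < ?N" by simp
  have "ennreal \<kappa> * ennreal c = (\<integral>\<^sup>+y. ennreal c * indicator {y. \<rho> y \<le> 1} y \<partial>lborel)"
    by (subst nn_integral_cmult) (simp_all add: emeasure_wulff_1 mult.commute)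
  also have "\<dots> \<le> (\<integral>\<^sup>+y. (\<integral>\<^sup>+r. G (r *\<^sub>R y) * ennreal (\<rho> y) * indicator {0<..} r \<partial>lborel)
      * indicator {y. \<rho> y \<le> 1} y \<partial>lborel)"
  proof (rule nn_integral_mono_AE)
    have "AE y in lborel. y \<noteq> (0::real^'n)" by (rule AE_lborel_singleton)
    then show "AE y in lborel. ennreal c * indicator {y. \<rho> y \<le> 1} y \<le>
      (\<integral>\<^sup>+r. G (r *\<^sub>R y) * ennreal (\<rho> y) * indicator {0<..} r \<partial>lborel) * indicator {y. \<rho> y \<le> 1} y"
      by eventually_elim (intro mult_right_mono ray, auto)
  qed
  also have "\<dots> = (\<integral>\<^sup>+y. (\<integral>\<^sup>+r. G (r *\<^sub>R y) * ennreal (\<rho> y) * indicator {0<..} r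
      * indicator {y. \<rho> y \<le> 1} y \<partial>lborel) \<partial>lborel)"
    by (subst nn_integral_multc) auto
  also have "\<dots> = (\<integral>\<^sup>+r. (\<integral>\<^sup>+y. G (r *\<^sub>R y) * ennreal (\<rho> y) * indicator {0<..} r
      * indicator {y. \<rho> y \<le> 1} y \<partial>lborel) \<partial>lborel)"
    by (rule lborel_pair.Fubini') measurable
  \<comment> \<open>For fixed r > 0 the Jacobian r^N and the factor r in \<rho> z = r \<rho> y are
    compensated by r^(-N-1), and the Wulff ball in y becomes the condition \<rho> z \<le> r.\<close>
  also have "\<dots> = (\<integral>\<^sup>+r. (\<integral>\<^sup>+z. G z * ennreal (\<rho> z) *
      (ennreal (r powr (- ?N - 1)) * indicator {r. 0 < r \<and> \<rho> z \<le> r} r) \<partial>lborel) \<partial>lborel)"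
  proof (rule nn_integral_cong)
    fix r :: real
    show "(\<integral>\<^sup>+y. G (r *\<^sub>R y) * ennreal (\<rho> y) * indicator {0<..} r * indicator {y. \<rho> y \<le> 1} y \<partial>lborel)
      = (\<integral>\<^sup>+z. G z * ennreal (\<rho> z) * (ennreal (r powr (- ?N - 1)) * indicator {r. 0 < r \<and> \<rho> z \<le> r} r) \<partial>lborel)"
    proof (cases "0 < r")
      case True
      have "(\<integral>\<^sup>+z. G z * ennreal (\<rho> z) * (ennreal (r powr (- ?N - 1)) * indicator {r. 0 < r \<and> \<rho> z \<le> r} r) \<partial>lborel)
        = ennreal (\<bar>r\<bar> ^ DIM(real^'n)) * (\<integral>\<^sup>+y. G (r *\<^sub>R y) * ennreal (\<rho> (r *\<^sub>R y)) *
          (ennreal (r powr (- ?N - 1)) * indicator {r'. 0 < r' \<and> \<rho> (r *\<^sub>R y) \<le> r'} r) \<partial>lborel)"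
        by (rule nn_integral_lborel_scaleR) (use True in auto)
      also have "\<dots> = (\<integral>\<^sup>+y. ennreal (\<bar>r\<bar> ^ DIM(real^'n)) * (G (r *\<^sub>R y) * ennreal (\<rho> (r *\<^sub>R y)) *
          (ennreal (r powr (- ?N - 1)) * indicator {r'. 0 < r' \<and> \<rho> (r *\<^sub>R y) \<le> r'} r)) \<partial>lborel)"
        by (subst nn_integral_cmult) auto
      also have "\<dots> = (\<integral>\<^sup>+y. G (r *\<^sub>R y) * ennreal (\<rho> y) * indicator {0<..} r * indicator {y. \<rho> y \<le> 1} y \<partial>lborel)"
      proof (rule nn_integral_cong)
        fix y
        have "r ^ CARD('n) * (r * \<rho> y) * r powr (- ?N - 1) = r powr (?N + 1 + (- ?N - 1)) * \<rho> y"
          using True by (simp only: powr_add powr_realpow) simp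
        then have e: "r ^ CARD('n) * (r * \<rho> y) * r powr (- ?N - 1) = \<rho> y" using True by simp
        have "ennreal (\<bar>r\<bar> ^ DIM(real^'n)) * (G (r *\<^sub>R y) * ennreal (\<rho> (r *\<^sub>R y)) * ennreal (r powr (- ?N - 1)))
          = G (r *\<^sub>R y) * ennreal (r ^ CARD('n) * (r * \<rho> y) * r powr (- ?N - 1))"
          using True by (simp add: polar_scale ennreal_mult mult_ac)
        then show "ennreal (\<bar>r\<bar> ^ DIM(real^'n)) * (G (r *\<^sub>R y) * ennreal (\<rho> (r *\<^sub>R y)) *
          (ennreal (r powr (- ?N - 1)) * indicator {r'. 0 < r' \<and> \<rho> (r *\<^sub>R y) \<le> r'} r))
          = G (r *\<^sub>R y) * ennreal (\<rho> y) * indicator {0<..} r * indicator {y. \<rho> y \<le> 1} y"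
          unfolding e using True by (auto simp: indicator_def polar_scale mult_ac)
      qed
      finally show ?thesis by simp
    qed simp
  qed
  also have "\<dots> = (\<integral>\<^sup>+z. (\<integral>\<^sup>+r. G z * ennreal (\<rho> z) *
      (ennreal (r powr (- ?N - 1)) * indicator {r. 0 < r \<and> \<rho> z \<le> r} r) \<partial>lborel) \<partial>lborel)"
    by (rule lborel_pair.Fubini') measurable
  \<comment> \<open>For fixed z the remaining radii are r \<ge> \<rho> z. Integrating r^(-N-1) over
    them and multiplying by \<rho> z produces the kernel \<rho> z^(1-N) / N.\<close>
  also have "\<dots> = (\<integral>\<^sup>+z. G z * ennreal (\<rho> z) * ennreal (\<rho> z powr (- ?N) / ?N) \<partial>lborel)"
  proof (rule nn_integral_cong)
    fix z
    show "(\<integral>\<^sup>+r. G z * ennreal (\<rho> z) * (ennreal (r powr (- ?N - 1)) * indicator {r. 0 < r \<and> \<rho> z \<le> r} r) \<partial>lborel)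
      = G z * ennreal (\<rho> z) * ennreal (\<rho> z powr (- ?N) / ?N)"
    proof (cases "z = 0")
      case False
      then have z: "0 < \<rho> z" by simp
      have "(\<integral>\<^sup>+r. ennreal (r powr (- ?N - 1)) * indicator {\<rho> z..} r \<partial>lborel)
          = ennreal (0 - (- (\<rho> z powr (- ?N) / ?N)))"
      proof (rule nn_integral_FTC_atLeast)
        have "((\<lambda>r. r powr (- ?N)) \<longlongrightarrow> 0) at_top"
          using N by (intro tendsto_neg_powr filterlim_ident) simp
        then have "((\<lambda>r. - (r powr (- ?N) / ?N)) \<longlongrightarrow> - (0 / ?N)) at_top"
          by (intro tendsto_intros) auto
        then show "((\<lambda>r. - (r powr (- ?N) / ?N)) \<longlongrightarrow> 0) at_top" by simp
      qed (use less_le_trans[OF z] in \<open>auto intro!: derivative_eq_intros\<close>)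
      moreover have "{r. 0 < r \<and> \<rho> z \<le> r} = {\<rho> z..}"
        unfolding atLeast_def using less_le_trans[OF z] by blast
      ultimately show ?thesis by (subst nn_integral_cmult) simp_all
    qed simp
  qed
  also have "\<dots> = (\<integral>\<^sup>+z. ennreal (1 / ?N) * (G z * ennreal (\<rho> z powr (1 - ?N))) \<partial>lborel)"
  proof (rule nn_integral_cong)
    fix z
    have "\<rho> z * (\<rho> z powr (- ?N) / ?N) = 1 / ?N * \<rho> z powr (1 - ?N)"
      by (cases "z = 0") (simp_all add: powr_diff powr_minus_divide)
    moreover have "G z * ennreal (\<rho> z) * ennreal (\<rho> z powr (- ?N) / ?N) = G z * ennreal (\<rho> z * (\<rho> z powr (- ?N) / ?N))"
      by (subst ennreal_mult) (simp_all add: mult.assoc)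
    ultimately show "G z * ennreal (\<rho> z) * ennreal (\<rho> z powr (- ?N) / ?N)
        = ennreal (1 / ?N) * (G z * ennreal (\<rho> z powr (1 - ?N)))"
      by (simp only:) (subst ennreal_mult, simp_all add: mult_ac)
  qed
  also have "\<dots> = ennreal (1 / ?N) * (\<integral>\<^sup>+z. G z * ennreal (\<rho> z powr (1 - ?N)) \<partial>lborel)"
    by (rule nn_integral_cmult) measurable
  finally have "ennreal ?N * (ennreal \<kappa> * ennreal c)
      \<le> ennreal ?N * (ennreal (1 / ?N) * (\<integral>\<^sup>+z. G z * ennreal (\<rho> z powr (1 - ?N)) \<partial>lborel))"
    by (rule mult_left_mono) simp
  also have "\<dots> = (\<integral>\<^sup>+z. G z * ennreal (\<rho> z powr (1 - ?N)) \<partial>lborel)"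
    unfolding mult.assoc[symmetric] by (simp add: ennreal_mult[symmetric])
  finally show ?thesis using kappa_pos by (simp add: ennreal_mult mult.assoc)
qed

end

section \<open>Level set estimates\<close>

text \<open>Let r2 be the first point with |g| \<le> a and r1 the last point before it with |g|
  \<ge> b. Between them |g| stays strictly inside the strip, and the fundamental theorem of calculus
  on [r1, r2] gives variation at least b - a. Working with g itself avoids differentiating a
  truncation of |g|.\<close>

lemma nn_integral_abs_deriv_level_ge:
  fixes g g' :: "real \<Rightarrow> real"
  assumes deriv: "\<And>r. (g has_real_derivative g' r) (at r)" and cont: "continuous_on UNIV g'"
    and R: "0 \<le> R" "g R = 0" and ab: "0 \<le> a" "a < b" "b \<le> \<bar>g 0\<bar>"
  shows "ennreal (b - a)
    \<le> (\<integral>\<^sup>+r. ennreal \<bar>g' r\<bar> * indicator {r. 0 < r \<and> a < \<bar>g r\<bar> \<and> \<bar>g r\<bar> < b} r \<partial>lborel)"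
proof -
  have cg: "continuous_on S g" for S
    by (meson DERIV_continuous_on deriv has_field_derivative_at_within)
  have "closed ({0..R} \<inter> {r. \<bar>g r\<bar> \<le> a})"
    by (intro closed_Int closed_Collect_le continuous_intros cg)
  then have "compact ({0..R} \<inter> {r. \<bar>g r\<bar> \<le> a})"
    by (auto simp: compact_eq_bounded_closed intro: bounded_subset[of "{0..R}"])
  moreover have "{0..R} \<inter> {r. \<bar>g r\<bar> \<le> a} \<noteq> {}" using R ab by (auto intro!: exI[of _ R])
  ultimately obtain r2 where S2: "r2 \<in> {0..R} \<inter> {r. \<bar>g r\<bar> \<le> a}"
    "\<forall>r \<in> {0..R} \<inter> {r. \<bar>g r\<bar> \<le> a}. r2 \<le> r"
    using compact_attains_inf[of "{0..R} \<inter> {r. \<bar>g r\<bar> \<le> a}"] by blast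
  then have r2: "0 \<le> r2" "r2 \<le> R" "\<bar>g r2\<bar> \<le> a"
    and r2_min: "\<And>r. 0 \<le> r \<Longrightarrow> r \<le> R \<Longrightarrow> \<bar>g r\<bar> \<le> a \<Longrightarrow> r2 \<le> r"
    by auto
  have "closed ({0..r2} \<inter> {r. b \<le> \<bar>g r\<bar>})"
    by (intro closed_Int closed_Collect_le continuous_intros cg)
  then have "compact ({0..r2} \<inter> {r. b \<le> \<bar>g r\<bar>})"
    by (auto simp: compact_eq_bounded_closed intro: bounded_subset[of "{0..r2}"])
  moreover have "{0..r2} \<inter> {r. b \<le> \<bar>g r\<bar>} \<noteq> {}" using r2 ab by (auto intro!: exI[of _ 0])
  ultimately obtain r1 where S1: "r1 \<in> {0..r2} \<inter> {r. b \<le> \<bar>g r\<bar>}"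
    "\<forall>r \<in> {0..r2} \<inter> {r. b \<le> \<bar>g r\<bar>}. r \<le> r1"
    using compact_attains_sup[of "{0..r2} \<inter> {r. b \<le> \<bar>g r\<bar>}"] by blast
  then have r1: "0 \<le> r1" "r1 \<le> r2" "b \<le> \<bar>g r1\<bar>"
    and r1_max: "\<And>r. 0 \<le> r \<Longrightarrow> r \<le> r2 \<Longrightarrow> b \<le> \<bar>g r\<bar> \<Longrightarrow> r \<le> r1"
    by auto
  have between: "a < \<bar>g r\<bar> \<and> \<bar>g r\<bar> < b" if "r1 < r" "r < r2" for r
    using r1_max[of r] r2_min[of r] that r1 r2 by (meson leD leI less_imp_le order_trans)
  have int: "(\<lambda>r. \<bar>g' r\<bar>) integrable_on {r1..r2}" "g' integrable_on {r1..r2}"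
    by (intro integrable_continuous_real continuous_intros continuous_on_subset[OF cont]; simp)+
  have "(g' has_integral (g r2 - g r1)) {r1..r2}"
    by (rule fundamental_theorem_of_calculus[OF r1(2)])
      (meson deriv has_field_derivative_at_within has_real_derivative_iff_has_vector_derivative)
  then have "\<bar>g r2 - g r1\<bar> \<le> integral {r1..r2} (\<lambda>r. \<bar>g' r\<bar>)"
    using integral_norm_bound_integral[OF int(2,1)] by (simp add: integral_unique)
  then have "ennreal (b - a) \<le> ennreal (integral {r1..r2} (\<lambda>r. \<bar>g' r\<bar>))"
    using r1(3) r2(3) by (intro ennreal_leI) linarith
  also have "\<dots> = (\<integral>\<^sup>+r. ennreal (\<bar>g' r\<bar>) * indicator {r1..r2} r \<partial>lborel)"
    using nn_integral_has_integral_lebesgue'[OF _ integrable_integral[OF int(1)]]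
    by (simp add: mult.commute)
  also have "\<dots> \<le> (\<integral>\<^sup>+r. ennreal \<bar>g' r\<bar> * indicator {r. 0 < r \<and> a < \<bar>g r\<bar> \<and> \<bar>g r\<bar> < b} r \<partial>lborel)"
  proof (rule nn_integral_mono_AE)
    have "AE r in lborel. r \<noteq> r1" "AE r in lborel. r \<noteq> r2" by (rule AE_lborel_singleton)+
    then show "AE r in lborel. ennreal (\<bar>g' r\<bar>) * indicator {r1..r2} r
      \<le> ennreal \<bar>g' r\<bar> * indicator {r. 0 < r \<and> a < \<bar>g r\<bar> \<and> \<bar>g r\<bar> < b} r"
    proof eventually_elim
      case (elim r)
      show ?case
      proof (cases "r1 \<le> r \<and> r \<le> r2")
        case True
        then have "r1 < r" "r < r2" "0 < r" using elim r1 by auto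
        then show ?thesis using between[of r] by simp
      qed (auto simp: indicator_def)
    qed
  qed
  finally show ?thesis .
qed

lemma nn_integral_Holder:
  fixes f h :: "'a \<Rightarrow> real" and p q e k :: real
  assumes [measurable]: "f \<in> borel_measurable M" "h \<in> borel_measurable M"
    and nonneg: "\<And>x. 0 \<le> f x" "\<And>x. 0 \<le> h x" "0 \<le> e" "0 \<le> k"
    and pq: "1 < p" "1 < q" "1 / p + 1 / q = 1"
    and e: "(\<integral>\<^sup>+x. ennreal (f x powr p) \<partial>M) \<le> ennreal e"
    and k: "(\<integral>\<^sup>+x. ennreal (h x powr q) \<partial>M) \<le> ennreal k"
  shows "(\<integral>\<^sup>+x. ennreal (f x * h x) \<partial>M) \<le> ennreal (e powr (1 / p) * k powr (1 / q))"
proof -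
  have zero: "(\<integral>\<^sup>+x. ennreal (f x * h x) \<partial>M) = 0"
    if "(\<integral>\<^sup>+x. ennreal (g x powr s) \<partial>M) = 0" "g = f \<or> g = h" for g s
  proof -
    have [measurable]: "g \<in> borel_measurable M" using that(2) by auto
    have "AE x in M. ennreal (g x powr s) = 0" using that(1) by (subst (asm) nn_integral_0_iff_AE) auto
    then have "AE x in M. ennreal (f x * h x) = 0"
      by eventually_elim (use that(2) nonneg in \<open>auto simp: powr_def split: if_splits\<close>)
    then show ?thesis by (subst nn_integral_0_iff_AE) auto
  qed
  show ?thesis
  proof (cases "e = 0 \<or> k = 0")
    case True
    then show ?thesis using zero[of f p] zero[of h q] e k by auto
  next
    case False
    then have pos: "0 < e" "0 < k" using nonneg by auto
    define E where "E = e powr (1 / p)"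
    define K where "K = k powr (1 / q)"
    have EK: "0 < E" "0 < K" "E powr p = e" "K powr q = k"
      using pos pq by (auto simp: E_def K_def powr_powr)
    have "(\<integral>\<^sup>+x. ennreal (f x * h x) \<partial>M)
        \<le> (\<integral>\<^sup>+x. ennreal (E * K / (p * e)) * ennreal (f x powr p)
            + ennreal (E * K / (q * k)) * ennreal (h x powr q) \<partial>M)"
    proof (rule nn_integral_mono)
      fix x
      have "f x / E * (h x / K) \<le> (f x / E) powr p / p + (h x / K) powr q / q"
        using nonneg EK by (intro Youngs_inequality pq) auto
      then have "E * K * (f x / E * (h x / K)) \<le> E * K * ((f x / E) powr p / p + (h x / K) powr q / q)"
        using EK by (intro mult_left_mono) auto
      also have "\<dots> = E * K / (p * e) * f x powr p + E * K / (q * k) * h x powr q"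
        using nonneg EK by (simp add: powr_divide algebra_simps)
      finally have "f x * h x \<le> E * K / (p * e) * f x powr p + E * K / (q * k) * h x powr q"
        using EK by simp
      then show "ennreal (f x * h x) \<le> ennreal (E * K / (p * e)) * ennreal (f x powr p)
            + ennreal (E * K / (q * k)) * ennreal (h x powr q)"
        using EK pos pq by (simp add: ennreal_mult[symmetric] ennreal_plus[symmetric] ennreal_leI del: ennreal_plus)
    qed
    also have "\<dots> = ennreal (E * K / (p * e)) * (\<integral>\<^sup>+x. ennreal (f x powr p) \<partial>M)
            + ennreal (E * K / (q * k)) * (\<integral>\<^sup>+x. ennreal (h x powr q) \<partial>M)"
      by (subst nn_integral_add) (simp_all add: nn_integral_cmult)
    also have "\<dots> \<le> ennreal (E * K / (p * e)) * ennreal e + ennreal (E * K / (q * k)) * ennreal k"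
      by (intro add_mono mult_left_mono e k) auto
    also have "\<dots> = ennreal (E * K / (p * e) * e + E * K / (q * k) * k)"
      using EK pos pq by (simp add: ennreal_mult[symmetric] ennreal_plus[symmetric] del: ennreal_plus)
    also have "E * K / (p * e) * e + E * K / (q * k) * k = E * K * (1 / p + 1 / q)"
      using pos by (simp add: field_simps)
    finally show ?thesis using pq unfolding E_def K_def by simp
  qed
qed

lemma powr_realpow_of_nonneg: "0 \<le> x \<Longrightarrow> 0 < n \<Longrightarrow> x powr real n = x ^ n"
  by (cases "x = 0") (simp_all add: powr_realpow)

text \<open>The two non-logarithmic contributions in \<open>level_estimate\<close>: 1 comes from the
  region beyond the Wulff ball of measure V, the second summand from the neighbourhood of the pole,
  where the kernel is replaced by a tangent bound. It depends on the dimension alone.\<close>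

definition level_const :: "real \<Rightarrow> real" where
  "level_const N = 1 + N / (N - 1) * N * (N + 1) powr (1 / (N - 1))"

context finsler_norm
begin

text \<open>Split D at the Wulff ball of radius R about y: inside, the integral over the whole ball
  is explicit; outside, the weight is at most R^(-s). With \<kappa> R^N = m this has the order of
  the rearrangement bound and loses only a constant factor, so it is used only where such a loss is
  harmless.\<close>

lemma nn_integral_polar_powr_le:
  assumes s: "0 \<le> s" "s < real CARD('n)" and R: "0 < R"
    and [measurable]: "D \<in> sets borel" and m: "emeasure lborel D \<le> ennreal m" "0 \<le> m"
  shows "(\<integral>\<^sup>+x. ennreal (\<rho> (y - x) powr (- s)) * indicator D x \<partial>lborel)
    \<le> ennreal (real CARD('n) * \<kappa> / (real CARD('n) - s) * R powr (real CARD('n) - s) + R powr (- s) * m)"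
proof -
  have "(\<integral>\<^sup>+x. ennreal (\<rho> (y - x) powr (- s)) * indicator D x \<partial>lborel)
    \<le> (\<integral>\<^sup>+x. ennreal (\<rho> (y - x) powr (- s)) * indicator {x. \<rho> x \<le> R} (y - x)
        + ennreal (R powr (- s)) * indicator D x \<partial>lborel)"
  proof (rule nn_integral_mono)
    fix x
    have "\<rho> (y - x) powr (- s) \<le> R powr (- s)" if "R < \<rho> (y - x)"
      using that s R by (intro powr_mono2') auto
    then show "ennreal (\<rho> (y - x) powr (- s)) * indicator D x
      \<le> ennreal (\<rho> (y - x) powr (- s)) * indicator {x. \<rho> x \<le> R} (y - x)
        + ennreal (R powr (- s)) * indicator D x"
      by (cases "\<rho> (y - x) \<le> R") (auto simp: indicator_def ennreal_leI)
  qed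
  also have "\<dots> = (\<integral>\<^sup>+x. ennreal (\<rho> (y - x) powr (- s)) * indicator {x. \<rho> x \<le> R} (y - x) \<partial>lborel)
      + (\<integral>\<^sup>+x. ennreal (R powr (- s)) * indicator D x \<partial>lborel)"
    by (rule nn_integral_add) measurable
  also have "(\<integral>\<^sup>+x. ennreal (\<rho> (y - x) powr (- s)) * indicator {x. \<rho> x \<le> R} (y - x) \<partial>lborel)
      = (\<integral>\<^sup>+x. ennreal (\<rho> x powr (- s)) * indicator {x. \<rho> x \<le> R} x \<partial>lborel)"
    by (rule nn_integral_lborel_minus[where f = "\<lambda>x. ennreal (\<rho> x powr (- s)) * indicator {x. \<rho> x \<le> R} x"])
       measurable
  also have "(\<integral>\<^sup>+x. ennreal (R powr (- s)) * indicator D x \<partial>lborel) = ennreal (R powr (- s)) * emeasure lborel D"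
    by (rule nn_integral_cmult_indicator) measurable
  also have "(\<integral>\<^sup>+x. ennreal (\<rho> x powr (- s)) * indicator {x. \<rho> x \<le> R} x \<partial>lborel)
      + ennreal (R powr (- s)) * emeasure lborel D
    \<le> ennreal (real CARD('n) * \<kappa> / (real CARD('n) - s) * R powr (real CARD('n) - s)) + ennreal (R powr (- s)) * ennreal m"
    using nn_integral_polar_powr_ball[OF s(2), of R] R
    by (intro add_mono mult_left_mono m) auto
  also have "\<dots> = ennreal (real CARD('n) * \<kappa> / (real CARD('n) - s) * R powr (real CARD('n) - s) + R powr (- s) * m)"
    using s m kappa_pos by (simp add: ennreal_mult)
  finally show ?thesis .
qed

end

section \<open>Compactly supported functions: bounds along rays and between two levels\<close>

locale compactly_supported_C1 = finsler_norm F for F :: "real^'n \<Rightarrow> real" +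
  fixes \<phi> :: "real^'n \<Rightarrow> real" and G :: "real^'n \<Rightarrow> real^'n"
  assumes dim: "2 \<le> CARD('n)"
    and deriv: "(\<phi> has_derivative (\<lambda>h. G x \<bullet> h)) (at x)"
    and G_continuous: "continuous_on UNIV G"
    and supp: "bounded {x. \<phi> x \<noteq> 0}"
begin

lemma phi_continuous: "continuous_on S \<phi>"
  by (meson deriv has_derivative_continuous_on has_derivative_at_withinI)

lemma phi_measurable [measurable]: "\<phi> \<in> borel_measurable borel"
  by (rule borel_measurable_continuous_onI[OF phi_continuous])

lemma G_measurable [measurable]: "G \<in> borel_measurable borel"
  by (rule borel_measurable_continuous_onI[OF G_continuous])

text \<open>Along the ray from x in direction y the derivative of \<phi> is at most F(G) \<rho>(y)
  by duality, and the ray leaves the support, so the one-dimensional strip estimate applies in every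
  direction. \<open>ray_average\<close> then produces the kernel.\<close>

lemma ray_estimate:
  assumes ab: "0 \<le> a" "a < b" "b \<le> \<bar>\<phi> x\<bar>"
  shows "ennreal (real CARD('n) * \<kappa>) * ennreal (b - a)
    \<le> (\<integral>\<^sup>+y. ennreal (F (G y)) * indicator {y. a < \<bar>\<phi> y\<bar> \<and> \<bar>\<phi> y\<bar> < b} y
         * ennreal (\<rho> (x - y) powr (1 - real CARD('n))) \<partial>lborel)"
proof -
  define A where "A = {y. a < \<bar>\<phi> y\<bar> \<and> \<bar>\<phi> y\<bar> < b}"
  have [measurable]: "A \<in> sets borel" unfolding A_def by measurable
  define g0 where "g0 = (\<lambda>y. ennreal (F (G y)) * indicator A y)"
  have [measurable]: "g0 \<in> borel_measurable borel" unfolding g0_def by measurable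
  have "ennreal (real CARD('n) * \<kappa>) * ennreal (b - a)
      \<le> (\<integral>\<^sup>+z. g0 (x + z) * ennreal (\<rho> z powr (1 - real CARD('n))) \<partial>lborel)"
  proof (rule ray_average)
    fix y :: "real^'n" assume y: "y \<noteq> 0"
    define g where "g r = \<phi> (x + r *\<^sub>R y)" for r
    define g' where "g' r = G (x + r *\<^sub>R y) \<bullet> y" for r
    obtain B where B: "\<And>z. \<phi> z \<noteq> 0 \<Longrightarrow> norm z \<le> B"
      using supp by (auto simp: bounded_iff)
    \<comment> \<open>At this radius x + R y has norm at least |B| + 1, hence lies outside the
      support. The absolute value covers an empty support, for which B may be negative.\<close>
    define R where "R = (\<bar>B\<bar> + norm x + 1) / norm y"
    have R: "0 \<le> R" "R * norm y = \<bar>B\<bar> + norm x + 1" using y unfolding R_def by (auto simp: field_simps)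
    have "g R = 0"
    proof (rule ccontr)
      assume "g R \<noteq> 0"
      then have "norm (x + R *\<^sub>R y) \<le> B" using B unfolding g_def by blast
      moreover have "norm (R *\<^sub>R y) \<le> norm (x + R *\<^sub>R y) + norm x"
        using norm_triangle_ineq4[of "x + R *\<^sub>R y" x] by simp
      ultimately show False using R by simp
    qed
    have "ennreal (b - a)
      \<le> (\<integral>\<^sup>+r. ennreal \<bar>g' r\<bar> * indicator {r. 0 < r \<and> a < \<bar>g r\<bar> \<and> \<bar>g r\<bar> < b} r \<partial>lborel)"
    proof (rule nn_integral_abs_deriv_level_ge[where R = R, OF _ _ R(1) _ ab(1,2)])
      show "g R = 0" by fact
      show "(g has_real_derivative g' r) (at r)" for r
        unfolding g_def g'_def has_field_derivative_def
        by (rule has_derivative_eq_rhs[OF has_derivative_compose[OF _ deriv]])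
          (auto intro!: derivative_eq_intros simp: fun_eq_iff)
      show "continuous_on UNIV g'"
        unfolding g'_def by (intro continuous_intros continuous_on_compose2[OF G_continuous]) auto
      show "b \<le> \<bar>g 0\<bar>" using ab by (simp add: g_def)
    qed
    also have "\<dots> \<le> (\<integral>\<^sup>+r. g0 (x + r *\<^sub>R y) * ennreal (\<rho> y) * indicator {0<..} r \<partial>lborel)"
    proof (rule nn_integral_mono)
      fix r
      have "ennreal \<bar>g' r\<bar> \<le> ennreal (F (G (x + r *\<^sub>R y))) * ennreal (\<rho> y)"
        using abs_inner_le_polar[of y "G (x + r *\<^sub>R y)"] F_nonneg unfolding g'_def
        by (simp add: ennreal_mult[symmetric] ennreal_leI inner_commute mult.commute)
      then show "ennreal \<bar>g' r\<bar> * indicator {r. 0 < r \<and> a < \<bar>g r\<bar> \<and> \<bar>g r\<bar> < b} r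
        \<le> g0 (x + r *\<^sub>R y) * ennreal (\<rho> y) * indicator {0<..} r"
        unfolding g0_def A_def g_def by (auto simp: indicator_def)
    qed
    finally show "ennreal (b - a) \<le> (\<integral>\<^sup>+r. g0 (x + r *\<^sub>R y) * ennreal (\<rho> y) * indicator {0<..} r \<partial>lborel)" .
  qed measurable
  also have "\<dots> = (\<integral>\<^sup>+z. g0 (x + z) * ennreal (\<rho> (x - (x + z)) powr (1 - real CARD('n))) \<partial>lborel)"
    by simp
  also have "\<dots> = (\<integral>\<^sup>+y. g0 y * ennreal (\<rho> (x - y) powr (1 - real CARD('n))) \<partial>lborel)"
    by (rule nn_integral_lborel_translate[where f = "\<lambda>y. g0 y * ennreal (\<rho> (x - y) powr (1 - real CARD('n)))"])
      measurable
  finally show ?thesis unfolding g0_def A_def .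
qed

definition level_energy :: "real \<Rightarrow> real \<Rightarrow> ennreal" where
  "level_energy a b = (\<integral>\<^sup>+x. ennreal (F (G x) ^ CARD('n)) * indicator {x. a < \<bar>\<phi> x\<bar> \<and> \<bar>\<phi> x\<bar> < b} x \<partial>lborel)"

text \<open>Averaging \<open>ray_estimate\<close> over D and exchanging the integrals leaves F(G) on
  A against H, the mean over D of the kernel k. After Hoelder's inequality the integral of H^q over
  A must be bounded with the exact logarithmic coefficient. Plain Jensen would replace H^q by the
  mean of k^q = c^q \<rho>^(-N), whose integral diverges at the pole; the boundedness of H by h is
  what permits a repair there.\<close>

lemma level_estimate:
  assumes ab: "0 \<le> a" "a < b"
    and V: "emeasure lborel {x. a < \<bar>\<phi> x\<bar>} \<le> ennreal V"
    and m: "emeasure lborel {x. b \<le> \<bar>\<phi> x\<bar>} = ennreal m" "0 < m"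
    and e: "level_energy a b \<le> ennreal e" "0 \<le> e"
  shows "lambda_N F * (b - a) powr (real CARD('n) / (real CARD('n) - 1))
    \<le> e powr (1 / (real CARD('n) - 1)) * (ln (V / m) + level_const (real CARD('n)))"
proof -
  define N where "N = real CARD('n)"
  define r where "r = 1 / (N - 1)"
  define q where "q = N / (N - 1)"
  define c where "c = 1 / (N * \<kappa>)"
  define A where "A = {x. a < \<bar>\<phi> x\<bar> \<and> \<bar>\<phi> x\<bar> < b}"
  define D where "D = {x. b \<le> \<bar>\<phi> x\<bar>}"
  define k where "k x y = c * \<rho> (x - y) powr (1 - N)" for x y
  have N: "2 \<le> N" using dim unfolding N_def by simp
  have r: "0 < r" "r \<le> 1" and q: "1 < q" "q = 1 + r" "q * (1 - N) = - N" "q / N = r" "(1 - N) * r = -1"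
    unfolding r_def q_def using N by (auto simp: field_simps)
  have c: "0 < c" "c * (N * \<kappa>) = 1" unfolding c_def using N kappa_pos by auto
  have [measurable]: "A \<in> sets borel" "D \<in> sets borel" unfolding A_def D_def by measurable
  have [measurable]: "(\<lambda>x. k x y) \<in> borel_measurable borel" "(\<lambda>y. k x y) \<in> borel_measurable borel"
    "(\<lambda>(x, y). k x y) \<in> borel_measurable (borel \<Otimes>\<^sub>M borel)" for x y
    unfolding k_def by measurable
  have k0: "0 \<le> k x y" for x y unfolding k_def using c by simp
  have mD: "emeasure lborel D = ennreal m" using m(1) unfolding D_def .
  have AV: "emeasure lborel A \<le> ennreal V"
    by (rule order_trans[OF emeasure_mono V]) (auto simp: A_def)
  have "ennreal m \<le> ennreal V"
    unfolding mD[symmetric] by (rule order_trans[OF emeasure_mono V]) (use ab in \<open>auto simp: D_def\<close>)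
  then have mV: "m \<le> V" "0 < V" using m(2) by (auto simp: ennreal_le_iff2)

  \<comment> \<open>\<open>R\<close> and \<open>R0\<close> are the radii of the Wulff balls of
    measure m and V, so that N ln (R0 / R) = ln (V / m).\<close>
  define R where "R = (m / \<kappa>) powr (1 / N)"
  define R0 where "R0 = (V / \<kappa>) powr (1 / N)"
  have R: "0 < R" "R powr N = m / \<kappa>" "R \<le> R0" "0 < R0" "R0 powr N = V / \<kappa>"
    unfolding R_def R0_def using m(2) mV N kappa_pos
    by (auto simp: powr_powr intro!: powr_mono2 divide_right_mono)
  have lnR: "N * ln (R0 / R) = ln (V / m)"
    unfolding R_def R0_def using m(2) mV N kappa_pos
    by (simp add: ln_div ln_powr algebra_simps)

  \<comment> \<open>A uniform bound for the mean kernel. In \<open>nn_integral_polar_powr_le\<close>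
    with this R, the ball contributes N and the rest of D contributes 1.\<close>
  define h where "h = (N + 1) * c * R powr (1 - N)"
  have h0: "0 < h" unfolding h_def using N c R by auto
  define I where "I y = (\<integral>\<^sup>+x. ennreal (k x y) * indicator D x \<partial>lborel)" for y
  have [measurable]: "I \<in> borel_measurable borel" unfolding I_def by measurable
  have I_le: "I y \<le> ennreal (m * h)" for y
  proof -
    have "I y = (\<integral>\<^sup>+x. ennreal c * (ennreal (\<rho> (y - x) powr (- (N - 1))) * indicator D x) \<partial>lborel)"
      unfolding I_def k_def using c
      by (intro nn_integral_cong) (simp add: ennreal_mult mult.assoc polar_minus_commute)
    also have "\<dots> = ennreal c * (\<integral>\<^sup>+x. ennreal (\<rho> (y - x) powr (- (N - 1))) * indicator D x \<partial>lborel)"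
      by (rule nn_integral_cmult) measurable
    also have "\<dots> \<le> ennreal c * ennreal (N * \<kappa> / (N - (N - 1)) * R powr (N - (N - 1)) + R powr (- (N - 1)) * m)"
      unfolding N_def using dim R m mD
      by (intro mult_left_mono nn_integral_polar_powr_le) auto
    also have "\<dots> = ennreal (c * (N * \<kappa> * R + R powr (1 - N) * m))"
      using c N kappa_pos R m(2) by (simp add: ennreal_mult)
    also have "c * (N * \<kappa> * R + R powr (1 - N) * m) = m * h"
    proof -
      have "R powr N * R powr (1 - N) = R" using R(1) by (simp add: powr_add[symmetric])
      then have "\<kappa> * R = \<kappa> * (m / \<kappa> * R powr (1 - N))" unfolding R(2) by simp
      also have "\<dots> = m * R powr (1 - N)" using kappa_pos by simp
      finally have "\<kappa> * R = m * R powr (1 - N)" .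
      then show ?thesis unfolding h_def by (simp add: algebra_simps)
    qed
    finally show ?thesis .
  qed
  define H where "H y = enn2real (I y) / m" for y
  have [measurable]: "H \<in> borel_measurable borel" unfolding H_def by measurable
  have I_eq: "I y = ennreal (m * H y)" for y
  proof -
    have "I y < top" using I_le[of y] by (rule le_less_trans) simp
    then show ?thesis unfolding H_def using m(2) by simp
  qed
  have H: "0 \<le> H y" "H y \<le> h" for y
  proof -
    show "0 \<le> H y" unfolding H_def using m(2) by simp
    have "ennreal (m * H y) \<le> ennreal (m * h)" using I_le[of y] I_eq[of y] by simp
    then show "H y \<le> h" using m(2) h0 by (simp add: ennreal_le_iff)
  qed

  \<comment> \<open>An integrable substitute for k^q. Away from the pole it is k^q itself, which
    keeps the logarithmic coefficient exact. Near the pole it is q h^r k, which still dominates the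
    term q H^r k of the tangent inequality because H \<le> h.\<close>
  define \<Psi> where "\<Psi> x y = (if \<rho> (x - y) < R then q * h powr r * k x y else k x y powr q)" for x y
  have [measurable]: "(\<lambda>x. \<Psi> x y) \<in> borel_measurable borel" "(\<lambda>y. \<Psi> x y) \<in> borel_measurable borel"
    "(\<lambda>(x, y). \<Psi> x y) \<in> borel_measurable (borel \<Otimes>\<^sub>M borel)" for x y
    unfolding \<Psi>_def k_def by measurable
  have Psi_nonneg: "0 \<le> \<Psi> x y" for x y unfolding \<Psi>_def using k0 q by auto
  have tangent: "q * H y powr r * k x y \<le> \<Psi> x y + r * H y powr q" for x y
  proof (cases "\<rho> (x - y) < R")
    case True
    have "q * H y powr r * k x y \<le> q * h powr r * k x y"
      using H r q k0 by (intro mult_right_mono mult_left_mono powr_mono2) auto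
    moreover have "0 \<le> r * H y powr q" using r by simp
    ultimately show ?thesis using True unfolding \<Psi>_def by simp
  next
    case False
    then show ?thesis using powr_tangent_le[OF H(1) k0 q(1), of y x y] q(2) unfolding \<Psi>_def by simp
  qed
  \<comment> \<open>Since the mean of k over D is H, averaging the tangent inequality turns its left
    side into q m H^q. Cancelling the finite term r m H^q leaves m H^q, because q = 1 + r.\<close>
  have Hq_le: "ennreal (m * H y powr q) \<le> (\<integral>\<^sup>+x. ennreal (\<Psi> x y) * indicator D x \<partial>lborel)" for y
  proof -
    have "ennreal (q * m * H y powr q) = ennreal (q * H y powr r) * I y"
    proof -
      have "H y powr r * H y = H y powr q" using H(1)[of y] unfolding q(2)
        by (cases "H y = 0") (simp_all add: powr_add)
      then have "q * H y powr r * (m * H y) = q * m * H y powr q" by (simp add: algebra_simps)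
      then show ?thesis unfolding I_eq using q H m(2) by (simp add: ennreal_mult[symmetric])
    qed
    also have "\<dots> = (\<integral>\<^sup>+x. ennreal (q * H y powr r) * (ennreal (k x y) * indicator D x) \<partial>lborel)"
      unfolding I_def by (rule nn_integral_cmult[symmetric]) measurable
    also have "\<dots> \<le> (\<integral>\<^sup>+x. ennreal (\<Psi> x y) * indicator D x + ennreal (r * H y powr q) * indicator D x \<partial>lborel)"
      using tangent r q k0 Psi_nonneg
      by (intro nn_integral_mono)
         (auto simp: indicator_def ennreal_mult[symmetric] ennreal_plus[symmetric] ennreal_leI simp del: ennreal_plus)
    also have "\<dots> = (\<integral>\<^sup>+x. ennreal (\<Psi> x y) * indicator D x \<partial>lborel) + ennreal (r * H y powr q) * ennreal m"
      by (subst nn_integral_add) (auto simp: nn_integral_cmult_indicator mD)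
    also have "\<dots> = (\<integral>\<^sup>+x. ennreal (\<Psi> x y) * indicator D x \<partial>lborel) + ennreal (r * m * H y powr q)"
      using r m(2) by (simp add: ennreal_mult[symmetric] mult_ac)
    finally have *: "ennreal (q * m * H y powr q)
        \<le> (\<integral>\<^sup>+x. ennreal (\<Psi> x y) * indicator D x \<partial>lborel) + ennreal (r * m * H y powr q)" .
    have "q * m * H y powr q = m * H y powr q + r * m * H y powr q" unfolding q(2) by (simp add: algebra_simps)
    then have "ennreal (m * H y powr q) + ennreal (r * m * H y powr q)
        \<le> (\<integral>\<^sup>+x. ennreal (\<Psi> x y) * indicator D x \<partial>lborel) + ennreal (r * m * H y powr q)"
      using * r m(2) by (simp add: ennreal_plus[symmetric] del: ennreal_plus)
    then show ?thesis by (simp add: add.commute[of _ "ennreal (r * m * H y powr q)"] ennreal_add_left_cancel_le)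
  qed

  define B where "B = c powr q * \<kappa> * (ln (V / m) + level_const (real CARD('n)))"
  \<comment> \<open>In units of c^q \<kappa>, the ball of radius R contributes q N (N+1)^r, the
    annulus contributes ln (V / m), and the part of A beyond R0, where the kernel is smallest and
    the measure at most V, contributes 1.\<close>
  have Psi_int: "(\<integral>\<^sup>+y. ennreal (\<Psi> x y) * indicator A y \<partial>lborel) \<le> ennreal B" for x
  proof -
    have kq: "k x y powr q = c powr q * \<rho> (x - y) powr (- N)" for y
      unfolding k_def using c q by (simp add: powr_mult powr_powr mult.commute)
    have "(\<integral>\<^sup>+y. ennreal (\<Psi> x y) * indicator A y \<partial>lborel) \<le>
      (\<integral>\<^sup>+y. (ennreal (q * h powr r * c) * (ennreal (\<rho> (x - y) powr (- (N - 1))) * indicator {x. \<rho> x \<le> R} (x - y))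
        + ennreal (c powr q) * (ennreal (\<rho> (x - y) powr (- N)) * indicator {x. R \<le> \<rho> x \<and> \<rho> x \<le> R0} (x - y)))
        + ennreal (c powr q * R0 powr (- N)) * indicator A y \<partial>lborel)"
    proof (rule nn_integral_mono)
      fix y
      have far: "\<rho> (x - y) powr (- N) \<le> R0 powr (- N)" if "R0 < \<rho> (x - y)"
        using that N R by (intro powr_mono2') auto
      consider "\<rho> (x - y) < R" | "R \<le> \<rho> (x - y)" "\<rho> (x - y) \<le> R0" | "R \<le> \<rho> (x - y)" "R0 < \<rho> (x - y)"
        by linarith
      then show "ennreal (\<Psi> x y) * indicator A y \<le>
        (ennreal (q * h powr r * c) * (ennreal (\<rho> (x - y) powr (- (N - 1))) * indicator {x. \<rho> x \<le> R} (x - y))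
        + ennreal (c powr q) * (ennreal (\<rho> (x - y) powr (- N)) * indicator {x. R \<le> \<rho> x \<and> \<rho> x \<le> R0} (x - y)))
        + ennreal (c powr q * R0 powr (- N)) * indicator A y"
      proof cases
        case 1
        then have "ennreal (\<Psi> x y) = ennreal (q * h powr r * c) * ennreal (\<rho> (x - y) powr (- (N - 1)))"
          unfolding \<Psi>_def k_def using c q by (simp add: ennreal_mult[symmetric] mult.assoc)
        then show ?thesis using 1 by (auto simp: indicator_def add_increasing2 intro!: add_increasing2)
      next
        case 2
        then have "ennreal (\<Psi> x y) = ennreal (c powr q) * ennreal (\<rho> (x - y) powr (- N))"
          unfolding \<Psi>_def kq using c by (simp add: ennreal_mult[symmetric])
        then show ?thesis using 2 by (auto simp: indicator_def intro!: add_increasing2 add_increasing)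
      next
        case 3
        then have "ennreal (\<Psi> x y) \<le> ennreal (c powr q * R0 powr (- N))"
          unfolding \<Psi>_def kq using c far by (auto intro!: ennreal_leI mult_left_mono)
        then show ?thesis using 3 by (auto simp: indicator_def intro!: add_increasing)
      qed
    qed
    also have "\<dots> = (ennreal (q * h powr r * c) * (\<integral>\<^sup>+y. ennreal (\<rho> (x - y) powr (- (N - 1))) * indicator {x. \<rho> x \<le> R} (x - y) \<partial>lborel)
        + ennreal (c powr q) * (\<integral>\<^sup>+y. ennreal (\<rho> (x - y) powr (- N)) * indicator {x. R \<le> \<rho> x \<and> \<rho> x \<le> R0} (x - y) \<partial>lborel))
        + ennreal (c powr q * R0 powr (- N)) * emeasure lborel A"
      by (subst nn_integral_add, measurable, subst nn_integral_add, measurable)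
         (simp add: nn_integral_cmult nn_integral_cmult_indicator)
    also have "(\<integral>\<^sup>+y. ennreal (\<rho> (x - y) powr (- (N - 1))) * indicator {x. \<rho> x \<le> R} (x - y) \<partial>lborel)
        = ennreal (N * \<kappa> / (N - (N - 1)) * R powr (N - (N - 1)))"
      by (subst nn_integral_lborel_minus[where f = "\<lambda>x. ennreal (\<rho> x powr (- (N - 1))) * indicator {x. \<rho> x \<le> R} x"], measurable)
         (unfold N_def, rule nn_integral_polar_powr_ball, use R in auto)
    also have "(\<integral>\<^sup>+y. ennreal (\<rho> (x - y) powr (- N)) * indicator {x. R \<le> \<rho> x \<and> \<rho> x \<le> R0} (x - y) \<partial>lborel)
        = ennreal (N * \<kappa> * ln (R0 / R))"
      by (subst nn_integral_lborel_minus[where f = "\<lambda>z. ennreal (\<rho> z powr (- N)) * indicator {x. R \<le> \<rho> x \<and> \<rho> x \<le> R0} z"], measurable)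
         (unfold N_def, rule nn_integral_polar_annulus[OF R(1,3)])
    also have "(ennreal (q * h powr r * c) * ennreal (N * \<kappa> / (N - (N - 1)) * R powr (N - (N - 1)))
        + ennreal (c powr q) * ennreal (N * \<kappa> * ln (R0 / R)))
        + ennreal (c powr q * R0 powr (- N)) * emeasure lborel A
      \<le> (ennreal (q * h powr r * c) * ennreal (N * \<kappa> / (N - (N - 1)) * R powr (N - (N - 1)))
        + ennreal (c powr q) * ennreal (N * \<kappa> * ln (R0 / R)))
        + ennreal (c powr q * R0 powr (- N)) * ennreal V"
      by (intro add_left_mono mult_left_mono AV) auto
    also have "\<dots> = ennreal (q * h powr r * c * (N * \<kappa> * R) + c powr q * (\<kappa> * ln (V / m)) + c powr q * R0 powr (- N) * V)"
    proof -
      have ln0: "0 \<le> ln (V / m)" using m(2) mV by simp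
      have lnN: "N * \<kappa> * ln (R0 / R) = \<kappa> * ln (V / m)" using lnR by (simp add: mult_ac)
      show ?thesis unfolding lnN using c(1) q(1) N kappa_pos R(1,4) mV ln0
        by (simp add: ennreal_mult[symmetric] ennreal_plus[symmetric] del: ennreal_plus)
    qed
    also have "q * h powr r * c * (N * \<kappa> * R) + c powr q * (\<kappa> * ln (V / m)) + c powr q * R0 powr (- N) * V = B"
    proof -
      have "h powr r * R = ((N + 1) * c) powr r * (R powr ((1 - N) * r) * R)"
        unfolding h_def using N c R by (simp add: powr_mult powr_powr)
      also have "R powr ((1 - N) * r) * R = 1" unfolding q(5) using R by (simp add: powr_minus)
      finally have hR: "h powr r * R = ((N + 1) * c) powr r" by simp
      have "q * h powr r * c * (N * \<kappa> * R) = q * (h powr r * R) * (c * (N * \<kappa>))" by (simp add: mult_ac)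
      also have "\<dots> = q * (N + 1) powr r * c powr r"
        unfolding hR c(2) using N c by (simp add: powr_mult)
      also have "c powr r = c powr q * \<kappa> * N"
        unfolding q(2) powr_add using c by (simp add: mult_ac)
      finally have 1: "q * h powr r * c * (N * \<kappa> * R) = c powr q * \<kappa> * (q * N * (N + 1) powr r)"
        by (simp add: mult_ac)
      have "R0 powr (- N) * V = \<kappa>" using R mV kappa_pos by (simp add: powr_minus field_simps)
      then have 2: "c powr q * R0 powr (- N) * V = c powr q * \<kappa>" by (simp add: mult_ac)
      show ?thesis unfolding 1 2 B_def level_const_def N_def[symmetric] q_def[symmetric] r_def[symmetric]
        by (simp add: algebra_simps)
    qed
    finally show ?thesis .
  qed
  have B0: "0 \<le> B"
    unfolding B_def level_const_def N_def[symmetric] using kappa_pos N m(2) mV by (simp add: add_nonneg_nonneg)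
  have Hq_int: "(\<integral>\<^sup>+y. ennreal ((H y * indicator A y) powr q) \<partial>lborel) \<le> ennreal B"
  proof -
    have "ennreal m * (\<integral>\<^sup>+y. ennreal ((H y * indicator A y) powr q) \<partial>lborel)
        = (\<integral>\<^sup>+y. ennreal (m * H y powr q) * indicator A y \<partial>lborel)"
      using m(2) q by (subst nn_integral_cmult[symmetric]) (auto intro!: nn_integral_cong simp: indicator_def ennreal_mult)
    also have "\<dots> \<le> (\<integral>\<^sup>+y. (\<integral>\<^sup>+x. ennreal (\<Psi> x y) * indicator D x \<partial>lborel) * indicator A y \<partial>lborel)"
      by (intro nn_integral_mono mult_right_mono Hq_le) auto
    also have "\<dots> = (\<integral>\<^sup>+y. (\<integral>\<^sup>+x. ennreal (\<Psi> x y) * indicator D x * indicator A y \<partial>lborel) \<partial>lborel)"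
      by (subst nn_integral_multc) auto
    also have "\<dots> = (\<integral>\<^sup>+x. (\<integral>\<^sup>+y. ennreal (\<Psi> x y) * indicator D x * indicator A y \<partial>lborel) \<partial>lborel)"
      by (rule lborel_pair.Fubini') measurable
    also have "\<dots> \<le> (\<integral>\<^sup>+x. ennreal B * indicator D x \<partial>lborel)"
    proof (rule nn_integral_mono)
      fix x
      have "(\<integral>\<^sup>+y. ennreal (\<Psi> x y) * indicator D x * indicator A y \<partial>lborel)
        = indicator D x * (\<integral>\<^sup>+y. ennreal (\<Psi> x y) * indicator A y \<partial>lborel)"
        by (subst nn_integral_cmult[symmetric]) (auto intro!: nn_integral_cong simp: mult_ac)
      also have "\<dots> \<le> indicator D x * ennreal B" by (intro mult_left_mono Psi_int) auto
      finally show "(\<integral>\<^sup>+y. ennreal (\<Psi> x y) * indicator D x * indicator A y \<partial>lborel) \<le> ennreal B * indicator D x"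
        by (simp add: mult.commute)
    qed
    also have "\<dots> = ennreal m * ennreal B"
      by (subst nn_integral_cmult_indicator) (auto simp: mD mult.commute)
    finally show ?thesis using m(2) by (subst (asm) ennreal_mult_le_mult_iff) auto
  qed

  have "ennreal m * (ennreal (N * \<kappa>) * ennreal (b - a))
      = (\<integral>\<^sup>+x. ennreal (N * \<kappa>) * ennreal (b - a) * indicator D x \<partial>lborel)"
    by (subst nn_integral_cmult_indicator) (auto simp: mD mult.commute)
  also have "\<dots> \<le> (\<integral>\<^sup>+x. (\<integral>\<^sup>+y. ennreal (F (G y)) * indicator A y * ennreal (\<rho> (x - y) powr (1 - N)) \<partial>lborel)
      * indicator D x \<partial>lborel)"
    using ray_estimate[OF ab] unfolding A_def D_def N_def
    by (intro nn_integral_mono) (auto simp: indicator_def)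
  also have "\<dots> = (\<integral>\<^sup>+x. (\<integral>\<^sup>+y. ennreal (F (G y)) * indicator A y * ennreal (\<rho> (x - y) powr (1 - N))
      * indicator D x \<partial>lborel) \<partial>lborel)"
    by (subst nn_integral_multc) auto
  also have "\<dots> = (\<integral>\<^sup>+y. (\<integral>\<^sup>+x. ennreal (F (G y)) * indicator A y * ennreal (\<rho> (x - y) powr (1 - N))
      * indicator D x \<partial>lborel) \<partial>lborel)"
    by (rule lborel_pair.Fubini'[symmetric]) measurable
  also have "\<dots> = (\<integral>\<^sup>+y. ennreal (F (G y)) * indicator A y * (ennreal (N * \<kappa>) * I y) \<partial>lborel)"
  proof (rule nn_integral_cong)
    fix y
    have "(\<integral>\<^sup>+x. ennreal (F (G y)) * indicator A y * ennreal (\<rho> (x - y) powr (1 - N)) * indicator D x \<partial>lborel)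
      = ennreal (F (G y)) * indicator A y * (\<integral>\<^sup>+x. ennreal (\<rho> (x - y) powr (1 - N)) * indicator D x \<partial>lborel)"
      by (subst nn_integral_cmult[symmetric]) (auto simp: mult.assoc)
    also have "(\<integral>\<^sup>+x. ennreal (\<rho> (x - y) powr (1 - N)) * indicator D x \<partial>lborel) = ennreal (N * \<kappa>) * I y"
      unfolding I_def k_def
    proof (subst nn_integral_cmult[symmetric])
      show "(\<integral>\<^sup>+x. ennreal (\<rho> (x - y) powr (1 - N)) * indicator D x \<partial>lborel)
        = (\<integral>\<^sup>+x. ennreal (N * \<kappa>) * (ennreal (c * \<rho> (x - y) powr (1 - N)) * indicator D x) \<partial>lborel)"
      proof (rule nn_integral_cong)
        fix x
        have "N * \<kappa> * (c * \<rho> (x - y) powr (1 - N)) = \<rho> (x - y) powr (1 - N)" using c(2)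
          by (metis mult.assoc mult.commute mult_1)
        moreover have "ennreal (N * \<kappa>) * (ennreal (c * \<rho> (x - y) powr (1 - N)) * indicator D x)
          = ennreal (N * \<kappa> * (c * \<rho> (x - y) powr (1 - N))) * indicator D x"
          using N kappa_pos c(1) by (subst ennreal_mult) (simp_all add: mult.assoc)
        ultimately show "ennreal (\<rho> (x - y) powr (1 - N)) * indicator D x
          = ennreal (N * \<kappa>) * (ennreal (c * \<rho> (x - y) powr (1 - N)) * indicator D x)"
          by (simp only:)
      qed
    qed measurable
    finally show "(\<integral>\<^sup>+x. ennreal (F (G y)) * indicator A y * ennreal (\<rho> (x - y) powr (1 - N)) * indicator D x \<partial>lborel)
      = ennreal (F (G y)) * indicator A y * (ennreal (N * \<kappa>) * I y)" .
  qed
  also have "\<dots> = (\<integral>\<^sup>+y. ennreal (m * (N * \<kappa>)) * ennreal (F (G y) * indicator A y * (H y * indicator A y)) \<partial>lborel)"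
  proof (rule nn_integral_cong)
    fix y
    show "ennreal (F (G y)) * indicator A y * (ennreal (N * \<kappa>) * I y)
      = ennreal (m * (N * \<kappa>)) * ennreal (F (G y) * indicator A y * (H y * indicator A y))"
      unfolding I_eq using F_nonneg[of "G y"] H(1)[of y] m(2) N kappa_pos
      by (auto simp: indicator_def ennreal_mult[symmetric] mult_ac)
  qed
  also have "\<dots> = ennreal (m * (N * \<kappa>)) * (\<integral>\<^sup>+y. ennreal (F (G y) * indicator A y * (H y * indicator A y)) \<partial>lborel)"
    by (rule nn_integral_cmult) measurable
  also have "\<dots> \<le> ennreal (m * (N * \<kappa>)) * ennreal (e powr (1 / N) * B powr (1 / q))"
  proof (intro mult_left_mono nn_integral_Holder)
    show "(\<integral>\<^sup>+x. ennreal ((F (G x) * indicator A x) powr N) \<partial>lborel) \<le> ennreal e"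
    proof -
      have "(\<integral>\<^sup>+x. ennreal ((F (G x) * indicator A x) powr N) \<partial>lborel) = level_energy a b"
        unfolding level_energy_def A_def[symmetric] using N F_nonneg
        by (intro nn_integral_cong) (auto simp: indicator_def N_def powr_realpow_of_nonneg)
      then show ?thesis using e by simp
    qed
    show "1 / N + 1 / q = 1" unfolding q_def using N by (simp add: field_simps)
  qed (use H F_nonneg e B0 N q Hq_int in \<open>auto simp: indicator_def\<close>)
  finally have "ennreal (m * (N * \<kappa>) * (b - a)) \<le> ennreal (m * (N * \<kappa>) * (e powr (1 / N) * B powr (1 / q)))"
    using m(2) N kappa_pos ab by (simp add: ennreal_mult mult.assoc)
  then have "m * (N * \<kappa>) * (b - a) \<le> m * (N * \<kappa>) * (e powr (1 / N) * B powr (1 / q))"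
    using m(2) N kappa_pos by (subst (asm) ennreal_le_iff) auto
  then have "b - a \<le> e powr (1 / N) * B powr (1 / q)"
    using m(2) N kappa_pos by (subst (asm) mult_le_cancel_left_pos) auto
  then have "(b - a) powr q \<le> (e powr (1 / N) * B powr (1 / q)) powr q"
    using ab q by (intro powr_mono2) auto
  also have "\<dots> = e powr r * B"
    using e B0 q by (simp add: powr_mult powr_powr)
  finally have "lambda_N F * (b - a) powr q \<le> lambda_N F * (e powr r * B)"
    by (intro mult_left_mono) (simp_all add: lambda_N_def Let_def)
  also have "\<dots> = (lambda_N F * (c powr q * \<kappa>)) * (e powr r * (ln (V / m) + level_const (real CARD('n))))"
    unfolding B_def by (simp add: mult_ac)
  \<comment> \<open>The origin of the sharp constant: \<open>lambda_N F\<close> = N^q \<kappa>^r is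
    the reciprocal of c^q \<kappa>, where c = 1 / (N \<kappa>) comes from the ray average and
    \<kappa> from the logarithmic integral.\<close>
  also have "lambda_N F * (c powr q * \<kappa>) = 1"
  proof -
    have "lambda_N F = N powr q * \<kappa> powr r"
      unfolding lambda_N_def Let_def N_def q_def r_def \<kappa>_def by simp
    moreover have "c powr q * \<kappa> = N powr (- q) * \<kappa> powr (1 - q)"
      unfolding c_def using N kappa_pos by (simp add: powr_divide powr_mult powr_minus powr_diff field_simps)
    moreover have "\<kappa> powr r * \<kappa> powr (1 - q) = 1"
      unfolding powr_add[symmetric] q(2) using kappa_pos by simp
    moreover have "N powr q * N powr (- q) = 1" using N by (simp add: powr_add[symmetric])
    ultimately show ?thesis by (metis (no_types, opaque_lifting) mult.assoc mult.left_commute mult_1)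
  qed
  finally show ?thesis unfolding N_def q_def r_def by simp
qed

end

section \<open>The exponential sum over levels\<close>

context finsler_norm
begin

definition C_wt :: "real \<Rightarrow> real" where
  "C_wt \<beta> = (real CARD('n) * \<kappa> / (real CARD('n) - \<beta>) + \<kappa>) * \<kappa> powr (\<beta> / real CARD('n) - 1)"

definition exp_integral :: "(real^'n) set \<Rightarrow> real \<Rightarrow> real \<Rightarrow> (real^'n \<Rightarrow> real) \<Rightarrow> ennreal" where
  "exp_integral \<Omega> \<Lambda> \<beta> v = (\<integral>\<^sup>+x. ennreal (exp (\<Lambda> * \<bar>v x\<bar> powr (real CARD('n) / (real CARD('n) - 1)))
     * \<rho> x powr (- \<beta>)) * indicator \<Omega> x \<partial>lborel)"

lemma C_wt_nonneg: "\<beta> < real CARD('n) \<Longrightarrow> 0 \<le> C_wt \<beta>"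
  unfolding C_wt_def using kappa_pos by simp

text \<open>Cut D at the Wulff ball of measure m; both pieces then scale like m^(1 - \<beta>/N). The
  singular weight thus acts on level sets only by raising their measure to the power 1 - \<beta>/N,
  which is the factor appearing in the exponent.\<close>

lemma nn_integral_weight_le:
  assumes \<beta>: "0 \<le> \<beta>" "\<beta> < real CARD('n)"
    and [measurable]: "D \<in> sets borel" and m: "emeasure lborel D \<le> ennreal m" "0 < m"
  shows "(\<integral>\<^sup>+x. ennreal (\<rho> x powr (- \<beta>)) * indicator D x \<partial>lborel)
    \<le> ennreal (C_wt \<beta> * m powr (1 - \<beta> / real CARD('n)))"
proof -
  define N where "N = real CARD('n)"
  define R where "R = (m / \<kappa>) powr (1 / N)"
  have N: "0 < N" unfolding N_def by simp
  have R: "0 < R" "R powr N = m / \<kappa>" unfolding R_def using m kappa_pos N by (auto simp: powr_powr)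
  have "(\<integral>\<^sup>+x. ennreal (\<rho> x powr (- \<beta>)) * indicator D x \<partial>lborel)
      = (\<integral>\<^sup>+x. ennreal (\<rho> (0 - x) powr (- \<beta>)) * indicator D x \<partial>lborel)"
    by simp
  also have "\<dots> \<le> ennreal (N * \<kappa> / (N - \<beta>) * R powr (N - \<beta>) + R powr (- \<beta>) * m)"
    unfolding N_def by (rule nn_integral_polar_powr_le) (use \<beta> m R in auto)
  also have "N * \<kappa> / (N - \<beta>) * R powr (N - \<beta>) + R powr (- \<beta>) * m = (N * \<kappa> / (N - \<beta>) + \<kappa>) * R powr (N - \<beta>)"
  proof -
    have "\<kappa> * R powr (N - \<beta>) = \<kappa> * (R powr N * R powr (- \<beta>))" by (simp add: powr_add[symmetric])
    also have "\<dots> = R powr (- \<beta>) * m" unfolding R(2) using kappa_pos by simp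
    finally show ?thesis by (simp add: algebra_simps)
  qed
  also have "R powr (N - \<beta>) = \<kappa> powr (\<beta> / N - 1) * m powr (1 - \<beta> / N)"
  proof -
    have "R powr (N - \<beta>) = (m / \<kappa>) powr (1 - \<beta> / N)"
      unfolding R_def powr_powr using N by (simp add: field_simps)
    also have "\<dots> = \<kappa> powr (- (1 - \<beta> / N)) * m powr (1 - \<beta> / N)"
      using m kappa_pos by (simp only: powr_divide powr_minus) (simp add: field_simps)
    finally show ?thesis by simp
  qed
  finally show ?thesis unfolding C_wt_def N_def by (simp add: mult.assoc)
qed

end

context compactly_supported_C1
begin

lemma lambda_pos: "0 < lambda_N F"
  unfolding lambda_N_def Let_def using kappa_pos dim by (simp add: \<kappa>_def)

lemma level_const_ge_1: "1 \<le> level_const (real CARD('n))"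
  unfolding level_const_def using dim by simp

lemma phi_bounded: obtains B where "\<And>x. \<bar>\<phi> x\<bar> \<le> B"
proof -
  obtain B where B: "\<And>x. \<phi> x \<noteq> 0 \<Longrightarrow> norm x \<le> B"
    using supp by (auto simp: bounded_iff)
  have "compact (\<phi> ` cball 0 B)" by (intro compact_continuous_image phi_continuous compact_cball)
  then obtain C where C: "\<And>y. y \<in> \<phi> ` cball 0 B \<Longrightarrow> \<bar>y\<bar> \<le> C"
    by (meson bounded_real compact_imp_bounded)
  show ?thesis
  proof (rule that[of "\<bar>C\<bar>"])
    fix x show "\<bar>\<phi> x\<bar> \<le> \<bar>C\<bar>"
      using B[of x] C[of "\<phi> x"] by (cases "\<phi> x = 0") force+
  qed
qed

lemma emeasure_phi_ne_0: "emeasure lborel {x. \<phi> x \<noteq> 0} < \<infinity>"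
  using emeasure_bounded_finite[OF supp] .

text \<open>The energy budget behind the Adams-Garsia condition. The two open strips are disjoint;
  no relation between b and c is imposed, since for c \<le> b the second strip is empty.\<close>

lemma level_energy_add:
  assumes "a < b"
  shows "level_energy a b + level_energy b c \<le>
    (\<integral>\<^sup>+x. ennreal (F (G x) ^ CARD('n)) * indicator {x. a < \<bar>\<phi> x\<bar>} x \<partial>lborel)"
  unfolding level_energy_def
  by (subst nn_integral_add[symmetric]) (use assms in \<open>auto intro!: nn_integral_mono simp: indicator_def\<close>)

text \<open>The levels \<open>lev n\<close> are chosen so that the normalised exponent of the truncation \<open>max 0 (\<bar>\<phi>\<bar> - M)\<close>
  equals \<open>n\<close> there.\<close>

lemma truncated_exponential_sum:
  assumes M: "0 \<le> M" and \<sigma>: "0 < \<sigma>" and V: "0 < V" "emeasure lborel {x. M < \<bar>\<phi> x\<bar>} \<le> ennreal V"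
    and e: "(\<integral>\<^sup>+x. ennreal (F (G x) ^ CARD('n)) * indicator {x. M < \<bar>\<phi> x\<bar>} x \<partial>lborel) \<le> ennreal \<sigma>"
    and S: "\<And>I (t::nat \<Rightarrow> real). adams_garsia_levels (real CARD('n)) (level_const (real CARD('n))) I t \<Longrightarrow>
      (\<Sum>n\<in>I. exp (\<alpha> * (n - t n))) \<le> S"
    and \<beta>: "0 \<le> \<beta>" "\<beta> < real CARD('n)" and \<alpha>: "\<alpha> = 1 - \<beta> / real CARD('n)"
    and [measurable]: "\<Omega> \<in> sets borel" and \<Omega>: "emeasure lborel \<Omega> \<le> ennreal V"
  shows "(\<integral>\<^sup>+x. ennreal (exp (\<alpha> * (lambda_N F * (max 0 (\<bar>\<phi> x\<bar> - M)) powr (real CARD('n) / (real CARD('n) - 1))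
       * \<sigma> powr (- (1 / (real CARD('n) - 1))))) * \<rho> x powr (- \<beta>)) * indicator \<Omega> x \<partial>lborel)
     \<le> ennreal (exp \<alpha> * (C_wt \<beta> * V powr \<alpha>) * (1 + S))"
proof -
  define N where "N = real CARD('n)"
  define r where "r = 1 / (N - 1)"
  define q where "q = N / (N - 1)"
  define \<Lambda> where "\<Lambda> = lambda_N F"
  have N: "2 \<le> N" using dim unfolding N_def by simp
  have r: "0 < r" and q: "1 < q" and iq: "(N - 1) / N = 1 / q" "1 / q > 0"
    unfolding r_def q_def using N by (auto simp: field_simps)
  have \<alpha>0: "0 < \<alpha>" unfolding \<alpha> using \<beta> by simp
  have \<Lambda>: "0 < \<Lambda>" unfolding \<Lambda>_def by (rule lambda_pos)
  define w where "w x = \<Lambda> * (max 0 (\<bar>\<phi> x\<bar> - M)) powr q * \<sigma> powr (- r)" for x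
  define z where "z = (\<sigma> powr r / \<Lambda>) powr (1 / q)"
  define lev where "lev n = M + z * real n powr (1 / q)" for n :: nat
  have z: "0 < z" "\<Lambda> * z powr q = \<sigma> powr r" unfolding z_def using \<sigma> \<Lambda> q by (auto simp: powr_powr)
  have lev_mono: "lev n < lev k" if "n < k" for n k
    unfolding lev_def using that z iq by (auto intro!: powr_less_mono2)
  have lev_ge: "M \<le> lev n" for n unfolding lev_def using z by simp
  have lev_gt: "M < lev n" if "1 \<le> n" for n unfolding lev_def using z that by simp
  define L where "L n = {x. lev n \<le> \<bar>\<phi> x\<bar>}" for n
  have [measurable]: "L n \<in> sets borel" for n unfolding L_def by measurable
  define m where "m n = measure lborel (L n)" for n
  have L_le: "emeasure lborel (L n) \<le> ennreal V" if "1 \<le> n" for n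
    by (rule order_trans[OF emeasure_mono V(2)]) (use lev_gt[OF that] in \<open>auto simp: L_def\<close>)
  have m: "emeasure lborel (L n) = ennreal (m n)" "m n \<le> V" if "1 \<le> n" for n
  proof -
    have "emeasure lborel (L n) < \<infinity>" using L_le[OF that] by (rule le_less_trans) simp
    then show "emeasure lborel (L n) = ennreal (m n)" unfolding m_def
      by (simp add: emeasure_eq_ennreal_measure)
    then show "m n \<le> V" using L_le[OF that] V(1) by (simp add: ennreal_le_iff)
  qed
  \<comment> \<open>Positive measure is what makes the logarithm in \<open>t\<close> meaningful. The
    set is finite because \<phi> is bounded, but its size depends on \<phi>, so only the uniform
    bound S may enter the result.\<close>
  define I where "I = {n. 1 \<le> n \<and> 0 < m n}"
  define t where "t n = ln (V / m n)" for n
  have fin: "finite I"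
  proof -
    obtain B where B: "\<And>x. \<bar>\<phi> x\<bar> \<le> B" using phi_bounded by metis
    have "n \<le> nat \<lceil>((B - M) / z) powr q\<rceil>" if "n \<in> I" for n
    proof -
      have "L n \<noteq> {}" using that unfolding I_def m_def by auto
      then have "M + z * real n powr (1 / q) \<le> B" using B unfolding L_def lev_def by (auto intro: order_trans)
      then have le: "real n powr (1 / q) \<le> (B - M) / z" using z by (simp add: field_simps)
      have "real n = (real n powr (1 / q)) powr q" using q by (simp add: powr_powr)
      also have "\<dots> \<le> ((B - M) / z) powr q" using le q by (intro powr_mono2) auto
      finally show ?thesis by linarith
    qed
    then show ?thesis using finite_subset[of I "{..nat \<lceil>((B - M) / z) powr q\<rceil>}"] by auto
  qed
  define E where "E a b = enn2real (level_energy a b)" for a b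
  have E: "level_energy a b = ennreal (E a b)" "0 \<le> E a b" if "M \<le> a" for a b
  proof -
    have "level_energy a b \<le> (\<integral>\<^sup>+x. ennreal (F (G x) ^ CARD('n)) * indicator {x. M < \<bar>\<phi> x\<bar>} x \<partial>lborel)"
      unfolding level_energy_def using that by (intro nn_integral_mono) (auto simp: indicator_def)
    then have "level_energy a b < top" using e by (rule le_less_trans[OF order_trans]) simp
    then show "level_energy a b = ennreal (E a b)" "0 \<le> E a b" unfolding E_def by auto
  qed
  have E_sum: "E M b + E b c \<le> \<sigma>" if "M < b" for b c
  proof -
    have "ennreal (E M b + E b c) = level_energy M b + level_energy b c"
      using E[of M b] E[of b c] that by simp
    also have "\<dots> \<le> ennreal \<sigma>" by (rule order_trans[OF level_energy_add[OF that] e])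
    finally show ?thesis using \<sigma> by (simp add: ennreal_le_iff)
  qed
  have outer: "real n \<le> (E M (lev n) / \<sigma>) powr r * (t n + level_const (real CARD('n)))" if "n \<in> I" for n
  proof -
    have n: "1 \<le> n" "0 < m n" using that unfolding I_def by auto
    have "\<Lambda> * (lev n - M) powr q \<le> E M (lev n) powr r * (ln (V / m n) + level_const (real CARD('n)))"
      unfolding \<Lambda>_def q_def r_def N_def
      by (rule level_estimate[OF M lev_gt[OF n(1)] V(2) _ n(2)])
        (use m(1)[OF n(1)] E[of M "lev n"] in \<open>auto simp: L_def\<close>)
    moreover have "\<Lambda> * (lev n - M) powr q = \<sigma> powr r * real n"
      unfolding lev_def z(2)[symmetric] using z(1) q by (simp add: powr_mult powr_powr)
    ultimately show ?thesis using \<sigma> E(2)[of M "lev n"] unfolding t_def by (simp add: powr_divide field_simps)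
  qed
  \<comment> \<open>For the strip starting at level n the measure of that level set takes the place
    of V, so the logarithm becomes t k - t n.\<close>
  have inner: "(real k powr (1 / q) - real n powr (1 / q)) powr q
      \<le> (E (lev n) (lev k) / \<sigma>) powr r * (t k - t n + level_const (real CARD('n)))" if "n \<in> I" "k \<in> I" "n < k" for n k
  proof -
    have nk: "1 \<le> n" "0 < m n" "1 \<le> k" "0 < m k" using that unfolding I_def by auto
    have "emeasure lborel {x. lev n < \<bar>\<phi> x\<bar>} \<le> emeasure lborel (L n)"
      by (rule emeasure_mono) (auto simp: L_def)
    then have "\<Lambda> * (lev k - lev n) powr q \<le> E (lev n) (lev k) powr r * (ln (m n / m k) + level_const (real CARD('n)))"
      unfolding \<Lambda>_def q_def r_def N_def
      by (intro level_estimate[OF order_trans[OF M lev_ge] lev_mono[OF that(3)] _ _ nk(4)])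
        (use m(1)[OF nk(1)] m(1)[OF nk(3)] E[of "lev n" "lev k"] lev_ge[of n] in \<open>auto simp: L_def\<close>)
    moreover have "\<Lambda> * (lev k - lev n) powr q = \<sigma> powr r * (real k powr (1 / q) - real n powr (1 / q)) powr q"
    proof -
      have "lev k - lev n = z * (real k powr (1 / q) - real n powr (1 / q))"
        unfolding lev_def by (simp add: algebra_simps)
      then show ?thesis unfolding z(2)[symmetric] using z(1) that(3) iq
        by (simp add: powr_mult powr_mono2)
    qed
    moreover have "ln (m n / m k) = t k - t n" unfolding t_def using nk V(1) by (simp add: ln_div)
    ultimately show ?thesis using \<sigma> E(2)[of "lev n" "lev k"] lev_ge[of n]
      by (simp add: powr_divide field_simps)
  qed
  have t_nonneg: "0 \<le> t n" if "n \<in> I" for n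
    using that m(2)[of n] unfolding t_def I_def by simp
  have "(\<Sum>n\<in>I. exp (\<alpha> * (n - t n))) \<le> S"
  proof (rule S, unfold adams_garsia_levels_def, intro conjI ballI impI fin)
    fix n assume n: "n \<in> I"
    have "E M (lev n) \<le> \<sigma>"
      using E_sum[of "lev n" "lev n"] E(2)[of "lev n" "lev n"] lev_ge lev_gt[of n] n unfolding I_def by auto
    then have "(E M (lev n) / \<sigma>) powr r \<le> 1"
      using \<sigma> E(2)[of M "lev n"] r powr_mono2[of r "E M (lev n) / \<sigma>" 1] by simp
    then have "(E M (lev n) / \<sigma>) powr r * (t n + level_const (real CARD('n))) \<le> 1 * (t n + level_const (real CARD('n)))"
      using t_nonneg[OF n] level_const_ge_1 by (intro mult_right_mono) auto
    then show "real n \<le> t n + level_const (real CARD('n))" using order_trans[OF outer[OF n]] by simp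
  next
    fix n k assume nk: "n \<in> I" "k \<in> I" "n < k"
    then have Mn: "M < lev n" "M \<le> lev n" using lev_gt lev_ge unfolding I_def by auto
    \<comment> \<open>The share of the budget spent between the two levels. By \<open>E_sum\<close>
      at most the share 1 - b remains for the strip from M to level n, which is the coupling
      required by \<open>adams_garsia_levels\<close>.\<close>
    define b where "b = E (lev n) (lev k) / \<sigma>"
    have b: "0 \<le> b" "b \<le> 1" "E M (lev n) / \<sigma> \<le> 1 - b"
      using E_sum[OF Mn(1), of "lev k"] E(2)[of M "lev n"] E(2)[OF Mn(2), of "lev k"] \<sigma>
      unfolding b_def by (auto simp: field_simps)
    have "real n \<le> (1 - b) powr r * (t n + level_const (real CARD('n)))"
    proof (rule order_trans[OF outer[OF nk(1)]])
      show "(E M (lev n) / \<sigma>) powr r * (t n + level_const (real CARD('n))) \<le> (1 - b) powr r * (t n + level_const (real CARD('n)))"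
        using b r E(2)[of M "lev n"] \<sigma> t_nonneg[OF nk(1)] level_const_ge_1
        by (intro mult_right_mono powr_mono2) auto
    qed
    then show "\<exists>b. 0 \<le> b \<and> b \<le> 1 \<and>
       real n \<le> (1 - b) powr (1 / (real CARD('n) - 1)) * (t n + level_const (real CARD('n))) \<and>
       (real k powr ((real CARD('n) - 1) / real CARD('n)) - real n powr ((real CARD('n) - 1) / real CARD('n)))
          powr (real CARD('n) / (real CARD('n) - 1))
          \<le> b powr (1 / (real CARD('n) - 1)) * (t k - t n + level_const (real CARD('n)))"
      using b(1,2) inner[OF nk] unfolding b_def[symmetric] N_def[symmetric] r_def[symmetric] q_def[symmetric] iq
      by blast
  qed
  then have sum_le: "(\<Sum>n\<in>I. exp (\<alpha> * n) * m n powr \<alpha>) \<le> V powr \<alpha> * S"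
  proof -
    have "exp (\<alpha> * n) * m n powr \<alpha> = V powr \<alpha> * exp (\<alpha> * (n - t n))" if "n \<in> I" for n
    proof -
      have "0 < m n" using that unfolding I_def by auto
      then show ?thesis unfolding t_def using V(1)
        by (simp add: powr_def ln_div exp_add[symmetric] algebra_simps)
    qed
    then have "(\<Sum>n\<in>I. exp (\<alpha> * n) * m n powr \<alpha>) = V powr \<alpha> * (\<Sum>n\<in>I. exp (\<alpha> * (n - t n)))"
      by (simp add: sum_distrib_left)
    also have "\<dots> \<le> V powr \<alpha> * S" by (intro mult_left_mono) (fact, simp)
    finally show ?thesis .
  qed
  have in_L: "x \<in> L n" if "n = nat \<lfloor>w x\<rfloor>" "1 \<le> n" for n x
  proof -
    have "real n \<le> w x" using that by linarith
    then have "\<sigma> powr r * real n \<le> \<Lambda> * (max 0 (\<bar>\<phi> x\<bar> - M)) powr q"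
      unfolding w_def using \<sigma> by (simp add: powr_minus field_simps)
    then have "\<Lambda> * z powr q * real n \<le> \<Lambda> * (max 0 (\<bar>\<phi> x\<bar> - M)) powr q" unfolding z(2) .
    then have "z powr q * real n \<le> (max 0 (\<bar>\<phi> x\<bar> - M)) powr q" using \<Lambda> by (simp add: mult.assoc)
    then have "(z powr q * real n) powr (1 / q) \<le> ((max 0 (\<bar>\<phi> x\<bar> - M)) powr q) powr (1 / q)"
      using q by (intro powr_mono2) auto
    then have "z * real n powr (1 / q) \<le> max 0 (\<bar>\<phi> x\<bar> - M)"
      using q z(1) by (simp add: powr_mult powr_powr)
    moreover have "0 < z * real n powr (1 / q)" using z(1) that(2) by (intro mult_pos_pos) auto
    ultimately show ?thesis unfolding L_def lev_def by auto
  qed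
  \<comment> \<open>With n the integer part of w x, the point lies in L n and the exponential is at
    most e^\<alpha> e^(\<alpha> n). The points with n = 0 are covered by the integral of the weight
    over the whole domain, and level sets with index n \<ge> 1 outside I are null.\<close>
  have "(\<integral>\<^sup>+x. ennreal (exp (\<alpha> * w x) * \<rho> x powr (- \<beta>)) * indicator \<Omega> x \<partial>lborel)
    \<le> (\<integral>\<^sup>+x. ennreal (exp \<alpha>) * (ennreal (\<rho> x powr (- \<beta>)) * indicator \<Omega> x)
        + (\<Sum>n\<in>I. ennreal (exp \<alpha> * exp (\<alpha> * n)) * (ennreal (\<rho> x powr (- \<beta>)) * indicator (L n) x)) \<partial>lborel)"
  proof (rule nn_integral_mono_AE)
    have "AE x in lborel. \<forall>n. 1 \<le> n \<and> n \<notin> I \<longrightarrow> x \<notin> L n"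
      unfolding AE_all_countable
    proof
      fix n
      show "AE x in lborel. 1 \<le> n \<and> n \<notin> I \<longrightarrow> x \<notin> L n"
      proof (cases "1 \<le> n \<and> n \<notin> I")
        case True
        then have "emeasure lborel (L n) = 0"
          using m(1)[of n] unfolding I_def by (auto simp: ennreal_eq_0_iff not_less)
        then show ?thesis by (intro AE_I[where N = "L n"]) auto
      qed auto
    qed
    then show "AE x in lborel. ennreal (exp (\<alpha> * w x) * \<rho> x powr (- \<beta>)) * indicator \<Omega> x
      \<le> ennreal (exp \<alpha>) * (ennreal (\<rho> x powr (- \<beta>)) * indicator \<Omega> x)
        + (\<Sum>n\<in>I. ennreal (exp \<alpha> * exp (\<alpha> * n)) * (ennreal (\<rho> x powr (- \<beta>)) * indicator (L n) x))"
    proof eventually_elim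
      case (elim x)
      have w0: "0 \<le> w x" unfolding w_def using \<Lambda> by simp
      define n where "n = nat \<lfloor>w x\<rfloor>"
      have wn: "w x \<le> 1 + real n" unfolding n_def using w0 by linarith
      have exp_le: "exp (\<alpha> * w x) \<le> exp \<alpha> * exp (\<alpha> * n)"
        using mult_left_mono[OF wn, of \<alpha>] \<alpha>0 by (simp add: mult_exp_exp algebra_simps)
      show ?case
      proof (cases "n = 0")
        case True
        then have "ennreal (exp (\<alpha> * w x) * \<rho> x powr (- \<beta>)) \<le> ennreal (exp \<alpha>) * ennreal (\<rho> x powr (- \<beta>))"
          using exp_le by (simp add: ennreal_mult[symmetric] ennreal_leI mult_right_mono)
        then show ?thesis by (auto simp: indicator_def intro!: add_increasing2)
      next
        case False
        have xL: "x \<in> L n" using False in_L[OF n_def] by linarith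
        have "1 \<le> n" using False by simp
        then have nI: "n \<in> I" using elim xL by blast
        have "ennreal (exp (\<alpha> * w x) * \<rho> x powr (- \<beta>)) * indicator \<Omega> x
            \<le> ennreal (exp \<alpha> * exp (\<alpha> * n)) * (ennreal (\<rho> x powr (- \<beta>)) * indicator (L n) x)"
          using exp_le xL by (auto simp: indicator_def ennreal_mult[symmetric] ennreal_leI mult_right_mono)
        also have "\<dots> \<le> (\<Sum>n\<in>I. ennreal (exp \<alpha> * exp (\<alpha> * n)) * (ennreal (\<rho> x powr (- \<beta>)) * indicator (L n) x))"
          using member_le_sum[OF nI _ fin, of "\<lambda>n. ennreal (exp \<alpha> * exp (\<alpha> * n)) * (ennreal (\<rho> x powr (- \<beta>)) * indicator (L n) x)"]
          by simp
        finally show ?thesis by (rule order_trans) (simp add: add_increasing)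
      qed
    qed
  qed
  also have "\<dots> = ennreal (exp \<alpha>) * (\<integral>\<^sup>+x. ennreal (\<rho> x powr (- \<beta>)) * indicator \<Omega> x \<partial>lborel)
        + (\<Sum>n\<in>I. ennreal (exp \<alpha> * exp (\<alpha> * n)) * (\<integral>\<^sup>+x. ennreal (\<rho> x powr (- \<beta>)) * indicator (L n) x \<partial>lborel))"
    by (subst nn_integral_add) (simp_all add: nn_integral_sum nn_integral_cmult)
  also have "\<dots> \<le> ennreal (exp \<alpha>) * ennreal (C_wt \<beta> * V powr \<alpha>)
        + (\<Sum>n\<in>I. ennreal (exp \<alpha> * exp (\<alpha> * n)) * ennreal (C_wt \<beta> * m n powr \<alpha>))"
    unfolding \<alpha> using \<Omega> V(1) m(1)
    by (intro add_mono mult_left_mono sum_mono nn_integral_weight_le \<beta>) (auto simp: I_def)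
  also have "\<dots> = ennreal (exp \<alpha> * (C_wt \<beta> * V powr \<alpha>) + (\<Sum>n\<in>I. exp \<alpha> * exp (\<alpha> * n) * (C_wt \<beta> * m n powr \<alpha>)))"
    using C_wt_nonneg[OF \<beta>(2)]
    by (simp add: ennreal_mult[symmetric] sum_ennreal ennreal_plus[symmetric] sum_nonneg del: ennreal_plus)
  also have "\<dots> \<le> ennreal (exp \<alpha> * (C_wt \<beta> * V powr \<alpha>) * (1 + S))"
  proof (rule ennreal_leI)
    have "(\<Sum>n\<in>I. exp \<alpha> * exp (\<alpha> * n) * (C_wt \<beta> * m n powr \<alpha>))
        = exp \<alpha> * C_wt \<beta> * (\<Sum>n\<in>I. exp (\<alpha> * n) * m n powr \<alpha>)"
      by (simp add: sum_distrib_left mult_ac)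
    also have "\<dots> \<le> exp \<alpha> * C_wt \<beta> * (V powr \<alpha> * S)"
      using C_wt_nonneg[OF \<beta>(2)] by (intro mult_left_mono sum_le) auto
    finally show "exp \<alpha> * (C_wt \<beta> * V powr \<alpha>) + (\<Sum>n\<in>I. exp \<alpha> * exp (\<alpha> * n) * (C_wt \<beta> * m n powr \<alpha>))
      \<le> exp \<alpha> * (C_wt \<beta> * V powr \<alpha>) * (1 + S)"
      by (simp add: algebra_simps)
  qed
  finally show ?thesis unfolding w_def \<Lambda>_def q_def r_def N_def .
qed

end

section \<open>The energy gain below a level\<close>

context compactly_supported_C1
begin

definition low_energy :: "real \<Rightarrow> ennreal" where
  "low_energy M = (\<integral>\<^sup>+x. ennreal (F (G x) ^ CARD('n)) * indicator {x. \<bar>\<phi> x\<bar> \<le> M} x \<partial>lborel)"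

definition high_energy :: "real \<Rightarrow> ennreal" where
  "high_energy M = (\<integral>\<^sup>+x. ennreal (F (G x) ^ CARD('n)) * indicator {x. M < \<bar>\<phi> x\<bar>} x \<partial>lborel)"

lemma low_high_energy: "low_energy M + high_energy M = (\<integral>\<^sup>+x. ennreal (F (G x) ^ CARD('n)) \<partial>lborel)"
  unfolding low_energy_def high_energy_def
  by (subst nn_integral_add[symmetric]) (auto intro!: nn_integral_cong simp: indicator_def)

lemma level_energy_le_low: "level_energy a b \<le> low_energy b"
  unfolding level_energy_def low_energy_def by (intro nn_integral_mono) (auto simp: indicator_def)

lemma emeasure_level_finite:
  assumes "0 < M" shows "emeasure lborel {x. M \<le> \<bar>\<phi> x\<bar>} < \<infinity>"
  by (rule le_less_trans[OF emeasure_mono emeasure_phi_ne_0]) (use assms in auto)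

text \<open>The eigenvalue inequality for the truncation of \<phi> at height M, keeping in the L^p
  norm only the part strictly below M. Isolating it as a property of \<phi> separates the level set
  argument from the space \<open>W0\<close>; \<open>truncation_energy\<close> establishes it with c
  = \<gamma>1.\<close>

definition truncation_bound :: "real \<Rightarrow> real \<Rightarrow> bool" where
  "truncation_bound c p \<longleftrightarrow> (\<forall>M>0. \<forall>Q\<ge>0.
     (\<integral>\<^sup>+x. ennreal (\<bar>\<phi> x\<bar> powr p) * indicator {x. \<bar>\<phi> x\<bar> < M} x \<partial>lborel) = ennreal Q \<longrightarrow>
     ennreal (c * Q powr (real CARD('n) / p)) \<le> low_energy M)"

definition tail :: "real \<Rightarrow> real \<Rightarrow> ennreal" where
  "tail p M = (\<integral>\<^sup>+x. ennreal (\<bar>\<phi> x\<bar> powr p) * indicator {x. M \<le> \<bar>\<phi> x\<bar>} x \<partial>lborel)"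

lemma tail_finite:
  assumes "0 < p" shows "tail p M < \<infinity>"
proof -
  obtain B where B: "\<And>x. \<bar>\<phi> x\<bar> \<le> B" using phi_bounded by metis
  have "tail p M \<le> (\<integral>\<^sup>+x. ennreal (B powr p) * indicator {x. \<phi> x \<noteq> 0} x \<partial>lborel)"
    unfolding tail_def using B assms
    by (intro nn_integral_mono) (auto simp: indicator_def intro!: ennreal_leI powr_mono2)
  also have "\<dots> = ennreal (B powr p) * emeasure lborel {x. \<phi> x \<noteq> 0}"
    by (rule nn_integral_cmult_indicator) measurable
  also have "\<dots> < \<infinity>" using emeasure_phi_ne_0 by (simp add: ennreal_mult_less_top)
  finally show ?thesis .
qed

lemma tail_step:
  assumes "0 < p" "0 < M"
  shows "tail p M \<le> ennreal ((2 * M) powr p) * emeasure lborel {x. M \<le> \<bar>\<phi> x\<bar>} + tail p (2 * M)"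
proof -
  have "tail p M \<le> (\<integral>\<^sup>+x. ennreal ((2 * M) powr p) * indicator {x. M \<le> \<bar>\<phi> x\<bar>} x
      + ennreal (\<bar>\<phi> x\<bar> powr p) * indicator {x. 2 * M \<le> \<bar>\<phi> x\<bar>} x \<partial>lborel)"
    unfolding tail_def using assms
    by (intro nn_integral_mono) (auto simp: indicator_def intro!: ennreal_leI powr_mono2)
  also have "\<dots> = ennreal ((2 * M) powr p) * emeasure lborel {x. M \<le> \<bar>\<phi> x\<bar>} + tail p (2 * M)"
    unfolding tail_def by (subst nn_integral_add) (auto simp: nn_integral_cmult_indicator)
  finally show ?thesis .
qed

text \<open>The level estimate for the strip from M to 2 M is scale invariant: if the energy is of
  order M^N, both sides carry M^(N/(N-1)). The equation for \<open>lambda_N F\<close> fixes c so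
  that, after cancelling, V / m \<ge> 1 / \<eta> remains.\<close>

lemma emeasure_doubling:
  assumes M: "0 < M" and c: "0 < c" "lambda_N F = (2 ^ (CARD('n) + 1) * c) powr (1 / (real CARD('n) - 1))
      * (level_const (real CARD('n)) + ln (1 / \<eta>))" and \<eta>: "0 < \<eta>"
    and e: "low_energy (2 * M) \<le> ennreal (2 * c * (2 * M) ^ CARD('n))"
  shows "emeasure lborel {x. 2 * M \<le> \<bar>\<phi> x\<bar>} \<le> ennreal \<eta> * emeasure lborel {x. M \<le> \<bar>\<phi> x\<bar>}"
proof -
  define N where "N = real CARD('n)"
  define r where "r = 1 / (N - 1)"
  have N: "2 \<le> N" using dim unfolding N_def by simp
  have r: "0 < r" "N * r = N / (N - 1)" unfolding r_def using N by auto
  define V where "V = measure lborel {x. M \<le> \<bar>\<phi> x\<bar>}"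
  define m where "m = measure lborel {x. 2 * M \<le> \<bar>\<phi> x\<bar>}"
  have V: "emeasure lborel {x. M \<le> \<bar>\<phi> x\<bar>} = ennreal V"
    using emeasure_level_finite[OF M] unfolding V_def by (simp add: emeasure_eq_ennreal_measure)
  have m: "emeasure lborel {x. 2 * M \<le> \<bar>\<phi> x\<bar>} = ennreal m"
    using emeasure_level_finite[of "2 * M"] M unfolding m_def by (simp add: emeasure_eq_ennreal_measure)
  show ?thesis
  proof (cases "0 < m")
    case True
    have mV: "m \<le> V"
    proof -
      have "emeasure lborel {x. 2 * M \<le> \<bar>\<phi> x\<bar>} \<le> emeasure lborel {x. M \<le> \<bar>\<phi> x\<bar>}"
        using M by (intro emeasure_mono) auto
      then show ?thesis unfolding V m using True by (simp add: ennreal_le_iff2)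
    qed
    have "emeasure lborel {x. M < \<bar>\<phi> x\<bar>} \<le> ennreal V"
      unfolding V[symmetric] by (intro emeasure_mono) auto
    then have "lambda_N F * (2 * M - M) powr (N / (N - 1))
        \<le> (2 * c * (2 * M) ^ CARD('n)) powr r * (ln (V / m) + level_const N)"
      unfolding N_def r_def
      by (intro level_estimate[OF _ _ _ m True order_trans[OF level_energy_le_low e]]) (use M c in auto)
    also have "(2 * c * (2 * M) ^ CARD('n)) powr r = (2 ^ (CARD('n) + 1) * c) powr r * M powr (N / (N - 1))"
    proof -
      have "2 * c * (2 * M) ^ CARD('n) = (2 ^ (CARD('n) + 1) * c) * M powr N"
        using M unfolding N_def by (simp add: powr_realpow power_mult_distrib)
      then show ?thesis using M c(1) r by (simp add: powr_mult powr_powr)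
    qed
    finally have "(2 ^ (CARD('n) + 1) * c) powr r * M powr (N / (N - 1)) * (level_const N + ln (1 / \<eta>))
      \<le> (2 ^ (CARD('n) + 1) * c) powr r * M powr (N / (N - 1)) * (ln (V / m) + level_const N)"
      unfolding c(2) N_def r_def by (simp add: mult_ac)
    moreover have "0 < (2 ^ (CARD('n) + 1) * c) powr r * M powr (N / (N - 1))" using M c(1) by simp
    ultimately have "level_const N + ln (1 / \<eta>) \<le> ln (V / m) + level_const N"
      by (rule mult_left_le_imp_le)
    then have "1 / \<eta> \<le> V / m" using True mV \<eta> by simp
    then have "m \<le> \<eta> * V" using \<eta> True by (simp add: field_simps)
    then show ?thesis unfolding V m using \<eta> mV True by (simp add: ennreal_mult[symmetric] ennreal_leI)
  next
    case False
    then show ?thesis unfolding m by (simp add: ennreal_neg)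
  qed
qed

end

text \<open>Either the energy below some dyadic level \<open>M\<close> exceeds a multiple of \<open>M ^ N\<close>, or the level sets shrink
  so fast that most of the \<open>L\<^sup>p\<close> norm is carried by \<open>min \<bar>\<phi>\<bar> M\<close> and the gap \<open>\<gamma> < \<gamma>1\<close> provides the gain.\<close>

lemma (in finsler_norm) exists_level_energy_gain:
  fixes \<gamma> \<gamma>1 p :: real
  assumes dim2: "2 \<le> CARD('n)" and \<gamma>: "0 \<le> \<gamma>" "\<gamma> < \<gamma>1" and p: "1 < p"
  shows "\<exists>c>0. \<forall>\<phi> G P. compactly_supported_C1 F \<phi> G \<longrightarrow> 0 < P \<longrightarrow>
     (\<integral>\<^sup>+x. ennreal (\<bar>\<phi> x\<bar> powr p) \<partial>lborel) = ennreal P \<longrightarrow>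
     compactly_supported_C1.truncation_bound F \<phi> G \<gamma>1 p \<longrightarrow>
     (\<exists>M>0. ennreal (c * M ^ CARD('n) + \<gamma> * P powr (real CARD('n) / p))
        \<le> compactly_supported_C1.low_energy F \<phi> G M)"
proof -
  define N where "N = real CARD('n)"
  have N: "2 \<le> N" using dim2 unfolding N_def by simp
  \<comment> \<open>Chosen so that M^p times the measure of the level set at M is at least halved
    when M doubles.\<close>
  define \<eta> :: real where "\<eta> = 2 powr (- (p + 1))"
  have \<eta>: "0 < \<eta>" "\<eta> < 1" "2 powr p * \<eta> = 1 / 2"
    unfolding \<eta>_def using p by (auto simp: powr_add[symmetric] powr_minus powr_less_one)
  define K where "K = level_const N + ln (1 / \<eta>)"
  have "0 < level_const N" unfolding level_const_def using N by (intro add_pos_nonneg) auto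
  then have K: "0 < K" unfolding K_def using \<eta> by (intro add_pos_nonneg) auto
  have lam: "0 < lambda_N F" unfolding lambda_N_def Let_def using kappa_pos dim2 by (simp add: \<kappa>_def)
  \<comment> \<open>The solution of the equation that \<open>emeasure_doubling\<close> imposes on
    c.\<close>
  define c where "c = (lambda_N F / K) powr (N - 1) / 2 ^ (CARD('n) + 1)"
  have c: "0 < c" "lambda_N F = (2 ^ (CARD('n) + 1) * c) powr (1 / (N - 1)) * K"
    unfolding c_def using lam K N by (auto simp: powr_powr)
  \<comment> \<open>The dyadic levels start at A \<delta>, where \<delta> is the L^p norm. From
    there on \<gamma> \<delta>^N \<le> c M^N, so a level without the desired gain has low energy at
    most 2 c M^N, as \<open>emeasure_doubling\<close> requires.\<close>
  define A where "A = max 1 ((\<gamma> / c) powr (1 / N))"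
  have A: "1 \<le> A" "\<gamma> \<le> c * A powr N"
  proof -
    have "\<gamma> / c = ((\<gamma> / c) powr (1 / N)) powr N" using \<gamma> c N by (simp add: powr_powr)
    also have "\<dots> \<le> A powr N" unfolding A_def using N by (intro powr_mono2) auto
    finally show "\<gamma> \<le> c * A powr N" using c by (simp add: field_simps)
  qed (simp add: A_def)
  \<comment> \<open>If the part below M keeps the fraction \<theta> of the L^p norm, the coefficient
    \<gamma>1 drops only to the midpoint of \<gamma> and \<gamma>1.\<close>
  define \<theta> where "\<theta> = ((\<gamma> + \<gamma>1) / (2 * \<gamma>1)) powr (1 / N)"
  have \<theta>: "0 < \<theta>" "\<theta> < 1" "\<gamma>1 * \<theta> powr N = (\<gamma> + \<gamma>1) / 2"
  proof -
    have *: "0 < (\<gamma> + \<gamma>1) / (2 * \<gamma>1)" "(\<gamma> + \<gamma>1) / (2 * \<gamma>1) < 1" using \<gamma> by (auto simp: field_simps)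
    show "0 < \<theta>" unfolding \<theta>_def powr_gt_zero using *(1) by linarith
    show "\<theta> < 1" using powr_less_mono2[of "1 / N" "(\<gamma> + \<gamma>1) / (2 * \<gamma>1)" 1] * N unfolding \<theta>_def by simp
    show "\<gamma>1 * \<theta> powr N = (\<gamma> + \<gamma>1) / 2"
      unfolding \<theta>_def powr_powr using * N \<gamma> by (simp add: field_simps)
  qed
  have "\<theta> powr p < 1" using powr_less_mono2[of p \<theta> 1] \<theta> p by simp
  \<comment> \<open>After k doublings the tail carries at most the share 1 - \<theta>^p of P, so the
    part below carries at least \<theta>^p P. The number k does not depend on \<phi>.\<close>
  obtain k :: nat where k: "2 powr (p + 1) / 2 ^ k \<le> 1 - \<theta> powr p"
  proof -
    obtain k :: nat where "2 powr (p + 1) / (1 - \<theta> powr p) < 2 ^ k"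
      using real_arch_pow[of 2 "2 powr (p + 1) / (1 - \<theta> powr p)"] by auto
    then show ?thesis using that[of k] \<open>\<theta> powr p < 1\<close> by (simp add: field_simps)
  qed
  \<comment> \<open>The first entry serves a level with direct gain. The second serves the level 2^k
    A \<delta>, where the other half of the gap, (\<gamma>1 - \<gamma>) / 2 times \<delta>^N, has to
    cover c' M^N.\<close>
  define c' where "c' = min c ((\<gamma>1 - \<gamma>) / 2 / (2 ^ k * A) powr N)"
  have c': "0 < c'" "c' \<le> c" "c' \<le> (\<gamma>1 - \<gamma>) / 2 / (2 ^ k * A) powr N" unfolding c'_def using c \<gamma> A by auto
  show ?thesis
  proof (rule exI[of _ c'], intro conjI allI impI)
    show "0 < c'" by fact
    fix \<phi> G P
    assume C1: "compactly_supported_C1 F \<phi> G" and P: "0 < P"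
      "(\<integral>\<^sup>+x. ennreal (\<bar>\<phi> x\<bar> powr p) \<partial>lborel) = ennreal P"
      and trunc: "compactly_supported_C1.truncation_bound F \<phi> G \<gamma>1 p"
    interpret compactly_supported_C1 F \<phi> G by fact
    define \<delta> where "\<delta> = P powr (1 / p)"
    have \<delta>: "0 < \<delta>" "\<delta> powr p = P" "\<delta> powr N = P powr (N / p)"
      unfolding \<delta>_def using P(1) p by (auto simp: powr_powr)
    define M where "M j = 2 ^ j * (A * \<delta>)" for j :: nat
    have M: "0 < M j" "M (Suc j) = 2 * M j" "A * \<delta> \<le> M j" for j
      unfolding M_def using A \<delta> mult_right_mono[of 1 "2 ^ j" "A * \<delta>"] by auto
    have MN: "M j ^ CARD('n) = M j powr N" for j unfolding N_def using M(1)[of j] by (simp add: powr_realpow)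
    have g_le: "\<gamma> * \<delta> powr N \<le> c * M j ^ CARD('n)" for j
    proof -
      have "\<gamma> * \<delta> powr N \<le> c * A powr N * \<delta> powr N" using A by (intro mult_right_mono) auto
      also have "\<dots> = c * (A * \<delta>) powr N" using A \<delta> by (simp add: powr_mult)
      also have "\<dots> \<le> c * M j powr N" using c M(3)[of j] A \<delta> N by (intro mult_left_mono powr_mono2) auto
      finally show ?thesis unfolding MN .
    qed
    show "\<exists>M>0. ennreal (c' * M ^ CARD('n) + \<gamma> * P powr (real CARD('n) / p)) \<le> low_energy M"
    proof (cases "\<exists>j. ennreal (c * M j ^ CARD('n) + \<gamma> * \<delta> powr N) \<le> low_energy (M j)")
      case True
      then obtain j where j: "ennreal (c * M j ^ CARD('n) + \<gamma> * \<delta> powr N) \<le> low_energy (M j)" by blast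
      have "ennreal (c' * M j ^ CARD('n) + \<gamma> * P powr (N / p)) \<le> ennreal (c * M j ^ CARD('n) + \<gamma> * \<delta> powr N)"
        unfolding \<delta>(3) using c' M(1)[of j] by (intro ennreal_leI add_right_mono mult_right_mono) auto
      then show ?thesis using j M(1)[of j] unfolding N_def by (meson order_trans)
    next
      case False
      have low: "low_energy (M j) \<le> ennreal (2 * c * M j ^ CARD('n))" for j
      proof -
        have "low_energy (M j) \<le> ennreal (c * M j ^ CARD('n) + \<gamma> * \<delta> powr N)"
          using False by (meson linear)
        also have "\<dots> \<le> ennreal (2 * c * M j ^ CARD('n))" using g_le[of j] by (intro ennreal_leI) auto
        finally show ?thesis .
      qed
      define m where "m j = measure lborel {x. M j \<le> \<bar>\<phi> x\<bar>}" for j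
      have m: "emeasure lborel {x. M j \<le> \<bar>\<phi> x\<bar>} = ennreal (m j)" "0 \<le> m j" for j
        using emeasure_level_finite[OF M(1), of j] unfolding m_def by (auto simp: emeasure_eq_ennreal_measure)
      have m_Suc: "m (Suc j) \<le> \<eta> * m j" for j
      proof -
        have "ennreal (m (Suc j)) \<le> ennreal \<eta> * ennreal (m j)"
          unfolding m(1)[symmetric] M(2)
          by (rule emeasure_doubling[OF M(1) c(1)])
            (use low[of "Suc j"] c(2) \<eta> in \<open>auto simp: M(2) K_def N_def\<close>)
        then show ?thesis using \<eta> m(2) by (simp add: ennreal_mult[symmetric] ennreal_le_iff)
      qed
      have m_le: "m j \<le> \<eta> ^ j * m 0" for j
      proof (induction j)
        case (Suc j)
        then have "\<eta> * m j \<le> \<eta> * (\<eta> ^ j * m 0)" using \<eta> by (intro mult_left_mono) auto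
        then show ?case using m_Suc[of j] by (simp add: mult.assoc)
      qed simp
      have m0: "(A * \<delta>) powr p * m 0 \<le> P"
      proof -
        have "ennreal ((A * \<delta>) powr p * m 0) = ennreal ((A * \<delta>) powr p) * emeasure lborel {x. M 0 \<le> \<bar>\<phi> x\<bar>}"
          unfolding m using m by (simp add: ennreal_mult)
        also have "\<dots> = (\<integral>\<^sup>+x. ennreal ((A * \<delta>) powr p) * indicator {x. M 0 \<le> \<bar>\<phi> x\<bar>} x \<partial>lborel)"
          by (rule nn_integral_cmult_indicator[symmetric]) measurable
        also have "\<dots> \<le> (\<integral>\<^sup>+x. ennreal (\<bar>\<phi> x\<bar> powr p) \<partial>lborel)"
          using A \<delta> p by (intro nn_integral_mono) (auto simp: indicator_def M_def intro!: ennreal_leI powr_mono2)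
        finally show ?thesis unfolding P(2) using P(1) by (simp add: ennreal_le_iff)
      qed
      have Mm: "(2 * M j) powr p * m j \<le> 2 powr p / 2 ^ j * P" for j
      proof -
        have "(2 * M j) powr p = 2 powr p * (2 ^ j) powr p * (A * \<delta>) powr p"
          unfolding M_def using A \<delta> by (simp add: powr_mult)
        also have "(2 ^ j) powr p = (2 powr p) ^ j"
          by (simp add: powr_realpow[symmetric] powr_powr mult.commute)
        finally have "(2 * M j) powr p * m j \<le> 2 powr p * (2 powr p) ^ j * (A * \<delta>) powr p * (\<eta> ^ j * m 0)"
          using m_le[of j] by (simp add: mult_left_mono)
        also have "\<dots> = 2 powr p * (2 powr p * \<eta>) ^ j * ((A * \<delta>) powr p * m 0)"
          by (simp add: power_mult_distrib mult_ac)
        also have "\<dots> \<le> 2 powr p * (2 powr p * \<eta>) ^ j * P"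
          using \<eta> by (intro mult_left_mono m0) auto
        finally show ?thesis unfolding \<eta>(3) by (simp add: power_one_over)
      qed
      obtain B where B: "\<And>x. \<bar>\<phi> x\<bar> \<le> B" using phi_bounded by metis
      obtain n :: nat where n: "B / (A * \<delta>) < 2 ^ n" "k \<le> n"
      proof -
        obtain n0 :: nat where "B / (A * \<delta>) < 2 ^ n0" using real_arch_pow[of 2 "B / (A * \<delta>)"] by auto
        moreover have "(2::real) ^ n0 \<le> 2 ^ (n0 + k)" by (intro power_increasing) auto
        ultimately have "B / (A * \<delta>) < 2 ^ (n0 + k)" by linarith
        then show ?thesis using that[of "n0 + k"] by simp
      qed
      \<comment> \<open>Downward induction from a level n above the maximum of |\<phi>|, where the
        tail vanishes. The geometric bound reproduces itself, 2^p / 2^j + 2^(p+1) / 2^(j+1) =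
        2^(p+1) / 2^j, so n leaves no trace.\<close>
      have tail_le: "tail p (M k) \<le> ennreal (2 powr (p + 1) / 2 ^ k * P)"
        using n(2)
      proof (induction rule: inc_induct)
        case base
        have "B < M n" using n(1) A \<delta> unfolding M_def by (simp add: field_simps)
        then have "tail p (M n) = 0" unfolding tail_def using B
          by (auto simp: nn_integral_0_iff_AE indicator_def intro!: AE_I2 dest: order.strict_trans2)
        then show ?case by simp
      next
        case (step j)
        have "tail p (M j) \<le> ennreal ((2 * M j) powr p) * ennreal (m j) + tail p (M (Suc j))"
          unfolding m(1)[symmetric] M(2) using p M(1) by (intro tail_step) auto
        also have "\<dots> \<le> ennreal (2 powr p / 2 ^ j * P) + ennreal (2 powr (p + 1) / 2 ^ Suc j * P)"
          using Mm[of j] m(2)[of j] by (intro add_mono step) (simp add: ennreal_mult[symmetric] ennreal_leI)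
        also have "\<dots> = ennreal (2 powr (p + 1) / 2 ^ j * P)"
          using P(1) by (simp add: ennreal_plus[symmetric] powr_add field_simps del: ennreal_plus)
        finally show ?case .
      qed
      define Q where "Q = enn2real (\<integral>\<^sup>+x. ennreal (\<bar>\<phi> x\<bar> powr p) * indicator {x. \<bar>\<phi> x\<bar> < M k} x \<partial>lborel)"
      define T where "T = enn2real (tail p (M k))"
      have split: "(\<integral>\<^sup>+x. ennreal (\<bar>\<phi> x\<bar> powr p) * indicator {x. \<bar>\<phi> x\<bar> < M k} x \<partial>lborel) + tail p (M k) = ennreal P"
        unfolding tail_def P(2)[symmetric]
        by (subst nn_integral_add[symmetric]) (auto intro!: nn_integral_cong simp: indicator_def)
      have Q: "(\<integral>\<^sup>+x. ennreal (\<bar>\<phi> x\<bar> powr p) * indicator {x. \<bar>\<phi> x\<bar> < M k} x \<partial>lborel) = ennreal Q" "0 \<le> Q"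
      proof -
        have "(\<integral>\<^sup>+x. ennreal (\<bar>\<phi> x\<bar> powr p) * indicator {x. \<bar>\<phi> x\<bar> < M k} x \<partial>lborel) \<le> ennreal P"
          unfolding split[symmetric] by simp
        then have "(\<integral>\<^sup>+x. ennreal (\<bar>\<phi> x\<bar> powr p) * indicator {x. \<bar>\<phi> x\<bar> < M k} x \<partial>lborel) < top"
          by (rule le_less_trans) simp
        then show "(\<integral>\<^sup>+x. ennreal (\<bar>\<phi> x\<bar> powr p) * indicator {x. \<bar>\<phi> x\<bar> < M k} x \<partial>lborel) = ennreal Q" "0 \<le> Q"
          unfolding Q_def by auto
      qed
      have T: "tail p (M k) = ennreal T" "0 \<le> T"
        unfolding T_def using tail_finite[of p "M k"] p by auto
      have "Q + T = P" using split Q(2) T(2) P(1) unfolding Q(1) T(1)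
        by (simp add: ennreal_plus[symmetric] del: ennreal_plus)
      moreover have "T \<le> 2 powr (p + 1) / 2 ^ k * P" using tail_le P(1) unfolding T(1) by (simp add: ennreal_le_iff)
      moreover have "2 powr (p + 1) / 2 ^ k * P \<le> (1 - \<theta> powr p) * P" using k P(1) by (intro mult_right_mono) auto
      ultimately have "\<theta> powr p * P \<le> Q" by (simp add: algebra_simps)
      then have "(\<theta> powr p * P) powr (N / p) \<le> Q powr (N / p)"
        using \<theta> P(1) p N by (intro powr_mono2) auto
      moreover have "(\<theta> powr p * P) powr (N / p) = \<theta> powr N * \<delta> powr N"
        unfolding \<delta>(3) using \<theta> P(1) p by (simp add: powr_mult powr_powr)
      ultimately have "\<gamma>1 * (\<theta> powr N * \<delta> powr N) \<le> \<gamma>1 * Q powr (N / p)"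
        using \<gamma> by (intro mult_left_mono) auto
      then have 1: "(\<gamma> + \<gamma>1) / 2 * \<delta> powr N \<le> \<gamma>1 * Q powr (N / p)"
        unfolding \<theta>(3)[symmetric] by (simp add: mult.assoc)
      have 2: "c' * M k ^ CARD('n) + \<gamma> * \<delta> powr N \<le> (\<gamma> + \<gamma>1) / 2 * \<delta> powr N"
      proof -
        have "M k ^ CARD('n) = (2 ^ k * A) powr N * \<delta> powr N"
          unfolding MN unfolding M_def using A(1) \<delta>(1) by (simp add: powr_mult mult.assoc)
        then have "c' * M k ^ CARD('n) = c' * ((2 ^ k * A) powr N * \<delta> powr N)" by simp
        also have "\<dots> \<le> (\<gamma>1 - \<gamma>) / 2 / (2 ^ k * A) powr N * ((2 ^ k * A) powr N * \<delta> powr N)"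
          by (rule mult_right_mono[OF c'(3)]) simp
        also have "\<dots> = (\<gamma>1 - \<gamma>) / 2 * \<delta> powr N" using A by simp
        finally show ?thesis by (simp add: field_simps)
      qed
      have "ennreal (c' * M k ^ CARD('n) + \<gamma> * \<delta> powr N) \<le> ennreal (\<gamma>1 * Q powr (N / p))"
        using 1 2 by (intro ennreal_leI) (rule order_trans)
      also have "\<dots> \<le> low_energy (M k)"
        unfolding N_def using trunc[unfolded truncation_bound_def, rule_format, OF M(1) Q(2,1)] .
      finally show ?thesis unfolding \<delta>(3) unfolding N_def by (intro exI[of _ "M k"] conjI M(1))
    qed
  qed
qed

text \<open>At the level M of \<open>exists_level_energy_gain\<close> the low energy pays for the
  whole \<gamma>-term and for an extra c M^N, so the energy above M is at most 1 - c M^N. The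
  truncated exponential sum with budget \<sigma> < 1 then tolerates the larger exponent that results
  from returning from max 0 (|\<phi>| - M) to |\<phi>|.\<close>

lemma (in finsler_norm) smooth_trudinger_moser:
  fixes \<gamma> \<gamma>1 p \<beta> V :: real
  assumes dim2: "2 \<le> CARD('n)" and \<gamma>: "0 \<le> \<gamma>" "\<gamma> < \<gamma>1" and p: "1 < p"
    and \<beta>: "0 \<le> \<beta>" "\<beta> < real CARD('n)" and V: "0 < V"
    and [measurable]: "\<Omega> \<in> sets borel" and \<Omega>: "emeasure lborel \<Omega> \<le> ennreal V"
  shows "\<exists>K. \<forall>\<phi> G P. compactly_supported_C1 F \<phi> G \<longrightarrow> {x. \<phi> x \<noteq> 0} \<subseteq> \<Omega> \<longrightarrow> 0 \<le> P \<longrightarrow>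
     (\<integral>\<^sup>+x. ennreal (\<bar>\<phi> x\<bar> powr p) \<partial>lborel) = ennreal P \<longrightarrow>
     compactly_supported_C1.truncation_bound F \<phi> G \<gamma>1 p \<longrightarrow>
     (\<integral>\<^sup>+x. ennreal (F (G x) ^ CARD('n)) \<partial>lborel) \<le> ennreal (1 + \<gamma> * P powr (real CARD('n) / p)) \<longrightarrow>
     exp_integral \<Omega> (lambda_N F * (1 - \<beta> / real CARD('n))) \<beta> \<phi> \<le> ennreal K"
proof -
  define N where "N = real CARD('n)"
  define r where "r = 1 / (N - 1)"
  define q where "q = N / (N - 1)"
  define \<Lambda> where "\<Lambda> = lambda_N F"
  define \<alpha> where "\<alpha> = 1 - \<beta> / N"
  have N: "2 \<le> N" using dim2 unfolding N_def by simp
  have r: "0 < r" and q: "1 < q" "1 - q = - r" "N * r = q"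
    unfolding r_def q_def using N by (auto simp: field_simps)
  have \<alpha>: "0 < \<alpha>" unfolding \<alpha>_def using \<beta> N unfolding N_def by simp
  have \<Lambda>: "0 < \<Lambda>" unfolding \<Lambda>_def lambda_N_def Let_def using kappa_pos dim2 by (simp add: \<kappa>_def)
  have "0 \<le> level_const N" unfolding level_const_def using N by (intro add_nonneg_nonneg) auto
  from adams_garsia_sum[OF N \<alpha> this] obtain S where S: "\<And>I (t::nat \<Rightarrow> real). adams_garsia_levels N (level_const N) I t \<Longrightarrow>
    (\<Sum>n\<in>I. exp (\<alpha> * (n - t n))) \<le> S" by blast
  obtain c where c: "0 < c" and gain: "\<And>\<phi> G P. compactly_supported_C1 F \<phi> G \<Longrightarrow> 0 < P \<Longrightarrow>
     (\<integral>\<^sup>+x. ennreal (\<bar>\<phi> x\<bar> powr p) \<partial>lborel) = ennreal P \<Longrightarrow>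
     compactly_supported_C1.truncation_bound F \<phi> G \<gamma>1 p \<Longrightarrow>
     (\<exists>M>0. ennreal (c * M ^ CARD('n) + \<gamma> * P powr (N / p)) \<le> compactly_supported_C1.low_energy F \<phi> G M)"
    using exists_level_energy_gain[OF dim2 \<gamma> p] unfolding N_def by blast
  define K1 where "K1 = exp (\<alpha> * (\<Lambda> * (c / 2) powr (- r))) * (exp \<alpha> * (C_wt \<beta> * V powr \<alpha>) * (1 + S))"
  define K where "K = max K1 (C_wt \<beta> * V powr \<alpha>)"
  show ?thesis
  proof (rule exI[of _ K], intro allI impI)
    fix \<phi> G P
    assume C1: "compactly_supported_C1 F \<phi> G" and sub: "{x. \<phi> x \<noteq> 0} \<subseteq> \<Omega>" and P: "0 \<le> P"
      "(\<integral>\<^sup>+x. ennreal (\<bar>\<phi> x\<bar> powr p) \<partial>lborel) = ennreal P"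
      and trunc: "compactly_supported_C1.truncation_bound F \<phi> G \<gamma>1 p"
      and en: "(\<integral>\<^sup>+x. ennreal (F (G x) ^ CARD('n)) \<partial>lborel) \<le> ennreal (1 + \<gamma> * P powr (real CARD('n) / p))"
    interpret compactly_supported_C1 F \<phi> G by fact
    have "(\<integral>\<^sup>+x. ennreal (exp (\<Lambda> * \<alpha> * \<bar>\<phi> x\<bar> powr q) * \<rho> x powr (- \<beta>)) * indicator \<Omega> x \<partial>lborel) \<le> ennreal K"
    proof (cases "P = 0")
      case True
      then have "AE x in lborel. ennreal (\<bar>\<phi> x\<bar> powr p) = 0" using P(2) by (subst nn_integral_0_iff_AE[symmetric]) auto
      then have "(\<integral>\<^sup>+x. ennreal (exp (\<Lambda> * \<alpha> * \<bar>\<phi> x\<bar> powr q) * \<rho> x powr (- \<beta>)) * indicator \<Omega> x \<partial>lborel)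
        = (\<integral>\<^sup>+x. ennreal (\<rho> x powr (- \<beta>)) * indicator \<Omega> x \<partial>lborel)"
        by (intro nn_integral_cong_AE, eventually_elim) (auto simp: powr_def split: if_splits)
      also have "\<dots> \<le> ennreal (C_wt \<beta> * V powr \<alpha>)"
        unfolding \<alpha>_def N_def by (rule nn_integral_weight_le[OF \<beta> _ \<Omega> V]) measurable
      also have "\<dots> \<le> ennreal K" unfolding K_def by (intro ennreal_leI) simp
      finally show ?thesis .
    next
      case False
      then have "0 < P" using P by simp
      then obtain M where M: "0 < M" "ennreal (c * M ^ CARD('n) + \<gamma> * P powr (N / p)) \<le> low_energy M"
        using gain[OF C1 _ P(2)] trunc unfolding N_def by blast
      define g where "g = \<gamma> * P powr (N / p)"
      \<comment> \<open>Only half of the gain is spent. Nonnegativity of the high energy then gives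
        s \<le> 1/2, so \<sigma> = 1 - s stays positive and s is an admissible weight in
        \<open>powr_add_le_convex\<close>.\<close>
      define s where "s = c / 2 * M powr N"
      define \<sigma> where "\<sigma> = 1 - s"
      have g: "0 \<le> g" and s: "0 < s" "2 * s = c * M ^ CARD('n)"
        unfolding g_def s_def N_def using \<gamma> c M(1) by (auto simp: powr_realpow)
      have total: "low_energy M + high_energy M \<le> ennreal (1 + g)"
        unfolding low_high_energy using en unfolding g_def N_def .
      have "ennreal (2 * s + g) + high_energy M \<le> low_energy M + high_energy M"
        using M(2) unfolding s(2) g_def by (rule add_right_mono)
      also note total
      finally have sg: "ennreal (2 * s + g) + high_energy M \<le> ennreal (1 + g)" .
      have "high_energy M \<le> ennreal (1 + g)"
        by (rule order_trans[OF _ total]) simp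
      then have fin: "high_energy M < top" by (rule le_less_trans) simp
      have "2 * s + g + enn2real (high_energy M) \<le> 1 + g"
        using sg fin s(1) g by (cases "high_energy M")
          (auto simp: ennreal_plus[symmetric] ennreal_le_iff simp del: ennreal_plus)
      then have hi: "enn2real (high_energy M) \<le> 1 - 2 * s" by simp
      then have s12: "s \<le> 1 / 2" using enn2real_nonneg[of "high_energy M"] by linarith
      have \<sigma>: "0 < \<sigma>" unfolding \<sigma>_def using s12 by simp
      have "high_energy M \<le> ennreal \<sigma>"
      proof -
        have "high_energy M = ennreal (enn2real (high_energy M))" using fin by simp
        also have "\<dots> \<le> ennreal \<sigma>" using hi s(1) unfolding \<sigma>_def by (intro ennreal_leI) linarith
        finally show ?thesis .
      qed
      moreover have "emeasure lborel {x. M < \<bar>\<phi> x\<bar>} \<le> ennreal V"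
        by (rule order_trans[OF emeasure_mono \<Omega>]) (use sub M(1) in auto)
      ultimately have main: "(\<integral>\<^sup>+x. ennreal (exp (\<alpha> * (\<Lambda> * (max 0 (\<bar>\<phi> x\<bar> - M)) powr q * \<sigma> powr (- r))) * \<rho> x powr (- \<beta>)) * indicator \<Omega> x \<partial>lborel)
        \<le> ennreal (exp \<alpha> * (C_wt \<beta> * V powr \<alpha>) * (1 + S))"
        unfolding \<Lambda>_def q_def r_def N_def
        by (intro truncated_exponential_sum[OF less_imp_le[OF M(1)] \<sigma> V _ _ _ \<beta> _ _ \<Omega>])
          (use S in \<open>auto simp: high_energy_def \<alpha>_def N_def\<close>)
      have pw: "exp (\<Lambda> * \<alpha> * \<bar>\<phi> x\<bar> powr q)
        \<le> exp (\<alpha> * (\<Lambda> * (c / 2) powr (- r))) * exp (\<alpha> * (\<Lambda> * (max 0 (\<bar>\<phi> x\<bar> - M)) powr q * \<sigma> powr (- r)))" for x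
      proof -
        have "\<bar>\<phi> x\<bar> powr q \<le> (max 0 (\<bar>\<phi> x\<bar> - M) + M) powr q" using q by (intro powr_mono2) auto
        also have "\<dots> \<le> (1 - s) powr (1 - q) * max 0 (\<bar>\<phi> x\<bar> - M) powr q + s powr (1 - q) * M powr q"
          using s s12 M(1) q by (intro powr_add_le_convex) auto
        \<comment> \<open>The critical cancellation: N (1 - q) + q = 0, so the cost of the shift
          does not depend on M. The other coefficient (1 - s)^(1-q) is exactly the \<sigma>^(-r)
          allowed by \<open>truncated_exponential_sum\<close>.\<close>
        also have "s powr (1 - q) * M powr q = (c / 2) powr (- r)"
        proof -
          have "s powr (1 - q) = (c / 2) powr (- r) * M powr (- q)"
            unfolding s_def q(2) using c M(1) q(3) by (subst powr_mult) (simp_all add: powr_powr)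
          then show ?thesis using M(1) by (simp add: powr_minus)
        qed
        finally have "\<alpha> * \<Lambda> * \<bar>\<phi> x\<bar> powr q
            \<le> \<alpha> * \<Lambda> * (\<sigma> powr (- r) * max 0 (\<bar>\<phi> x\<bar> - M) powr q + (c / 2) powr (- r))"
          unfolding \<sigma>_def q(2) using \<alpha> \<Lambda> by (intro mult_left_mono) auto
        then show ?thesis by (simp add: mult_exp_exp algebra_simps)
      qed
      have "(\<integral>\<^sup>+x. ennreal (exp (\<Lambda> * \<alpha> * \<bar>\<phi> x\<bar> powr q) * \<rho> x powr (- \<beta>)) * indicator \<Omega> x \<partial>lborel)
        \<le> (\<integral>\<^sup>+x. ennreal (exp (\<alpha> * (\<Lambda> * (c / 2) powr (- r)))) *
          (ennreal (exp (\<alpha> * (\<Lambda> * (max 0 (\<bar>\<phi> x\<bar> - M)) powr q * \<sigma> powr (- r))) * \<rho> x powr (- \<beta>)) * indicator \<Omega> x) \<partial>lborel)"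
        using pw by (intro nn_integral_mono)
          (auto simp: indicator_def ennreal_mult[symmetric] mult.assoc[symmetric] intro!: ennreal_leI mult_right_mono)
      also have "\<dots> = ennreal (exp (\<alpha> * (\<Lambda> * (c / 2) powr (- r)))) *
          (\<integral>\<^sup>+x. ennreal (exp (\<alpha> * (\<Lambda> * (max 0 (\<bar>\<phi> x\<bar> - M)) powr q * \<sigma> powr (- r))) * \<rho> x powr (- \<beta>)) * indicator \<Omega> x \<partial>lborel)"
        by (rule nn_integral_cmult) measurable
      also have "\<dots> \<le> ennreal (exp (\<alpha> * (\<Lambda> * (c / 2) powr (- r)))) * ennreal (exp \<alpha> * (C_wt \<beta> * V powr \<alpha>) * (1 + S))"
        by (intro mult_left_mono main) auto
      also have "\<dots> = ennreal K1" unfolding K1_def by (rule ennreal_mult'[symmetric]) simp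
      also have "\<dots> \<le> ennreal K" unfolding K_def by (intro ennreal_leI) simp
      finally show ?thesis .
    qed
    then show "exp_integral \<Omega> (lambda_N F * (1 - \<beta> / real CARD('n))) \<beta> \<phi> \<le> ennreal K"
      unfolding exp_integral_def \<Lambda>_def \<alpha>_def q_def N_def .
  qed
qed

section \<open>Test functions\<close>

text \<open>An invariant for coinduction on \<open>smooth_on\<close>. Products alone are not stable
  under differentiation, since the product rule gives sums of products; this closure contains the
  partial derivatives of all its members, including the powers used for smooth truncation.\<close>

inductive smooth_alg :: "(real^'n \<Rightarrow> real) \<Rightarrow> bool" where
  base: "smooth_on UNIV f \<Longrightarrow> smooth_alg f"
| const: "smooth_alg (\<lambda>x. c)"
| add: "smooth_alg f \<Longrightarrow> smooth_alg g \<Longrightarrow> smooth_alg (\<lambda>x. f x + g x)"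
| mult: "smooth_alg f \<Longrightarrow> smooth_alg g \<Longrightarrow> smooth_alg (\<lambda>x. f x * g x)"
| powr: "smooth_alg f \<Longrightarrow> (\<And>x. 0 < f x) \<Longrightarrow> smooth_alg (\<lambda>x. f x powr s)"

lemma smooth_onD:
  assumes "smooth_on S f"
  shows "continuous_on S f"
    and "\<exists>g. (\<forall>x\<in>S. ((\<lambda>t. f (x + t *\<^sub>R axis i 1)) has_real_derivative g x) (at 0)) \<and> smooth_on S g"
  using assms by (auto elim: smooth_on.cases)

lemma smooth_alg_partial:
  "smooth_alg f \<Longrightarrow> continuous_on UNIV f \<and>
    (\<exists>g. (\<forall>x. ((\<lambda>t. f (x + t *\<^sub>R axis i 1)) has_real_derivative g x) (at 0)) \<and> smooth_alg g)"
proof (induction rule: smooth_alg.induct)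
  case (base f)
  obtain g where "\<forall>x\<in>UNIV. ((\<lambda>t. f (x + t *\<^sub>R axis i 1)) has_real_derivative g x) (at 0)" "smooth_on UNIV g"
    using smooth_onD(2)[OF base] by blast
  then show ?case using smooth_onD(1)[OF base] smooth_alg.base by blast
next
  case (const c)
  show ?case by (auto intro!: exI[of _ "\<lambda>x. 0"] smooth_alg.const)
next
  case (add f g)
  then obtain f' g' where *: "\<And>x. ((\<lambda>t. f (x + t *\<^sub>R axis i 1)) has_real_derivative f' x) (at 0)" "smooth_alg f'"
    "\<And>x. ((\<lambda>t. g (x + t *\<^sub>R axis i 1)) has_real_derivative g' x) (at 0)" "smooth_alg g'" by blast
  show ?case
    by (intro conjI continuous_intros exI[of _ "\<lambda>x. f' x + g' x"] allI smooth_alg.add derivative_intros *)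
      (use add in auto)
next
  case (mult f g)
  then obtain f' g' where *: "\<And>x. ((\<lambda>t. f (x + t *\<^sub>R axis i 1)) has_real_derivative f' x) (at 0)" "smooth_alg f'"
    "\<And>x. ((\<lambda>t. g (x + t *\<^sub>R axis i 1)) has_real_derivative g' x) (at 0)" "smooth_alg g'" by blast
  have "smooth_alg (\<lambda>x. f' x * g x + g' x * f x)"
    by (intro smooth_alg.add smooth_alg.mult * mult.hyps)
  moreover have "((\<lambda>t. f (x + t *\<^sub>R axis i 1) * g (x + t *\<^sub>R axis i 1)) has_real_derivative
      f' x * g x + g' x * f x) (at 0)" for x
    using DERIV_mult[OF *(1,3)[of x]] by simp
  moreover have "continuous_on UNIV (\<lambda>x. f x * g x)" using mult by (intro continuous_intros) auto
  ultimately show ?case by (intro conjI exI[of _ "\<lambda>x. f' x * g x + g' x * f x"] allI)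
next
  case (powr f s)
  then obtain f' where *: "\<And>x. ((\<lambda>t. f (x + t *\<^sub>R axis i 1)) has_real_derivative f' x) (at 0)" "smooth_alg f'"
    by blast
  have "smooth_alg (\<lambda>x. s * f x powr (s - 1) * f' x)"
    by (intro smooth_alg.mult smooth_alg.const smooth_alg.powr * powr.hyps)
  moreover have "((\<lambda>t. f (x + t *\<^sub>R axis i 1) powr s) has_real_derivative s * f x powr (s - 1) * f' x) (at 0)" for x
    using DERIV_fun_powr[OF *(1)[of x], of s] powr.hyps(2) by simp
  moreover have "continuous_on UNIV (\<lambda>x. f x powr s)"
    using powr less_imp_neq[OF powr.hyps(2)] by (intro continuous_intros) (auto simp: less_le)
  ultimately show ?case by (intro conjI exI[of _ "\<lambda>x. s * f x powr (s - 1) * f' x"] allI)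
qed

lemma smooth_alg_smooth:
  fixes f :: "real^'n \<Rightarrow> real"
  assumes "smooth_alg f"
  shows "smooth_on UNIV f"
proof (rule smooth_on.coinduct[of "\<lambda>S f. S = UNIV \<and> smooth_alg f"])
  fix S :: "(real^'n) set" and f :: "real^'n \<Rightarrow> real"
  assume S: "S = UNIV \<and> smooth_alg f"
  have "\<exists>g. (\<forall>x\<in>S. ((\<lambda>t. f (x + t *\<^sub>R axis i 1)) has_real_derivative g x) (at 0)) \<and>
      ((S = UNIV \<and> smooth_alg g) \<or> smooth_on S g)" for i
  proof -
    obtain g where "\<forall>x. ((\<lambda>t. f (x + t *\<^sub>R axis i 1)) has_real_derivative g x) (at 0)" "smooth_alg g"
      using smooth_alg_partial[of f i] S by blast
    then show ?thesis using S by (intro exI[of _ g] conjI disjI1) auto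
  qed
  moreover have "continuous_on S f" using S smooth_alg_partial by blast
  ultimately show "\<exists>S' f'. S = S' \<and> f = f' \<and> continuous_on S' f' \<and>
      (\<forall>i. \<exists>g. (\<forall>x\<in>S'. ((\<lambda>t. f' (x + t *\<^sub>R axis i 1)) has_real_derivative g x) (at 0)) \<and>
        ((S' = UNIV \<and> smooth_alg g) \<or> smooth_on S' g))"
    by - (rule exI[of _ S], rule exI[of _ f], intro conjI refl allI, blast+)
qed (use assms in simp)

lemma smooth_alg_power: "smooth_alg f \<Longrightarrow> smooth_alg (\<lambda>x. f x ^ n)"
  by (induction n) (auto intro: smooth_alg.const smooth_alg.mult)

section \<open>Test functions paired with their gradients\<close>

definition test_function :: "(real^'n) set \<Rightarrow> (real^'n \<Rightarrow> real) \<Rightarrow> (real^'n \<Rightarrow> real^'n) \<Rightarrow> bool" where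
  "test_function \<Omega> \<phi> G \<longleftrightarrow> smooth_on UNIV \<phi> \<and> compact (closure {x. \<phi> x \<noteq> 0}) \<and>
     closure {x. \<phi> x \<noteq> 0} \<subseteq> \<Omega> \<and> (\<forall>x. (\<phi> has_derivative (\<lambda>h. G x \<bullet> h)) (at x))"

lemma W0_iff:
  "W0 \<Omega> q u g \<longleftrightarrow> u \<in> borel_measurable lebesgue \<and> g \<in> borel_measurable lebesgue \<and>
     (\<exists>\<phi> G. (\<forall>k. test_function \<Omega> (\<phi> k) (G k)) \<and>
        (\<lambda>k. \<integral>\<^sup>+ x. ennreal (\<bar>\<phi> k x - u x\<bar> powr q) \<partial>lebesgue) \<longlonglongrightarrow> 0 \<and>
        (\<lambda>k. \<integral>\<^sup>+ x. ennreal (norm (G k x - g x) powr q) \<partial>lebesgue) \<longlonglongrightarrow> 0)"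
  unfolding W0_def test_function_def by auto

text \<open>Differentiability alone says nothing about continuity of G. The coordinates of G are
  identified with the partial derivatives supplied by \<open>smooth_on\<close>, which are
  continuous.\<close>

lemma test_function_continuous:
  assumes "test_function \<Omega> \<phi> G"
  shows "continuous_on UNIV \<phi>" "continuous_on UNIV G"
proof -
  have d: "\<And>x. (\<phi> has_derivative (\<lambda>h. G x \<bullet> h)) (at x)" and s: "smooth_on UNIV \<phi>"
    using assms unfolding test_function_def by auto
  show "continuous_on UNIV \<phi>" by (rule smooth_onD[OF s])
  have "\<forall>i. \<exists>g. (\<forall>x. ((\<lambda>t. \<phi> (x + t *\<^sub>R axis i 1)) has_real_derivative g x) (at 0)) \<and> smooth_on UNIV g"
    using smooth_onD(2)[OF s] by simp
  then obtain g where g: "\<And>i x. ((\<lambda>t. \<phi> (x + t *\<^sub>R axis i 1)) has_real_derivative g i x) (at 0)"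
    "\<And>i. smooth_on UNIV (g i)" by metis
  have "G x = (\<chi> i. g i x)" for x
    unfolding vec_eq_iff
  proof
    fix i
    have "((\<lambda>t. \<phi> (x + t *\<^sub>R axis i 1)) has_real_derivative G x \<bullet> axis i 1) (at 0)"
      unfolding has_field_derivative_def
      by (rule has_derivative_eq_rhs[OF has_derivative_compose[OF _ d]])
        (auto intro!: derivative_eq_intros simp: fun_eq_iff)
    then show "G x $ i = (\<chi> i. g i x) $ i"
      using DERIV_unique[OF _ g(1)[of x i]] by (simp add: inner_axis)
  qed
  then have "G = (\<lambda>x. \<chi> i. g i x)" by auto
  then show "continuous_on UNIV G" using smooth_onD(1)[OF g(2)] by (auto intro!: continuous_intros)
qed

lemma test_function_G_eq_0:
  assumes "test_function \<Omega> \<phi> G" "x \<notin> closure {x. \<phi> x \<noteq> 0}"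
  shows "G x = 0"
proof -
  have d: "(\<phi> has_derivative (\<lambda>h. G x \<bullet> h)) (at x)"
    using assms unfolding test_function_def by auto
  have "open (- closure {x. \<phi> x \<noteq> 0})" by auto
  then have "((\<lambda>x. 0) has_derivative (\<lambda>h. G x \<bullet> h)) (at x)"
    by (rule has_derivative_transform_within_open[OF d])
      (use assms(2) closure_subset[of "{x. \<phi> x \<noteq> 0}"] in auto)
  then have "(\<lambda>h. G x \<bullet> h) = (\<lambda>h. 0)"
    by (rule has_derivative_unique) (rule has_derivative_const)
  then have "G x \<bullet> G x = 0" by meson
  then show ?thesis by simp
qed

lemma test_function_measurable:
  assumes "test_function \<Omega> \<phi> G"
  shows "\<phi> \<in> borel_measurable borel" "G \<in> borel_measurable borel"
  using test_function_continuous[OF assms] by (auto intro: borel_measurable_continuous_onI)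

lemma test_function_zero_outside:
  assumes "test_function \<Omega> \<phi> G" "x \<notin> \<Omega>"
  shows "\<phi> x = 0" "G x = 0"
  using assms test_function_G_eq_0[OF assms(1), of x] closure_subset[of "{x. \<phi> x \<noteq> 0}"]
  unfolding test_function_def by blast+

lemma test_function_imp_W0:
  assumes "test_function \<Omega> \<phi> G" "0 < q"
  shows "W0 \<Omega> q \<phi> G"
  unfolding W0_iff
  using assms test_function_measurable[OF assms(1)]
  by (auto intro!: measurable_completion exI[of _ "\<lambda>k. \<phi>"] exI[of _ "\<lambda>k. G"])

lemma test_function_lincomb:
  assumes "test_function \<Omega> \<phi> G" "test_function \<Omega> \<psi> H"
  shows "test_function \<Omega> (\<lambda>x. a * \<phi> x + b * \<psi> x) (\<lambda>x. a *\<^sub>R G x + b *\<^sub>R H x)"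
proof -
  let ?S = "\<lambda>f. closure {x. f x \<noteq> (0::real)}"
  have sub: "?S (\<lambda>x. a * \<phi> x + b * \<psi> x) \<subseteq> ?S \<phi> \<union> ?S \<psi>"
    unfolding closure_Un[symmetric] by (rule closure_mono) auto
  have c: "compact (?S \<phi> \<union> ?S \<psi>)" "?S \<phi> \<union> ?S \<psi> \<subseteq> \<Omega>"
    using assms unfolding test_function_def by auto
  have cp: "compact (?S (\<lambda>x. a * \<phi> x + b * \<psi> x))"
    using compact_Int_closed[OF c(1) closed_closure, of "{x. a * \<phi> x + b * \<psi> x \<noteq> 0}"] sub
    by (simp only: inf.absorb2)
  have "smooth_alg \<phi>" "smooth_alg \<psi>"
    using assms unfolding test_function_def by (blast intro: smooth_alg.base)+
  then have sm: "smooth_on UNIV (\<lambda>x. a * \<phi> x + b * \<psi> x)"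
    by (intro smooth_alg_smooth[OF smooth_alg.add] smooth_alg.mult smooth_alg.const)
  have d: "((\<lambda>x. a * \<phi> x + b * \<psi> x) has_derivative (\<lambda>h. (a *\<^sub>R G x + b *\<^sub>R H x) \<bullet> h)) (at x)" for x
  proof -
    have "(\<phi> has_derivative (\<lambda>h. G x \<bullet> h)) (at x)" "(\<psi> has_derivative (\<lambda>h. H x \<bullet> h)) (at x)"
      using assms unfolding test_function_def by blast+
    then have "((\<lambda>x. a * \<phi> x + b * \<psi> x) has_derivative (\<lambda>h. a * (G x \<bullet> h) + b * (H x \<bullet> h))) (at x)"
      by (intro has_derivative_add has_derivative_mult_right)
    then show ?thesis by (simp add: inner_add_left)
  qed
  show ?thesis unfolding test_function_def
    using cp sm d order_trans[OF sub c(2)] by (intro conjI allI)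
qed

lemma test_function_scale:
  assumes "test_function \<Omega> \<phi> G"
  shows "test_function \<Omega> (\<lambda>x. a * \<phi> x) (\<lambda>x. a *\<^sub>R G x)"
  using test_function_lincomb[OF assms assms, of a 0] by simp

lemma test_function_diff:
  assumes "test_function \<Omega> \<phi> G" "test_function \<Omega> \<psi> H"
  shows "test_function \<Omega> (\<lambda>x. \<phi> x - \<psi> x) (\<lambda>x. G x - H x)"
  using test_function_lincomb[OF assms, of 1 "-1"] by simp

text \<open>Needed so that the eigenvalue inequality can be applied to the approximation error
  itself: \<open>W0\<close> yields convergence in L^N only, and convergence in L^p has to come from
  the gradients.\<close>

lemma test_function_W0_diff:
  assumes "W0 \<Omega> q u g" "test_function \<Omega> \<phi> G"
  shows "W0 \<Omega> q (\<lambda>x. \<phi> x - u x) (\<lambda>x. G x - g x)"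
proof -
  obtain \<psi> H where H: "\<And>k. test_function \<Omega> (\<psi> k) (H k)"
    "(\<lambda>k. \<integral>\<^sup>+ x. ennreal (\<bar>\<psi> k x - u x\<bar> powr q) \<partial>lebesgue) \<longlonglongrightarrow> 0"
    "(\<lambda>k. \<integral>\<^sup>+ x. ennreal (norm (H k x - g x) powr q) \<partial>lebesgue) \<longlonglongrightarrow> 0"
    and [measurable]: "u \<in> borel_measurable lebesgue" "g \<in> borel_measurable lebesgue"
    using assms(1) unfolding W0_iff by blast
  have [measurable]: "\<phi> \<in> borel_measurable lebesgue" "G \<in> borel_measurable lebesgue"
    using test_function_measurable[OF assms(2)] by (auto intro: measurable_completion)
  show ?thesis
    unfolding W0_iff
  proof (intro conjI exI allI)
    show "(\<lambda>x. \<phi> x - u x) \<in> borel_measurable lebesgue" "(\<lambda>x. G x - g x) \<in> borel_measurable lebesgue"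
      by measurable
    show "test_function \<Omega> (\<lambda>x. \<phi> x - \<psi> k x) (\<lambda>x. G x - H k x)" for k
      by (rule test_function_diff[OF assms(2) H(1)])
    show "(\<lambda>k. \<integral>\<^sup>+ x. ennreal (\<bar>\<phi> x - \<psi> k x - (\<phi> x - u x)\<bar> powr q) \<partial>lebesgue) \<longlonglongrightarrow> 0"
      using H(2) by (simp add: abs_minus_commute)
    show "(\<lambda>k. \<integral>\<^sup>+ x. ennreal (norm (G x - H k x - (G x - g x)) powr q) \<partial>lebesgue) \<longlonglongrightarrow> 0"
      using H(3) by (simp add: norm_minus_commute)
  qed
qed

text \<open>A smooth approximation of the truncation at height \<open>M\<close>, exact in the limit \<open>j \<rightarrow> \<infinity>\<close>.\<close>

lemma test_function_truncate:
  fixes M :: real and j :: nat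
  assumes "test_function \<Omega> \<phi> G" and M: "0 < M" and j: "even j" "0 < j"
  shows "test_function \<Omega> (\<lambda>x. \<phi> x * (1 + (\<phi> x / M) ^ j) powr (- (1 / j)))
     (\<lambda>x. (1 + (\<phi> x / M) ^ j) powr (- (1 / j) - 1) *\<^sub>R G x)"
proof -
  let ?T = "\<lambda>x. \<phi> x * (1 + (\<phi> x / M) ^ j) powr (- (1 / j))"
  have pos: "0 < 1 + (\<phi> x / M) ^ j" for x
    using j zero_le_even_power[of j "\<phi> x / M"] by (intro add_pos_nonneg) auto
  have s: "smooth_on UNIV \<phi>" and d: "\<And>x. (\<phi> has_derivative (\<lambda>h. G x \<bullet> h)) (at x)"
    and K: "compact (closure {x. \<phi> x \<noteq> 0})" "closure {x. \<phi> x \<noteq> 0} \<subseteq> \<Omega>"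
    using assms unfolding test_function_def by auto
  have "1 + (\<phi> x / M) ^ j \<noteq> 0" for x using pos[of x] by linarith
  then have supp: "{x. ?T x \<noteq> 0} = {x. \<phi> x \<noteq> 0}"
    by (simp only: mult_eq_0_iff powr_eq_0_iff simp_thms)
  have sm: "smooth_on UNIV ?T"
    unfolding divide_inverse[where b = M]
    by (rule smooth_alg_smooth, intro smooth_alg.mult smooth_alg.powr smooth_alg.add smooth_alg.const
        smooth_alg_power smooth_alg.base[OF s]) (use pos in \<open>simp add: divide_inverse\<close>)
  have de: "(?T has_derivative (\<lambda>h. ((1 + (\<phi> x / M) ^ j) powr (- (1 / j) - 1) *\<^sub>R G x) \<bullet> h)) (at x)" for x
  proof -
    define p where "p = 1 + (\<phi> x / M) ^ j"
    have p: "0 < p" unfolding p_def by (rule pos)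
    have "((\<lambda>t. 1 + (t / M) ^ j) has_real_derivative j * (\<phi> x / M) ^ (j - 1) * (1 / M)) (at (\<phi> x))"
      using M by (auto intro!: derivative_eq_intros)
    from DERIV_mult[OF DERIV_ident DERIV_fun_powr[OF this, of "- (1 / j)"]]
    have "((\<lambda>t. t * (1 + (t / M) ^ j) powr (- (1 / j))) has_real_derivative
       (p powr (- (1 / j)) + \<phi> x * (- (1 / j) * p powr (- (1 / j) - 1) * (j * (\<phi> x / M) ^ (j - 1) * (1 / M))))) (at (\<phi> x))"
      using p unfolding p_def by (simp add: mult_ac)
    \<comment> \<open>Since \<phi> times the derivative of (\<phi>/M)^j is j (p - 1), the product
      rule gives p^(-1/j) - (p - 1) p^(-1/j-1), and all but one term cancels. As j is even, p \<ge>
      1, so the truncation never lengthens the gradient.\<close>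
    also have "p powr (- (1 / j)) + \<phi> x * (- (1 / j) * p powr (- (1 / j) - 1) * (j * (\<phi> x / M) ^ (j - 1) * (1 / M)))
      = p powr (- (1 / j) - 1)"
    proof -
      have "\<phi> x * ((\<phi> x / M) ^ (j - 1) * (1 / M)) = (\<phi> x / M) ^ j"
        using j M by (cases j) auto
      moreover have "\<phi> x * (- (1 / j) * P * (j * Y * (1 / M))) = - P * (\<phi> x * (Y * (1 / M)))" for P Y :: real
        using j M by (simp add: field_simps)
      ultimately have "\<phi> x * (- (1 / j) * p powr (- (1 / j) - 1) * (j * (\<phi> x / M) ^ (j - 1) * (1 / M)))
        = - (p powr (- (1 / j) - 1)) * (p - 1)"
        unfolding p_def by (simp only: add_diff_cancel_left')
      moreover have "p powr (- (1 / j)) = p powr (- (1 / j) - 1) * p"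
        using p by (simp add: powr_diff)
      ultimately show ?thesis by (simp add: algebra_simps)
    qed
    finally have D: "((\<lambda>t. t * (1 + (t / M) ^ j) powr (- (1 / j))) has_derivative
       (\<lambda>h. p powr (- (1 / j) - 1) * h)) (at (\<phi> x))"
      unfolding has_field_derivative_def .
    show ?thesis
      by (rule has_derivative_eq_rhs[OF has_derivative_compose[OF d D]]) (simp add: p_def)
  qed
  show ?thesis unfolding test_function_def supp using sm de K by (intro conjI allI)
qed

section \<open>The first eigenvalue and truncation\<close>

lemma nn_integral_Minkowski:
  fixes f h :: "'a \<Rightarrow> real" and p a b :: real
  assumes [measurable]: "f \<in> borel_measurable M" "h \<in> borel_measurable M"
    and nonneg: "\<And>x. 0 \<le> f x" "\<And>x. 0 \<le> h x" "0 \<le> a" "0 \<le> b" and p: "1 \<le> p"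
    and a: "(\<integral>\<^sup>+x. ennreal (f x powr p) \<partial>M) = ennreal a"
    and b: "(\<integral>\<^sup>+x. ennreal (h x powr p) \<partial>M) = ennreal b"
  shows "(\<integral>\<^sup>+x. ennreal ((f x + h x) powr p) \<partial>M) \<le> ennreal ((a powr (1 / p) + b powr (1 / p)) powr p)"
proof -
  have AE_zero: "AE x in M. g x = 0"
    if "(\<integral>\<^sup>+x. ennreal (g x powr p) \<partial>M) = 0" "g \<in> borel_measurable M" "\<And>x. 0 \<le> g x" for g
  proof -
    have "AE x in M. ennreal (g x powr p) = 0"
      using that by (subst nn_integral_0_iff_AE[symmetric]) auto
    then show ?thesis by eventually_elim (use that(3) in \<open>auto simp: powr_def split: if_splits\<close>)
  qed
  consider "a = 0" | "b = 0" | "0 < a" "0 < b" using nonneg by linarith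
  then show ?thesis
  proof cases
    case 1
    then have "AE x in M. f x = 0" using AE_zero[of f] a nonneg by simp
    then have "(\<integral>\<^sup>+x. ennreal ((f x + h x) powr p) \<partial>M) = (\<integral>\<^sup>+x. ennreal (h x powr p) \<partial>M)"
      by (intro nn_integral_cong_AE, eventually_elim) simp
    then show ?thesis using 1 b p nonneg by (simp add: powr_powr)
  next
    case 2
    then have "AE x in M. h x = 0" using AE_zero[of h] b nonneg by simp
    then have "(\<integral>\<^sup>+x. ennreal ((f x + h x) powr p) \<partial>M) = (\<integral>\<^sup>+x. ennreal (f x powr p) \<partial>M)"
      by (intro nn_integral_cong_AE, eventually_elim) simp
    then show ?thesis using 2 a p nonneg by (simp add: powr_powr)
  next
    case 3
    define A where "A = a powr (1 / p)"
    define B where "B = b powr (1 / p)"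
    \<comment> \<open>The optimal weight: with it the integrated convexity inequality has right side
      exactly (A + B)^p.\<close>
    define \<tau> where "\<tau> = B / (A + B)"
    have AB: "0 < A" "0 < B" "A powr p = a" "B powr p = b"
      unfolding A_def B_def using 3 p by (auto simp: powr_powr)
    have \<tau>: "0 < \<tau>" "\<tau> < 1" "1 - \<tau> = A / (A + B)" unfolding \<tau>_def using AB by (auto simp: field_simps)
    have "(\<integral>\<^sup>+x. ennreal ((f x + h x) powr p) \<partial>M)
      \<le> (\<integral>\<^sup>+x. ennreal ((1 - \<tau>) powr (1 - p)) * ennreal (f x powr p)
          + ennreal (\<tau> powr (1 - p)) * ennreal (h x powr p) \<partial>M)"
      using powr_add_le_convex[OF nonneg(1,2) \<tau>(1,2) p]
      by (intro nn_integral_mono)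
        (simp add: ennreal_mult[symmetric] ennreal_plus[symmetric] ennreal_leI del: ennreal_plus)
    also have "\<dots> = ennreal ((1 - \<tau>) powr (1 - p)) * ennreal a + ennreal (\<tau> powr (1 - p)) * ennreal b"
      unfolding a[symmetric] b[symmetric] by (subst nn_integral_add) (simp_all add: nn_integral_cmult)
    also have "\<dots> = ennreal ((1 - \<tau>) powr (1 - p) * a + \<tau> powr (1 - p) * b)"
      using nonneg by (simp add: ennreal_mult)
    also have "(1 - \<tau>) powr (1 - p) * a + \<tau> powr (1 - p) * b = (A + B) powr p"
    proof -
      have *: "(X / (A + B)) powr (1 - p) * X powr p = (A + B) powr (p - 1) * X" if "0 < X" for X
      proof -
        have "(X / (A + B)) powr (1 - p) * X powr p = (X powr (1 - p) * X powr p) / (A + B) powr (1 - p)"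
          using that AB by (simp add: powr_divide)
        also have "\<dots> = X / (A + B) powr (1 - p)" using that by (simp add: powr_add[symmetric])
        also have "\<dots> = (A + B) powr (- (1 - p)) * X" by (simp only: powr_minus) (simp add: field_simps)
        finally show ?thesis by simp
      qed
      have "(1 - \<tau>) powr (1 - p) * a + \<tau> powr (1 - p) * b = (A + B) powr (p - 1) * (A + B)"
        unfolding \<tau>(3) using *[OF AB(1)] *[OF AB(2)] AB(3,4) unfolding \<tau>_def by (simp add: algebra_simps)
      also have "\<dots> = (A + B) powr p" using AB by (simp add: powr_diff)
      finally show ?thesis .
    qed
    finally show ?thesis unfolding A_def B_def .
  qed
qed

text \<open>Allowing w to be merely dominated by f + h makes one lemma serve both the L^p norms of
  functions and, through the subadditivity of F, the energies of gradients.\<close>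

lemma Lp_norm_triangle:
  fixes f h w :: "'a \<Rightarrow> real" and p a b c :: real
  assumes [measurable]: "f \<in> borel_measurable M" "h \<in> borel_measurable M"
    and nonneg: "\<And>x. 0 \<le> f x" "\<And>x. 0 \<le> h x" "\<And>x. 0 \<le> w x" "0 \<le> a" "0 \<le> b" and p: "1 \<le> p"
    and a: "(\<integral>\<^sup>+x. ennreal (f x powr p) \<partial>M) = ennreal a"
    and b: "(\<integral>\<^sup>+x. ennreal (h x powr p) \<partial>M) = ennreal b"
    and w: "\<And>x. w x \<le> f x + h x"
  shows "(\<integral>\<^sup>+x. ennreal (w x powr p) \<partial>M) < \<infinity>"
    and "enn2real (\<integral>\<^sup>+x. ennreal (w x powr p) \<partial>M) powr (1 / p) \<le> a powr (1 / p) + b powr (1 / p)"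
proof -
  have le: "(\<integral>\<^sup>+x. ennreal (w x powr p) \<partial>M) \<le> ennreal ((a powr (1 / p) + b powr (1 / p)) powr p)"
    using w nonneg p
    by (intro order_trans[OF nn_integral_mono nn_integral_Minkowski[OF assms(1,2) nonneg(1,2,4,5) p a b]])
      (auto intro!: ennreal_leI powr_mono2)
  then show "(\<integral>\<^sup>+x. ennreal (w x powr p) \<partial>M) < \<infinity>" by (rule le_less_trans) simp
  have "enn2real (\<integral>\<^sup>+x. ennreal (w x powr p) \<partial>M) \<le> (a powr (1 / p) + b powr (1 / p)) powr p"
    using enn2real_mono[OF le] by simp
  then have "enn2real (\<integral>\<^sup>+x. ennreal (w x powr p) \<partial>M) powr (1 / p)
      \<le> ((a powr (1 / p) + b powr (1 / p)) powr p) powr (1 / p)"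
    using p by (intro powr_mono2) auto
  then show "enn2real (\<integral>\<^sup>+x. ennreal (w x powr p) \<partial>M) powr (1 / p) \<le> a powr (1 / p) + b powr (1 / p)"
    using p by (simp add: powr_powr)
qed

lemma tendsto_of_root_diff:
  fixes x y :: "nat \<Rightarrow> real" and a p :: real
  assumes p: "1 \<le> p" and nonneg: "\<And>k. 0 \<le> x k" "0 \<le> a" "\<And>k. 0 \<le> y k"
    and le: "\<And>k. x k powr (1 / p) \<le> a powr (1 / p) + y k powr (1 / p)"
      "\<And>k. a powr (1 / p) \<le> x k powr (1 / p) + y k powr (1 / p)"
    and y: "y \<longlonglongrightarrow> 0"
  shows "x \<longlonglongrightarrow> a"
proof -
  have "(\<lambda>k. y k powr (1 / p)) \<longlonglongrightarrow> 0 powr (1 / p)"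
    using p nonneg by (intro tendsto_powr' y tendsto_const) auto
  then have y0: "(\<lambda>k. y k powr (1 / p)) \<longlonglongrightarrow> 0" using p by simp
  have "(\<lambda>k. x k powr (1 / p) - a powr (1 / p)) \<longlonglongrightarrow> 0"
    by (rule Lim_null_comparison[OF always_eventually y0]) (use le in \<open>auto simp: abs_le_iff algebra_simps\<close>)
  then have lim: "(\<lambda>k. x k powr (1 / p)) \<longlonglongrightarrow> a powr (1 / p)" by (simp add: LIM_zero_iff)
  have "(\<lambda>k. (x k powr (1 / p)) powr p) \<longlonglongrightarrow> (a powr (1 / p)) powr p"
    by (rule tendsto_powr'[OF lim tendsto_const]) (use p in auto)
  moreover have "(x k powr (1 / p)) powr p = x k" for k using p nonneg(1)[of k] by (simp add: powr_powr)
  moreover have "(a powr (1 / p)) powr p = a" using p nonneg(2) by (simp add: powr_powr)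
  ultimately show ?thesis by simp
qed

lemma nn_integral_le_of_AE_tendsto:
  fixes f :: "nat \<Rightarrow> 'a \<Rightarrow> ennreal"
  assumes [measurable]: "\<And>k. f k \<in> borel_measurable M"
    and lim: "AE x in M. (\<lambda>k. f k x) \<longlonglongrightarrow> g x" and le: "\<And>k. (\<integral>\<^sup>+x. f k x \<partial>M) \<le> K"
  shows "(\<integral>\<^sup>+x. g x \<partial>M) \<le> K"
proof -
  have "(\<integral>\<^sup>+x. g x \<partial>M) = (\<integral>\<^sup>+x. liminf (\<lambda>k. f k x) \<partial>M)"
    using lim by (intro nn_integral_cong_AE, eventually_elim) (simp add: lim_imp_Liminf)
  also have "\<dots> \<le> liminf (\<lambda>k. \<integral>\<^sup>+x. f k x \<partial>M)" by (rule nn_integral_liminf) measurable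
  also have "\<dots> \<le> K"
    using Liminf_mono[of "\<lambda>k. \<integral>\<^sup>+x. f k x \<partial>M" "\<lambda>k. K" sequentially] le by (simp add: Liminf_const)
  finally show ?thesis .
qed

lemma finsler_norm_of_anisotropic: "anisotropic_F F \<Longrightarrow> finsler_norm F"
  unfolding anisotropic_F_def finsler_norm_def by auto

lemma compactly_supported_C1_of_test_function:
  fixes F :: "real^'n \<Rightarrow> real"
  assumes "finsler_norm F" "2 \<le> CARD('n)" "test_function \<Omega> \<phi> G"
  shows "compactly_supported_C1 F \<phi> G"
proof -
  interpret finsler_norm F by fact
  have "bounded {x. \<phi> x \<noteq> 0}"
    using assms(3) compact_imp_bounded bounded_subset closure_subset unfolding test_function_def by metis
  then show ?thesis
    using assms(2,3) test_function_continuous[OF assms(3)]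
    by unfold_locales (auto simp: test_function_def)
qed

section \<open>Test functions in the variational problem for \<open>gamma_1\<close>\<close>

context finsler_norm
begin

text \<open>\<open>F_energy\<close> is defined through \<open>enn2real\<close>, which sends infinity
  to 0, so the identity rests on finiteness: F(G) is bounded on the compact support and vanishes
  outside it.\<close>

lemma F_energy_test_function:
  assumes "test_function \<Omega> \<phi> G"
  shows "(\<integral>\<^sup>+x. ennreal (F (G x) ^ CARD('n)) \<partial>lborel) = ennreal (F_energy F \<Omega> G)"
proof -
  have G0: "F (G x) ^ CARD('n) = 0" if "x \<notin> S" "S = \<Omega> \<or> S = closure {x. \<phi> x \<noteq> 0}" for x S
    using test_function_zero_outside(2)[OF assms, of x] test_function_G_eq_0[OF assms, of x] that by auto
  obtain C where C: "0 < C" "\<And>x. F x \<le> C * norm x" using F_bounds by metis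
  have K: "compact (closure {x. \<phi> x \<noteq> 0})" using assms unfolding test_function_def by blast
  have "compact ((\<lambda>x. F (G x)) ` closure {x. \<phi> x \<noteq> 0})"
    by (intro compact_continuous_image K continuous_on_compose2[OF F_continuous]
        continuous_on_subset[OF test_function_continuous(2)[OF assms]]) auto
  then obtain B where B: "\<And>x. x \<in> closure {x. \<phi> x \<noteq> 0} \<Longrightarrow> \<bar>F (G x)\<bar> \<le> B"
    by (meson bounded_real compact_imp_bounded imageI)
  have "(\<integral>\<^sup>+x. ennreal (F (G x) ^ CARD('n)) \<partial>lborel)
      \<le> (\<integral>\<^sup>+x. ennreal (B ^ CARD('n)) * indicator (closure {x. \<phi> x \<noteq> 0}) x \<partial>lborel)"
  proof (rule nn_integral_mono)
    fix x
    show "ennreal (F (G x) ^ CARD('n)) \<le> ennreal (B ^ CARD('n)) * indicator (closure {x. \<phi> x \<noteq> 0}) x"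
    proof (cases "x \<in> closure {x. \<phi> x \<noteq> 0}")
      case True
      then have "F (G x) ^ CARD('n) \<le> B ^ CARD('n)" using B[OF True] F_nonneg by (intro power_mono) auto
      then show ?thesis using True by (simp add: ennreal_leI)
    qed (use G0 in simp)
  qed
  also have "\<dots> = ennreal (B ^ CARD('n)) * emeasure lborel (closure {x. \<phi> x \<noteq> 0})"
    by (rule nn_integral_cmult_indicator) simp
  also have "\<dots> < \<infinity>" using emeasure_compact_finite[OF K] by (simp add: ennreal_mult_less_top)
  finally have "(\<integral>\<^sup>+x. ennreal (F (G x) ^ CARD('n)) \<partial>lborel) < \<infinity>" .
  moreover have "(\<integral>\<^sup>+x\<in>\<Omega>. ennreal (F (G x) ^ CARD('n)) \<partial>lebesgue) = (\<integral>\<^sup>+x. ennreal (F (G x) ^ CARD('n)) \<partial>lborel)"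
    unfolding nn_integral_completion using G0[of _ \<Omega>] by (intro nn_integral_cong) (auto simp: indicator_def)
  ultimately show ?thesis unfolding F_energy_def by simp
qed

lemma Lp_norm_test_function:
  fixes \<phi> :: "real^'n \<Rightarrow> real"
  assumes "test_function \<Omega> \<phi> G" "0 < p" "2 \<le> CARD('n)"
  obtains P where "0 \<le> P" "(\<integral>\<^sup>+x. ennreal (\<bar>\<phi> x\<bar> powr p) \<partial>lborel) = ennreal P"
    "Lp_norm \<Omega> p \<phi> ^ CARD('n) = P powr (real CARD('n) / p)"
proof -
  interpret compactly_supported_C1 F \<phi> G
    by (rule compactly_supported_C1_of_test_function[OF _ assms(3,1)]) unfold_locales
  have "tail p 0 = (\<integral>\<^sup>+x. ennreal (\<bar>\<phi> x\<bar> powr p) \<partial>lborel)" unfolding tail_def by simp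
  then have fin: "(\<integral>\<^sup>+x. ennreal (\<bar>\<phi> x\<bar> powr p) \<partial>lborel) < \<infinity>" using tail_finite[OF assms(2), of 0] by simp
  have eq: "(\<integral>\<^sup>+x\<in>\<Omega>. ennreal (\<bar>\<phi> x\<bar> powr p) \<partial>lebesgue) = (\<integral>\<^sup>+x. ennreal (\<bar>\<phi> x\<bar> powr p) \<partial>lborel)"
    unfolding nn_integral_completion using test_function_zero_outside(1)[OF assms(1)] assms(2)
    by (intro nn_integral_cong) (auto simp: indicator_def)
  show ?thesis
    by (rule that[of "enn2real (\<integral>\<^sup>+x. ennreal (\<bar>\<phi> x\<bar> powr p) \<partial>lborel)"])
      (use fin in \<open>auto simp: Lp_norm_def eq powr_realpow_of_nonneg[symmetric] powr_powr\<close>)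
qed

text \<open>Positivity of \<open>gamma_1\<close> already contains the embedding into L^p. If a
  nonzero u had infinite L^p norm, \<open>enn2real\<close> would make \<open>Lp_norm\<close> zero,
  the quotient would be 0 by the convention for division by zero, and the infimum could not be
  positive.\<close>

lemma gamma_1_mult_le:
  assumes W: "W0 \<Omega> (real CARD('n)) u g" and pos: "0 < gamma_1 F \<Omega> p"
  shows "gamma_1 F \<Omega> p * Lp_norm \<Omega> p u ^ CARD('n) \<le> F_energy F \<Omega> g"
    and "(\<integral>\<^sup>+x\<in>\<Omega>. ennreal (\<bar>u x\<bar> powr p) \<partial>lebesgue) < \<infinity>"
proof -
  have E: "0 \<le> F_energy F \<Omega> g" for g unfolding F_energy_def by simp
  have L: "0 \<le> Lp_norm \<Omega> p u" for u unfolding Lp_norm_def by simp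
  have "gamma_1 F \<Omega> p * Lp_norm \<Omega> p u ^ CARD('n) \<le> F_energy F \<Omega> g
    \<and> (\<integral>\<^sup>+x\<in>\<Omega>. ennreal (\<bar>u x\<bar> powr p) \<partial>lebesgue) < \<infinity>"
  proof (cases "AE x in lebesgue. u x = 0")
    case True
    then have "(\<integral>\<^sup>+x\<in>\<Omega>. ennreal (\<bar>u x\<bar> powr p) \<partial>lebesgue) = (\<integral>\<^sup>+x. 0 \<partial>(lebesgue :: (real^'n) measure))"
      by (intro nn_integral_cong_AE, eventually_elim) simp
    then show ?thesis using E by (simp add: Lp_norm_def power_0_left)
  next
    case False
    have le: "gamma_1 F \<Omega> p \<le> F_energy F \<Omega> g / Lp_norm \<Omega> p u ^ CARD('n)"
      unfolding gamma_1_def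
    proof (rule cInf_lower)
      show "bdd_below {F_energy F \<Omega> g / Lp_norm \<Omega> p u ^ CARD('n) |u g.
        W0 \<Omega> (real CARD('n)) u g \<and> \<not> (AE x in lebesgue. u x = 0)}"
        using E L by (intro bdd_belowI[of _ 0]) auto
    qed (use W False in blast)
    then have ne: "Lp_norm \<Omega> p u ^ CARD('n) \<noteq> 0" using pos by (metis div_by_0 not_le)
    then have "(\<integral>\<^sup>+x\<in>\<Omega>. ennreal (\<bar>u x\<bar> powr p) \<partial>lebesgue) \<noteq> \<infinity>"
      by (auto simp: Lp_norm_def)
    moreover have "0 < Lp_norm \<Omega> p u ^ CARD('n)" using ne L[of u] by (simp add: less_le)
    ultimately show ?thesis using le by (simp add: pos_le_divide_eq top.not_eq_extremum)
  qed
  then show "gamma_1 F \<Omega> p * Lp_norm \<Omega> p u ^ CARD('n) \<le> F_energy F \<Omega> g"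
    "(\<integral>\<^sup>+x\<in>\<Omega>. ennreal (\<bar>u x\<bar> powr p) \<partial>lebesgue) < \<infinity>" by auto
qed

text \<open>Apply the eigenvalue inequality to smooth truncations at height M with exponents j
  growing to infinity. Where |\<phi>| \<le> M the gradients are no longer than G; above M their
  factor tends to 0, and dominated convergence removes that part of the energy.\<close>

lemma truncation_energy:
  assumes t: "test_function \<Omega> \<phi> G" and dim2: "2 \<le> CARD('n)" and p: "1 < p"
    and pos: "0 < gamma_1 F \<Omega> p"
  shows "compactly_supported_C1.truncation_bound F \<phi> G (gamma_1 F \<Omega> p) p"
proof -
  interpret compactly_supported_C1 F \<phi> G
    by (rule compactly_supported_C1_of_test_function[OF _ dim2 t]) unfold_locales
  have "ennreal (gamma_1 F \<Omega> p * Q powr (real CARD('n) / p)) \<le> low_energy M"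
    if M: "0 < M" and Q0: "0 \<le> Q"
      and Q: "(\<integral>\<^sup>+x. ennreal (\<bar>\<phi> x\<bar> powr p) * indicator {x. \<bar>\<phi> x\<bar> < M} x \<partial>lborel) = ennreal Q" for M Q
  proof -
    define N where "N = real CARD('n)"
    have N: "2 \<le> N" using dim2 unfolding N_def by simp
    define j where "j k = 2 * Suc k" for k :: nat
    have j: "even (j k)" "0 < j k" "1 \<le> j k" for k unfolding j_def by auto
    define b where "b k x = 1 + (\<phi> x / M) ^ j k" for k x
    have b1: "1 \<le> b k x" for k x unfolding b_def using zero_le_even_power[OF j(1)] by simp
    define d where "d k x = b k x powr (- (1 / j k) - 1)" for k x
    have [measurable]: "b k \<in> borel_measurable borel" "d k \<in> borel_measurable borel" for k
      unfolding b_def d_def by measurable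
    have d: "0 \<le> d k x" "d k x \<le> 1" for k x
    proof -
      have "0 \<le> 1 / real (j k)" by simp
      then have "d k x \<le> b k x powr 0" unfolding d_def using b1 by (intro powr_mono) linarith+
      then show "d k x \<le> 1" using b1[of k x] by simp
    qed (simp add: d_def)
    let ?e = "\<lambda>k. \<integral>\<^sup>+x. ennreal ((d k x * F (G x)) ^ CARD('n)) * indicator {x. M < \<bar>\<phi> x\<bar>} x \<partial>lborel"
    \<comment> \<open>Where |\<phi>| < M the base b is at most 2, so the smooth truncation keeps at
      least the fraction 2^(-1/j) of |\<phi>|. In the N-th power of the norm this becomes 2^(-N/j),
      which tends to 1.\<close>
    have lower: "ennreal (gamma_1 F \<Omega> p * (2 powr (- (N / j k)) * Q powr (N / p))) \<le> low_energy M + ?e k" for k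
    proof -
      have T: "test_function \<Omega> (\<lambda>x. \<phi> x * b k x powr (- (1 / j k))) (\<lambda>x. d k x *\<^sub>R G x)"
        unfolding b_def d_def by (rule test_function_truncate[OF t M j(1,2)])
      obtain P where P: "0 \<le> P" "(\<integral>\<^sup>+x. ennreal (\<bar>\<phi> x * b k x powr (- (1 / j k))\<bar> powr p) \<partial>lborel) = ennreal P"
        "Lp_norm \<Omega> p (\<lambda>x. \<phi> x * b k x powr (- (1 / j k))) ^ CARD('n) = P powr (N / p)"
        unfolding N_def by (rule Lp_norm_test_function[OF T _ dim2, of p]) (use p in auto)
      have "ennreal (2 powr (- (p / j k)) * Q)
        = (\<integral>\<^sup>+x. ennreal (2 powr (- (p / j k))) * (ennreal (\<bar>\<phi> x\<bar> powr p) * indicator {x. \<bar>\<phi> x\<bar> < M} x) \<partial>lborel)"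
        using Q0 by (subst nn_integral_cmult) (simp_all add: Q ennreal_mult)
      also have "\<dots> \<le> (\<integral>\<^sup>+x. ennreal (\<bar>\<phi> x * b k x powr (- (1 / j k))\<bar> powr p) \<partial>lborel)"
      proof (rule nn_integral_mono)
        fix x
        show "ennreal (2 powr (- (p / j k))) * (ennreal (\<bar>\<phi> x\<bar> powr p) * indicator {x. \<bar>\<phi> x\<bar> < M} x)
          \<le> ennreal (\<bar>\<phi> x * b k x powr (- (1 / j k))\<bar> powr p)"
        proof (cases "\<bar>\<phi> x\<bar> < M")
          case True
          have "(\<phi> x / M) ^ j k \<le> 1"
          proof -
            have "\<bar>\<phi> x / M\<bar> ^ j k \<le> 1" using True M by (intro power_le_one) auto
            then show ?thesis unfolding power_even_abs[OF j(1)] .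
          qed
          then have "b k x \<le> 2" unfolding b_def by simp
          then have "2 powr (- (p / j k)) \<le> b k x powr (- (p / j k))"
            using b1[of k x] p j(2)[of k] by (intro powr_mono2') auto
          then have "2 powr (- (p / j k)) * \<bar>\<phi> x\<bar> powr p \<le> b k x powr (- (p / j k)) * \<bar>\<phi> x\<bar> powr p"
            by (intro mult_right_mono) auto
          also have "\<dots> = \<bar>\<phi> x * b k x powr (- (1 / j k))\<bar> powr p"
            by (simp add: abs_mult powr_mult powr_powr mult.commute)
          finally show ?thesis using True by (simp add: ennreal_mult[symmetric] ennreal_leI)
        qed simp
      qed
      finally have "2 powr (- (p / j k)) * Q \<le> P" unfolding P(2) using P(1) by (simp add: ennreal_le_iff)
      then have "(2 powr (- (p / j k)) * Q) powr (N / p) \<le> P powr (N / p)"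
        using Q0 N p by (intro powr_mono2) auto
      moreover have "(2 powr (- (p / j k)) * Q) powr (N / p) = 2 powr (- (N / j k)) * Q powr (N / p)"
        using Q0 p by (simp add: powr_mult powr_powr)
      ultimately have "gamma_1 F \<Omega> p * (2 powr (- (N / j k)) * Q powr (N / p)) \<le> gamma_1 F \<Omega> p * P powr (N / p)"
        using pos by (intro mult_left_mono) auto
      also have "\<dots> \<le> F_energy F \<Omega> (\<lambda>x. d k x *\<^sub>R G x)"
        using gamma_1_mult_le(1)[OF test_function_imp_W0[OF T] pos] unfolding P(3) by simp
      finally have "ennreal (gamma_1 F \<Omega> p * (2 powr (- (N / j k)) * Q powr (N / p)))
        \<le> (\<integral>\<^sup>+x. ennreal (F (d k x *\<^sub>R G x) ^ CARD('n)) \<partial>lborel)"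
        unfolding F_energy_test_function[OF T] by (rule ennreal_leI)
      also have "\<dots> \<le> (\<integral>\<^sup>+x. ennreal (F (G x) ^ CARD('n)) * indicator {x. \<bar>\<phi> x\<bar> \<le> M} x
          + ennreal ((d k x * F (G x)) ^ CARD('n)) * indicator {x. M < \<bar>\<phi> x\<bar>} x \<partial>lborel)"
      proof (rule nn_integral_mono)
        fix x
        have "(d k x * F (G x)) ^ CARD('n) \<le> (1 * F (G x)) ^ CARD('n)"
          using d[of k x] F_nonneg by (intro power_mono mult_right_mono) auto
        then show "ennreal (F (d k x *\<^sub>R G x) ^ CARD('n)) \<le> ennreal (F (G x) ^ CARD('n)) * indicator {x. \<bar>\<phi> x\<bar> \<le> M} x
          + ennreal ((d k x * F (G x)) ^ CARD('n)) * indicator {x. M < \<bar>\<phi> x\<bar>} x"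
          using d(1)[of k x] by (auto simp: F_scale indicator_def ennreal_leI)
      qed
      also have "\<dots> = low_energy M + ?e k"
        unfolding low_energy_def by (rule nn_integral_add) measurable
      finally show ?thesis .
    qed
    have e_lim: "?e \<longlonglongrightarrow> (\<integral>\<^sup>+x. 0 \<partial>(lborel :: (real^'n) measure))"
    proof (rule nn_integral_dominated_convergence[where w = "\<lambda>x. ennreal (F (G x) ^ CARD('n))"])
      show "AE x in lborel. ennreal ((d k x * F (G x)) ^ CARD('n)) * indicator {x. M < \<bar>\<phi> x\<bar>} x
          \<le> ennreal (F (G x) ^ CARD('n))" for k
      proof (rule AE_I2)
        fix x
        have "(d k x * F (G x)) ^ CARD('n) \<le> (1 * F (G x)) ^ CARD('n)"
          using d[of k x] F_nonneg by (intro power_mono mult_right_mono) auto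
        then show "ennreal ((d k x * F (G x)) ^ CARD('n)) * indicator {x. M < \<bar>\<phi> x\<bar>} x \<le> ennreal (F (G x) ^ CARD('n))"
          by (auto simp: indicator_def ennreal_leI)
      qed
      show "AE x in lborel. (\<lambda>k. ennreal ((d k x * F (G x)) ^ CARD('n)) * indicator {x. M < \<bar>\<phi> x\<bar>} x) \<longlonglongrightarrow> 0"
      proof (rule AE_I2)
        fix x
        show "(\<lambda>k. ennreal ((d k x * F (G x)) ^ CARD('n)) * indicator {x. M < \<bar>\<phi> x\<bar>} x) \<longlonglongrightarrow> 0"
        proof (cases "M < \<bar>\<phi> x\<bar>")
          case True
          define y where "y = \<bar>\<phi> x\<bar> / M"
          have y: "1 < y" unfolding y_def using True M by simp
          have dy: "d k x \<le> (1 / y) ^ k" for k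
          proof -
            have "d k x \<le> b k x powr (- 1)" unfolding d_def using b1 by (intro powr_mono) auto
            also have "\<dots> = 1 / b k x" using b1[of k x] by (simp add: powr_minus_divide)
            also have "\<dots> \<le> 1 / y ^ k"
            proof (rule divide_left_mono)
              have "y ^ k \<le> y ^ j k" using y unfolding j_def by (intro power_increasing) auto
              also have "y ^ j k = (\<phi> x / M) ^ j k" unfolding y_def
                using j(1)[of k] M power_even_abs[of "j k" "\<phi> x / M"] by (simp add: abs_divide)
              also have "\<dots> \<le> b k x" unfolding b_def by simp
              finally show "y ^ k \<le> b k x" .
            qed (use y b1[of k x] in auto)
            finally show ?thesis by (simp add: power_one_over)
          qed
          have y0: "(\<lambda>k. (1 / y) ^ k) \<longlonglongrightarrow> 0" using y by (intro LIMSEQ_realpow_zero) auto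
          have "(\<lambda>k. d k x) \<longlonglongrightarrow> 0"
            by (intro real_tendsto_sandwich[OF _ _ tendsto_const y0] always_eventually allI d dy)
          then have "(\<lambda>k. (d k x * F (G x)) ^ CARD('n)) \<longlonglongrightarrow> (0 * F (G x)) ^ CARD('n)"
            by (intro tendsto_intros)
          then have "(\<lambda>k. ennreal ((d k x * F (G x)) ^ CARD('n))) \<longlonglongrightarrow> ennreal ((0 * F (G x)) ^ CARD('n))"
            by (rule tendsto_ennrealI)
          then show ?thesis using True by (simp add: power_0_left)
        qed simp
      qed
      show "(\<integral>\<^sup>+x. ennreal (F (G x) ^ CARD('n)) \<partial>lborel) < \<infinity>"
        unfolding F_energy_test_function[OF t] by simp
    qed measurable
    have "(\<lambda>k. 2 powr (- (N / j k))) \<longlonglongrightarrow> 2 powr (- 0)"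
    proof (intro tendsto_intros)
      have "filterlim (\<lambda>k. real (j k)) at_top sequentially"
      proof (rule filterlim_at_top_mono[OF filterlim_real_sequentially])
        show "\<forall>\<^sub>F k in sequentially. real k \<le> real (j k)" unfolding j_def by (intro always_eventually) simp
      qed
      then show "(\<lambda>k. N / real (j k)) \<longlonglongrightarrow> 0" by (intro tendsto_divide_0[OF tendsto_const] filterlim_at_top_imp_at_infinity)
    qed simp
    then have "(\<lambda>k. gamma_1 F \<Omega> p * (2 powr (- (N / j k)) * Q powr (N / p))) \<longlonglongrightarrow> gamma_1 F \<Omega> p * (1 * Q powr (N / p))"
      by (intro tendsto_intros) simp
    then have "(\<lambda>k. ennreal (gamma_1 F \<Omega> p * (2 powr (- (N / j k)) * Q powr (N / p))))
        \<longlonglongrightarrow> ennreal (gamma_1 F \<Omega> p * (1 * Q powr (N / p)))"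
      by (rule tendsto_ennrealI)
    moreover have "(\<lambda>k. low_energy M + ?e k) \<longlonglongrightarrow> low_energy M + 0"
      using e_lim by (intro tendsto_intros) simp
    ultimately have "ennreal (gamma_1 F \<Omega> p * (1 * Q powr (N / p))) \<le> low_energy M + 0"
      by (rule LIMSEQ_le) (use lower in blast)
    then show ?thesis unfolding N_def by simp
  qed
  then show ?thesis unfolding truncation_bound_def by blast
qed

lemma test_function_trudinger_moser:
  fixes \<gamma> p \<beta> :: real
  assumes dim2: "2 \<le> CARD('n)" and \<gamma>: "0 \<le> \<gamma>" "\<gamma> < gamma_1 F \<Omega> p" and p: "1 < p"
    and \<beta>: "0 \<le> \<beta>" "\<beta> < real CARD('n)" and \<Omega>: "open \<Omega>" "bounded \<Omega>"
  obtains K where "\<And>\<phi> G. test_function \<Omega> \<phi> G \<Longrightarrow> F_energy F \<Omega> G - \<gamma> * Lp_norm \<Omega> p \<phi> ^ CARD('n) \<le> 1 \<Longrightarrow>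
     exp_integral \<Omega> (lambda_N F * (1 - \<beta> / real CARD('n))) \<beta> \<phi> \<le> ennreal K"
proof -
  define V where "V = measure lborel \<Omega> + 1"
  have V: "0 < V" unfolding V_def by (simp add: add_nonneg_pos)
  have "emeasure lborel \<Omega> = ennreal (measure lborel \<Omega>)"
    using emeasure_bounded_finite[OF \<Omega>(2)] by (simp add: emeasure_eq_ennreal_measure)
  then have V': "emeasure lborel \<Omega> \<le> ennreal V" unfolding V_def by (simp add: ennreal_leI)
  have "\<Omega> \<in> sets borel" using \<Omega>(1) by simp
  from smooth_trudinger_moser[OF dim2 \<gamma> p \<beta> V this V'] obtain K where K: "\<And>\<phi> G P.
     compactly_supported_C1 F \<phi> G \<Longrightarrow> {x. \<phi> x \<noteq> 0} \<subseteq> \<Omega> \<Longrightarrow> 0 \<le> P \<Longrightarrow>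
     (\<integral>\<^sup>+x. ennreal (\<bar>\<phi> x\<bar> powr p) \<partial>lborel) = ennreal P \<Longrightarrow>
     compactly_supported_C1.truncation_bound F \<phi> G (gamma_1 F \<Omega> p) p \<Longrightarrow>
     (\<integral>\<^sup>+x. ennreal (F (G x) ^ CARD('n)) \<partial>lborel) \<le> ennreal (1 + \<gamma> * P powr (real CARD('n) / p)) \<Longrightarrow>
     exp_integral \<Omega> (lambda_N F * (1 - \<beta> / real CARD('n))) \<beta> \<phi> \<le> ennreal K" by blast
  show ?thesis
  proof (rule that[of K])
    fix \<phi> G
    assume t: "test_function \<Omega> \<phi> G" and le: "F_energy F \<Omega> G - \<gamma> * Lp_norm \<Omega> p \<phi> ^ CARD('n) \<le> 1"
    obtain P where P: "0 \<le> P" "(\<integral>\<^sup>+x. ennreal (\<bar>\<phi> x\<bar> powr p) \<partial>lborel) = ennreal P"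
      "Lp_norm \<Omega> p \<phi> ^ CARD('n) = P powr (real CARD('n) / p)"
      by (rule Lp_norm_test_function[OF t _ dim2, of p]) (use p in auto)
    show "exp_integral \<Omega> (lambda_N F * (1 - \<beta> / real CARD('n))) \<beta> \<phi> \<le> ennreal K"
    proof (rule K[OF _ _ P(1,2)])
      show "compactly_supported_C1 F \<phi> G"
        by (rule compactly_supported_C1_of_test_function[OF _ dim2 t]) unfold_locales
      show "{x. \<phi> x \<noteq> 0} \<subseteq> \<Omega>" using test_function_zero_outside(1)[OF t] by blast
      show "compactly_supported_C1.truncation_bound F \<phi> G (gamma_1 F \<Omega> p) p"
        by (rule truncation_energy[OF t dim2 p le_less_trans[OF \<gamma>]])
      show "(\<integral>\<^sup>+x. ennreal (F (G x) ^ CARD('n)) \<partial>lborel) \<le> ennreal (1 + \<gamma> * P powr (real CARD('n) / p))"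
        unfolding F_energy_test_function[OF t] P(3)[symmetric] using le by (intro ennreal_leI) linarith
    qed
  qed
qed

end

section \<open>Approximation by test functions\<close>

lemma AE_subseq_of_Lp_tendsto:
  fixes \<phi> :: "nat \<Rightarrow> 'a \<Rightarrow> real" and u :: "'a \<Rightarrow> real"
  assumes [measurable]: "\<And>k. \<phi> k \<in> borel_measurable M" "u \<in> borel_measurable M" and q: "0 < q"
    and fin: "\<And>k. (\<integral>\<^sup>+x. ennreal (\<bar>\<phi> k x - u x\<bar> powr q) \<partial>M) < \<infinity>"
    and lim: "(\<lambda>k. \<integral>\<^sup>+x. ennreal (\<bar>\<phi> k x - u x\<bar> powr q) \<partial>M) \<longlonglongrightarrow> 0"
  obtains r :: "nat \<Rightarrow> nat" where "strict_mono r" "AE x in M. (\<lambda>k. \<phi> (r k) x) \<longlonglongrightarrow> u x"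
proof -
  have int: "integrable M (\<lambda>x. \<bar>\<phi> k x - u x\<bar> powr q)" for k
    using fin[of k] by (intro integrableI_bounded) auto
  have "(\<lambda>k. enn2real (\<integral>\<^sup>+x. ennreal (\<bar>\<phi> k x - u x\<bar> powr q) \<partial>M)) \<longlonglongrightarrow> 0"
    by (rule tendsto_enn2real) (use lim in auto)
  moreover have "enn2real (\<integral>\<^sup>+x. ennreal (\<bar>\<phi> k x - u x\<bar> powr q) \<partial>M) = (\<integral>x. norm (\<bar>\<phi> k x - u x\<bar> powr q) \<partial>M)" for k
    by (subst integral_eq_nn_integral) auto
  ultimately have "(\<lambda>k. \<integral>x. norm (\<bar>\<phi> k x - u x\<bar> powr q) \<partial>M) \<longlonglongrightarrow> 0" by simp
  then obtain r :: "nat \<Rightarrow> nat" where r: "strict_mono r" "AE x in M. (\<lambda>k. \<bar>\<phi> (r k) x - u x\<bar> powr q) \<longlonglongrightarrow> 0"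
    using tendsto_L1_AE_subseq[of M "\<lambda>k x. \<bar>\<phi> k x - u x\<bar> powr q"] int by auto
  from r(2) have "AE x in M. (\<lambda>k. \<phi> (r k) x) \<longlonglongrightarrow> u x"
  proof eventually_elim
    case (elim x)
    have "(\<lambda>k. (\<bar>\<phi> (r k) x - u x\<bar> powr q) powr (1 / q)) \<longlonglongrightarrow> 0 powr (1 / q)"
      by (rule tendsto_powr'[OF elim tendsto_const]) (use q in auto)
    then have "(\<lambda>k. \<bar>\<phi> (r k) x - u x\<bar>) \<longlonglongrightarrow> 0" using q by (simp add: powr_powr)
    then show ?case by (simp add: tendsto_rabs_zero_iff LIM_zero_iff)
  qed
  then show ?thesis using r(1) that by blast
qed

context finsler_norm
begin

text \<open>The approximants need not satisfy the constraint, but its left side converges along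
  them: the energy by Minkowski's inequality, the L^p norm by the eigenvalue inequality for the
  error. Rescaling by factors tending to 1 restores the constraint, and Fatou's lemma along an
  almost everywhere convergent subsequence transfers the bound.\<close>

lemma trudinger_moser_of_test_functions:
  fixes \<gamma> p \<beta> K :: real
  assumes dim2: "2 \<le> CARD('n)" and \<gamma>: "0 \<le> \<gamma>" "\<gamma> < gamma_1 F \<Omega> p" and p: "1 < p"
    and \<Omega>: "open \<Omega>"
    and K: "\<And>\<phi> G. test_function \<Omega> \<phi> G \<Longrightarrow> F_energy F \<Omega> G - \<gamma> * Lp_norm \<Omega> p \<phi> ^ CARD('n) \<le> 1 \<Longrightarrow>
     exp_integral \<Omega> \<Lambda> \<beta> \<phi> \<le> K"
    and W: "W0 \<Omega> (real CARD('n)) u g" and le: "F_energy F \<Omega> g - \<gamma> * Lp_norm \<Omega> p u ^ CARD('n) \<le> 1"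
  shows "exp_integral \<Omega> \<Lambda> \<beta> u \<le> K"
proof -
  define N where "N = real CARD('n)"
  define q where "q = N / (N - 1)"
  have N: "2 \<le> N" and q: "1 < q" using dim2 unfolding N_def q_def by auto
  have g1: "0 < gamma_1 F \<Omega> p" using \<gamma> by linarith
  have FN: "F y ^ CARD('n) = F y powr N" for y
    unfolding N_def using F_nonneg by (simp add: powr_realpow_of_nonneg)
  obtain \<psi> H where \<psi>: "\<And>k. test_function \<Omega> (\<psi> k) (H k)"
    "(\<lambda>k. \<integral>\<^sup>+ x. ennreal (\<bar>\<psi> k x - u x\<bar> powr N) \<partial>lebesgue) \<longlonglongrightarrow> 0"
    "(\<lambda>k. \<integral>\<^sup>+ x. ennreal (norm (H k x - g x) powr N) \<partial>lebesgue) \<longlonglongrightarrow> 0"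
    and [measurable]: "u \<in> borel_measurable lebesgue" "g \<in> borel_measurable lebesgue"
    using W unfolding W0_iff N_def by blast
  have "\<forall>\<^sub>F k in sequentially. (\<integral>\<^sup>+ x. ennreal (\<bar>\<psi> k x - u x\<bar> powr N) \<partial>lebesgue) < 1"
    "\<forall>\<^sub>F k in sequentially. (\<integral>\<^sup>+ x. ennreal (norm (H k x - g x) powr N) \<partial>lebesgue) < 1"
    by (rule order_tendstoD[OF \<psi>(2)] order_tendstoD[OF \<psi>(3)]; simp)+
  then have "\<forall>\<^sub>F k in sequentially. (\<integral>\<^sup>+ x. ennreal (\<bar>\<psi> k x - u x\<bar> powr N) \<partial>lebesgue) < 1
      \<and> (\<integral>\<^sup>+ x. ennreal (norm (H k x - g x) powr N) \<partial>lebesgue) < 1"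
    by (rule eventually_conj)
  then obtain k0 where k0: "\<And>k. k0 \<le> k \<Longrightarrow> (\<integral>\<^sup>+ x. ennreal (\<bar>\<psi> k x - u x\<bar> powr N) \<partial>lebesgue) < 1
      \<and> (\<integral>\<^sup>+ x. ennreal (norm (H k x - g x) powr N) \<partial>lebesgue) < 1"
    unfolding eventually_sequentially by blast
  \<comment> \<open>Convergence in \<open>ennreal\<close> allows finitely many infinite terms;
    dropping them makes every error integral finite before passing to real numbers.\<close>
  define \<phi> where "\<phi> k = \<psi> (k + k0)" for k
  define G where "G k = H (k + k0)" for k
  have t: "test_function \<Omega> (\<phi> k) (G k)" for k unfolding \<phi>_def G_def by (rule \<psi>(1))
  have lim: "(\<lambda>k. \<integral>\<^sup>+ x. ennreal (\<bar>\<phi> k x - u x\<bar> powr N) \<partial>lebesgue) \<longlonglongrightarrow> 0"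
    "(\<lambda>k. \<integral>\<^sup>+ x. ennreal (norm (G k x - g x) powr N) \<partial>lebesgue) \<longlonglongrightarrow> 0"
    unfolding \<phi>_def G_def using LIMSEQ_ignore_initial_segment[OF \<psi>(2), of k0]
      LIMSEQ_ignore_initial_segment[OF \<psi>(3), of k0] by simp_all
  have fin: "(\<integral>\<^sup>+ x. ennreal (\<bar>\<phi> k x - u x\<bar> powr N) \<partial>lebesgue) < \<infinity>"
    "(\<integral>\<^sup>+ x. ennreal (norm (G k x - g x) powr N) \<partial>lebesgue) < \<infinity>" for k
    unfolding \<phi>_def G_def using k0[of "k + k0"] less_trans[OF _ ennreal_one_less_top] by auto
  have [measurable]: "\<phi> k \<in> borel_measurable borel" "G k \<in> borel_measurable borel" for k
    using test_function_measurable[OF t] by auto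
  have [measurable]: "\<phi> k \<in> borel_measurable lebesgue" "G k \<in> borel_measurable lebesgue" for k
    by (auto intro: measurable_completion)
  have [measurable]: "\<Omega> \<in> sets borel" "\<Omega> \<in> sets lebesgue" using \<Omega> by (auto intro: sets_completionI_sets)
  have [measurable]: "F \<in> borel_measurable borel" by (rule F_measurable)
  define M where "M = restrict_space lebesgue \<Omega>"
  have int_M: "(\<integral>\<^sup>+x. f x \<partial>M) = (\<integral>\<^sup>+x\<in>\<Omega>. f x \<partial>lebesgue)" for f
    unfolding M_def by (rule nn_integral_restrict_space) simp
  have meas_M: "f \<in> borel_measurable M" if "f \<in> borel_measurable lebesgue" for f :: "real^'n \<Rightarrow> real"
    unfolding M_def using that by (rule measurable_restrict_space1)

  define a where "a k = F_energy F \<Omega> (\<lambda>x. G k x - g x)" for k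
  define e where "e k = F_energy F \<Omega> (G k)" for k
  define E where "E = F_energy F \<Omega> g"
  obtain C where C: "0 < C" "\<And>x. F x \<le> C * norm x" using F_bounds by metis
  have a_le: "(\<integral>\<^sup>+x. ennreal (F (G k x - g x) powr N) \<partial>M)
      \<le> ennreal (C powr N) * (\<integral>\<^sup>+ x. ennreal (norm (G k x - g x) powr N) \<partial>lebesgue)" for k
  proof -
    have "(\<integral>\<^sup>+x. ennreal (F (G k x - g x) powr N) \<partial>M)
        \<le> (\<integral>\<^sup>+ x. ennreal (C powr N) * ennreal (norm (G k x - g x) powr N) \<partial>lebesgue)"
      unfolding int_M
    proof (rule nn_integral_mono)
      fix x
      have "F (G k x - g x) powr N \<le> (C * norm (G k x - g x)) powr N"
        using C F_nonneg N by (intro powr_mono2) auto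
      then have "ennreal (F (G k x - g x) powr N) \<le> ennreal (C powr N) * ennreal (norm (G k x - g x) powr N)"
        using C by (simp add: powr_mult ennreal_mult[symmetric] ennreal_leI)
      then show "ennreal (F (G k x - g x) powr N) * indicator \<Omega> x
        \<le> ennreal (C powr N) * ennreal (norm (G k x - g x) powr N)"
        by (auto simp: indicator_def)
    qed
    also have "\<dots> = ennreal (C powr N) * (\<integral>\<^sup>+ x. ennreal (norm (G k x - g x) powr N) \<partial>lebesgue)"
      by (rule nn_integral_cmult) measurable
    finally show ?thesis .
  qed
  have a: "(\<integral>\<^sup>+x. ennreal (F (G k x - g x) powr N) \<partial>M) = ennreal (a k)" "0 \<le> a k" for k
  proof -
    have "(\<integral>\<^sup>+x. ennreal (F (G k x - g x) powr N) \<partial>M) < top"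
      by (rule le_less_trans[OF a_le]) (use fin(2)[of k] in \<open>simp add: ennreal_mult_less_top\<close>)
    then show "(\<integral>\<^sup>+x. ennreal (F (G k x - g x) powr N) \<partial>M) = ennreal (a k)" "0 \<le> a k"
      unfolding a_def F_energy_def int_M FN by auto
  qed
  have a_lim: "a \<longlonglongrightarrow> 0"
  proof -
    have "(\<lambda>k. ennreal (C powr N) * (\<integral>\<^sup>+ x. ennreal (norm (G k x - g x) powr N) \<partial>lebesgue))
        \<longlonglongrightarrow> ennreal (C powr N) * 0"
      by (intro ennreal_tendsto_cmult lim) simp
    then have z: "(\<lambda>k. ennreal (C powr N) * (\<integral>\<^sup>+ x. ennreal (norm (G k x - g x) powr N) \<partial>lebesgue)) \<longlonglongrightarrow> 0"
      by simp
    have "(\<lambda>k. ennreal (a k)) \<longlonglongrightarrow> 0"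
      by (rule tendsto_sandwich[OF _ _ tendsto_const z])
        (use a_le a(1) in \<open>auto intro!: always_eventually\<close>)
    then have "(\<lambda>k. ennreal (a k)) \<longlonglongrightarrow> ennreal 0" by simp
    then show ?thesis using a(2) by (subst (asm) tendsto_ennreal_iff) auto
  qed
  have e: "(\<integral>\<^sup>+x. ennreal (F (G k x) powr N) \<partial>M) = ennreal (e k)" "0 \<le> e k" for k
  proof -
    have "(\<integral>\<^sup>+x. ennreal (F (G k x) powr N) \<partial>M) \<le> (\<integral>\<^sup>+x. ennreal (F (G k x) ^ CARD('n)) \<partial>lborel)"
      unfolding int_M FN nn_integral_completion by (intro nn_integral_mono) (auto simp: indicator_def)
    then have "(\<integral>\<^sup>+x. ennreal (F (G k x) powr N) \<partial>M) < top"
      unfolding F_energy_test_function[OF t] by (rule le_less_trans) simp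
    then show "(\<integral>\<^sup>+x. ennreal (F (G k x) powr N) \<partial>M) = ennreal (e k)" "0 \<le> e k"
      unfolding e_def F_energy_def int_M FN by auto
  qed
  have mF [measurable]: "(\<lambda>x. F (G k x)) \<in> borel_measurable M" "(\<lambda>x. F (G k x - g x)) \<in> borel_measurable M"
    "(\<lambda>x. F (g x)) \<in> borel_measurable M" for k
    by (intro meas_M measurable_compose[OF _ F_measurable]; measurable)+
  have tri: "F (g x) \<le> F (G k x) + F (G k x - g x)" "F (G k x) \<le> F (g x) + F (G k x - g x)" for k x
    using F_triangle[of "G k x" "g x - G k x"] F_minus[of "G k x - g x"] F_triangle[of "g x" "G k x - g x"]
    by simp_all
  have E: "(\<integral>\<^sup>+x. ennreal (F (g x) powr N) \<partial>M) = ennreal E" "0 \<le> E"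
  proof -
    have "(\<integral>\<^sup>+x. ennreal (F (g x) powr N) \<partial>M) < top"
      using Lp_norm_triangle(1)[OF mF(1) mF(2) F_nonneg F_nonneg F_nonneg e(2)[of 0] a(2)[of 0] _ e(1) a(1) tri(1)] N
      by simp
    then show "(\<integral>\<^sup>+x. ennreal (F (g x) powr N) \<partial>M) = ennreal E" "0 \<le> E"
      unfolding E_def F_energy_def int_M FN by auto
  qed
  have e_lim: "e \<longlonglongrightarrow> E"
  proof (rule tendsto_of_root_diff[where p = N, OF _ e(2) E(2) a(2) _ _ a_lim])
    show "e k powr (1 / N) \<le> E powr (1 / N) + a k powr (1 / N)" for k
      using Lp_norm_triangle(2)[OF mF(3) mF(2) F_nonneg F_nonneg F_nonneg E(2) a(2)[of k] _ E(1) a(1) tri(2)] N e[of k]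
      by simp
    show "E powr (1 / N) \<le> e k powr (1 / N) + a k powr (1 / N)" for k
      using Lp_norm_triangle(2)[OF mF(1) mF(2) F_nonneg F_nonneg F_nonneg e(2)[of k] a(2)[of k] _ e(1) a(1) tri(1)] N E
      by simp
  qed (use N in simp)

  define l where "l k = enn2real (\<integral>\<^sup>+x. ennreal (\<bar>\<phi> k x - u x\<bar> powr p) \<partial>M)" for k
  define P where "P k = enn2real (\<integral>\<^sup>+x. ennreal (\<bar>\<phi> k x\<bar> powr p) \<partial>M)" for k
  define Pu where "Pu = enn2real (\<integral>\<^sup>+x. ennreal (\<bar>u x\<bar> powr p) \<partial>M)"
  have Lp: "Lp_norm \<Omega> p v ^ CARD('n) = enn2real (\<integral>\<^sup>+x. ennreal (\<bar>v x\<bar> powr p) \<partial>M) powr (N / p)" for v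
    unfolding Lp_norm_def int_M N_def by (simp add: powr_realpow_of_nonneg[symmetric] powr_powr)
  have W_diff: "W0 \<Omega> (real CARD('n)) (\<lambda>x. \<phi> k x - u x) (\<lambda>x. G k x - g x)" for k
    by (rule test_function_W0_diff[OF W t])
  have W_t: "W0 \<Omega> (real CARD('n)) (\<phi> k) (G k)" for k
    by (rule test_function_imp_W0[OF t]) simp
  have l: "(\<integral>\<^sup>+x. ennreal (\<bar>\<phi> k x - u x\<bar> powr p) \<partial>M) = ennreal (l k)" "0 \<le> l k"
    and P: "(\<integral>\<^sup>+x. ennreal (\<bar>\<phi> k x\<bar> powr p) \<partial>M) = ennreal (P k)" "0 \<le> P k"
    and Pu: "(\<integral>\<^sup>+x. ennreal (\<bar>u x\<bar> powr p) \<partial>M) = ennreal Pu" "0 \<le> Pu" for k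
    using gamma_1_mult_le(2)[OF W_diff g1, of k] gamma_1_mult_le(2)[OF W_t g1, of k] gamma_1_mult_le(2)[OF W g1]
    unfolding l_def P_def Pu_def int_M by auto
  have l_lim: "l \<longlonglongrightarrow> 0"
  proof -
    \<comment> \<open>The L^p distance to u is controlled by the energy of the gradient difference,
      with constant 1 / \<open>gamma_1\<close>.\<close>
    have l_le: "l k \<le> (a k / gamma_1 F \<Omega> p) powr (p / N)" for k
    proof -
      have "gamma_1 F \<Omega> p * l k powr (N / p) \<le> a k"
        using gamma_1_mult_le(1)[OF W_diff g1, of k] unfolding Lp l_def a_def .
      then have "l k powr (N / p) \<le> a k / gamma_1 F \<Omega> p" using g1 by (simp add: field_simps)
      then have "(l k powr (N / p)) powr (p / N) \<le> (a k / gamma_1 F \<Omega> p) powr (p / N)"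
        using p N by (intro powr_mono2) auto
      then show ?thesis using l(2)[of k] p N by (simp add: powr_powr)
    qed
    have "(\<lambda>k. a k / gamma_1 F \<Omega> p) \<longlonglongrightarrow> 0 / gamma_1 F \<Omega> p"
      using g1 by (intro tendsto_divide a_lim tendsto_const) auto
    then have "(\<lambda>k. (a k / gamma_1 F \<Omega> p) powr (p / N)) \<longlonglongrightarrow> (0 / gamma_1 F \<Omega> p) powr (p / N)"
      by (rule tendsto_powr'[OF _ tendsto_const]) (use a(2) g1 p N in auto)
    then have z: "(\<lambda>k. (a k / gamma_1 F \<Omega> p) powr (p / N)) \<longlonglongrightarrow> 0" by simp
    show ?thesis
      by (intro real_tendsto_sandwich[OF _ _ tendsto_const z] always_eventually allI l l_le)
  qed
  have mu [measurable]: "(\<lambda>x. \<bar>\<phi> k x\<bar>) \<in> borel_measurable M" "(\<lambda>x. \<bar>u x\<bar>) \<in> borel_measurable M"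
    "(\<lambda>x. \<bar>\<phi> k x - u x\<bar>) \<in> borel_measurable M" for k
    by (intro meas_M; measurable)+
  have P_lim: "P \<longlonglongrightarrow> Pu"
  proof (rule tendsto_of_root_diff[where p = p, OF _ P(2) Pu(2) l(2) _ _ l_lim])
    show "P k powr (1 / p) \<le> Pu powr (1 / p) + l k powr (1 / p)" for k
      unfolding P_def
      by (rule Lp_norm_triangle(2)[OF mu(2) mu(3) _ _ _ Pu(2) l(2) _ Pu(1) l(1)]) (use p in auto)
    show "Pu powr (1 / p) \<le> P k powr (1 / p) + l k powr (1 / p)" for k
      unfolding Pu_def
      by (rule Lp_norm_triangle(2)[OF mu(1) mu(3) _ _ _ P(2) l(2) _ P(1) l(1)]) (use p in auto)
  qed (use p in simp)

  define D where "D k = e k - \<gamma> * P k powr (N / p)" for k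
  have "D \<longlonglongrightarrow> E - \<gamma> * Pu powr (N / p)"
    unfolding D_def
    by (intro tendsto_diff e_lim tendsto_mult tendsto_const tendsto_powr'[OF P_lim tendsto_const])
      (use p N P(2) in auto)
  then have "(\<lambda>k. max 1 (D k)) \<longlonglongrightarrow> max 1 (E - \<gamma> * Pu powr (N / p))"
    by (intro tendsto_max tendsto_const)
  moreover have "max 1 (E - \<gamma> * Pu powr (N / p)) = 1"
    using le unfolding Lp E_def[symmetric] Pu_def[symmetric] by simp
  ultimately have D_lim: "(\<lambda>k. max 1 (D k)) \<longlonglongrightarrow> 1" by simp
  \<comment> \<open>Both terms of D are homogeneous of degree N, so scaling by s k turns D k into D
    k / max 1 (D k) \<le> 1. The maximum leaves approximants with D k \<le> 1 untouched, including
    those with negative D k.\<close>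
  define s where "s k = max 1 (D k) powr (- (1 / N))" for k
  have s: "0 < s k" "s k powr N = 1 / max 1 (D k)" for k
  proof -
    show "0 < s k" unfolding s_def by simp
    have "s k powr N = max 1 (D k) powr (- 1)" unfolding s_def powr_powr using N by simp
    then show "s k powr N = 1 / max 1 (D k)" by (simp add: powr_minus_divide)
  qed
  have "s \<longlonglongrightarrow> 1 powr (- (1 / N))"
    unfolding s_def by (intro tendsto_powr D_lim tendsto_const) simp
  then have s_lim: "s \<longlonglongrightarrow> 1" by simp
  have bound: "(\<integral>\<^sup>+x. ennreal (exp (\<Lambda> * \<bar>s k * \<phi> k x\<bar> powr q) * \<rho> x powr (- \<beta>)) * indicator \<Omega> x \<partial>lborel) \<le> K" for k
    unfolding q_def N_def
  proof (rule K[unfolded exp_integral_def])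
    show T: "test_function \<Omega> (\<lambda>x. s k * \<phi> k x) (\<lambda>x. s k *\<^sub>R G k x)" by (rule test_function_scale[OF t])
    have "F_energy F \<Omega> (\<lambda>x. s k *\<^sub>R G k x) = s k powr N * e k"
    proof -
      have "(\<integral>\<^sup>+x. ennreal (F (s k *\<^sub>R G k x) powr N) \<partial>M) = (\<integral>\<^sup>+x. ennreal (s k powr N) * ennreal (F (G k x) powr N) \<partial>M)"
        using s(1)[of k] F_nonneg by (intro nn_integral_cong) (simp add: F_scale powr_mult ennreal_mult)
      also have "\<dots> = ennreal (s k powr N * e k)"
        using e[of k] by (subst nn_integral_cmult) (simp_all add: ennreal_mult)
      finally show ?thesis unfolding F_energy_def int_M[symmetric] FN using e(2)[of k] by simp
    qed
    moreover have "Lp_norm \<Omega> p (\<lambda>x. s k * \<phi> k x) ^ CARD('n) = s k powr N * P k powr (N / p)"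
    proof -
      have "(\<integral>\<^sup>+x. ennreal (\<bar>s k * \<phi> k x\<bar> powr p) \<partial>M) = (\<integral>\<^sup>+x. ennreal (s k powr p) * ennreal (\<bar>\<phi> k x\<bar> powr p) \<partial>M)"
        using s(1)[of k] by (intro nn_integral_cong) (simp add: abs_mult powr_mult ennreal_mult)
      also have "\<dots> = ennreal (s k powr p * P k)"
        using P[of k] by (subst nn_integral_cmult) (simp_all add: ennreal_mult)
      finally show ?thesis unfolding Lp using P(2)[of k] p s(1)[of k] by (simp add: powr_mult powr_powr)
    qed
    ultimately have "F_energy F \<Omega> (\<lambda>x. s k *\<^sub>R G k x) - \<gamma> * Lp_norm \<Omega> p (\<lambda>x. s k * \<phi> k x) ^ CARD('n)
        = D k / max 1 (D k)"
      unfolding D_def[of k] s(2) by (simp add: algebra_simps diff_divide_distrib)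
    also have "\<dots> \<le> 1" by (simp add: divide_le_eq)
    finally show "F_energy F \<Omega> (\<lambda>x. s k *\<^sub>R G k x) - \<gamma> * Lp_norm \<Omega> p (\<lambda>x. s k * \<phi> k x) ^ CARD('n) \<le> 1" .
  qed
  obtain r where r: "strict_mono r" "AE x in lebesgue. (\<lambda>k. \<phi> (r k) x) \<longlonglongrightarrow> u x"
    by (rule AE_subseq_of_Lp_tendsto[where M = lebesgue and q = N, OF _ _ _ fin(1) lim(1)]) (use N in auto)
  have "(\<integral>\<^sup>+x. ennreal (exp (\<Lambda> * \<bar>u x\<bar> powr q) * \<rho> x powr (- \<beta>)) * indicator \<Omega> x \<partial>lebesgue) \<le> K"
  proof (rule nn_integral_le_of_AE_tendsto)
    show "(\<lambda>x. ennreal (exp (\<Lambda> * \<bar>s (r k) * \<phi> (r k) x\<bar> powr q) * \<rho> x powr (- \<beta>)) * indicator \<Omega> x)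
        \<in> borel_measurable lebesgue" for k
      by (rule measurable_completion) measurable
    show "(\<integral>\<^sup>+x. ennreal (exp (\<Lambda> * \<bar>s (r k) * \<phi> (r k) x\<bar> powr q) * \<rho> x powr (- \<beta>)) * indicator \<Omega> x \<partial>lebesgue) \<le> K" for k
      unfolding nn_integral_completion by (rule bound)
    show "AE x in lebesgue. (\<lambda>k. ennreal (exp (\<Lambda> * \<bar>s (r k) * \<phi> (r k) x\<bar> powr q) * \<rho> x powr (- \<beta>)) * indicator \<Omega> x)
      \<longlonglongrightarrow> ennreal (exp (\<Lambda> * \<bar>u x\<bar> powr q) * \<rho> x powr (- \<beta>)) * indicator \<Omega> x"
      using r(2)
    proof eventually_elim
      case (elim x)
      have "(\<lambda>k. s (r k)) \<longlonglongrightarrow> 1" using LIMSEQ_subseq_LIMSEQ[OF s_lim r(1)] by (simp add: o_def)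
      then have "(\<lambda>k. \<bar>s (r k) * \<phi> (r k) x\<bar>) \<longlonglongrightarrow> \<bar>1 * u x\<bar>" by (intro tendsto_intros elim)
      then have "(\<lambda>k. \<bar>s (r k) * \<phi> (r k) x\<bar> powr q) \<longlonglongrightarrow> \<bar>1 * u x\<bar> powr q"
        by (rule tendsto_powr'[OF _ tendsto_const]) (use q in auto)
      then have "(\<lambda>k. ennreal (exp (\<Lambda> * \<bar>s (r k) * \<phi> (r k) x\<bar> powr q) * \<rho> x powr (- \<beta>)))
        \<longlonglongrightarrow> ennreal (exp (\<Lambda> * (\<bar>1 * u x\<bar> powr q)) * \<rho> x powr (- \<beta>))"
        by (intro tendsto_ennrealI tendsto_mult tendsto_exp tendsto_const)
      then show ?case by (cases "x \<in> \<Omega>") simp_all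
    qed
  qed
  then show ?thesis unfolding exp_integral_def q_def N_def nn_integral_completion .
qed

end

theorem theorem1p1:
  fixes F :: "real^'n \<Rightarrow> real" and \<Omega> :: "(real^'n) set"
    and \<gamma> \<beta> p :: real
  assumes "CARD('n) \<ge> 2"
    and "anisotropic_F F"
    and "smooth_bounded_domain \<Omega>" and "0 \<in> \<Omega>"
    and "0 \<le> \<gamma>" and "\<gamma> < gamma_1 F \<Omega> p"
    and "0 \<le> \<beta>" and "\<beta> < real CARD('n)"
    and "p > 1"
  shows "(SUP ug \<in> {(u, g). W0 \<Omega> (real CARD('n)) u g \<and> gamma_norm F \<Omega> \<gamma> p u g \<le> 1}.
            \<integral>\<^sup>+ x\<in>\<Omega>. ennreal (exp (lambda_N F * (1 - \<beta> / real CARD('n))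
                     * \<bar>fst ug x\<bar> powr (real CARD('n) / (real CARD('n) - 1)))
                   / polar_F F x powr \<beta>) \<partial>lebesgue) < \<infinity>"
proof -
  interpret finsler_norm F by (rule finsler_norm_of_anisotropic) fact
  have \<Omega>: "open \<Omega>" "bounded \<Omega>" using assms(3) unfolding smooth_bounded_domain_def by auto
  obtain K where K: "\<And>\<phi> G. test_function \<Omega> \<phi> G \<Longrightarrow> F_energy F \<Omega> G - \<gamma> * Lp_norm \<Omega> p \<phi> ^ CARD('n) \<le> 1 \<Longrightarrow>
     exp_integral \<Omega> (lambda_N F * (1 - \<beta> / real CARD('n))) \<beta> \<phi> \<le> ennreal K"
    using test_function_trudinger_moser[OF assms(1,5,6,9,7,8) \<Omega>] by blast
  have "(\<integral>\<^sup>+ x\<in>\<Omega>. ennreal (exp (lambda_N F * (1 - \<beta> / real CARD('n))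
          * \<bar>u x\<bar> powr (real CARD('n) / (real CARD('n) - 1))) / polar_F F x powr \<beta>) \<partial>lebesgue) \<le> ennreal K"
    if W: "W0 \<Omega> (real CARD('n)) u g" and n: "gamma_norm F \<Omega> \<gamma> p u g \<le> 1" for u g
  proof -
    define D where "D = F_energy F \<Omega> g - \<gamma> * Lp_norm \<Omega> p u ^ CARD('n)"
    \<comment> \<open>Arguing by contradiction evaluates the N-th root only at D > 1, so no value of
      \<open>powr\<close> at a negative number enters.\<close>
    have "D \<le> 1"
    proof (rule ccontr)
      assume "\<not> D \<le> 1"
      then have "1 < D powr (1 / real CARD('n))" by (intro gr_one_powr) auto
      then show False using n unfolding gamma_norm_def D_def by simp
    qed
    from trudinger_moser_of_test_functions[OF assms(1,5,6,9) \<Omega>(1) K W this[unfolded D_def]]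
    show ?thesis unfolding exp_integral_def nn_integral_completion by (simp add: powr_minus_divide)
  qed
  then have "(SUP ug \<in> {(u, g). W0 \<Omega> (real CARD('n)) u g \<and> gamma_norm F \<Omega> \<gamma> p u g \<le> 1}.
            \<integral>\<^sup>+ x\<in>\<Omega>. ennreal (exp (lambda_N F * (1 - \<beta> / real CARD('n))
                     * \<bar>fst ug x\<bar> powr (real CARD('n) / (real CARD('n) - 1)))
                   / polar_F F x powr \<beta>) \<partial>lebesgue) \<le> ennreal K"
    by (intro SUP_least) auto
  then show ?thesis by (rule le_less_trans) simp
qed

end
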